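(* Let $K$ be a commutative ring with identity and let $q\in K$ be invertible. The tower of affine Temperley-Lieb algebras $$TL\tilde B_2(q)\xrightarrow{Q_2}TL\tilde B_3(q)\longrightarrow\cdots\longrightarrow TL\tilde B_n(q)\xrightarrow{Q_n}TL\tilde B_{n+1}(q)\longrightarrow\cdots$$ is a tower of faithful arrows; that is, $Q_n$ is injective for every $n\ge 2$.
   Context: For $x,y$ in a ring with identity put $V(x,y)=xyx+xy+yx+x+y+1$ and $Z(x,y)=xyxy+xyx+yxy+xy+yx+x+y+1$. For $n\ge 2$, $TL\tilde B_{n+1}(q)$ is the $K$-algebra with generators $T_{\sigma_{\bar 1}},T_{\sigma_1},\dots,T_{\sigma_n},T_{t_{n+1}}$ and relations: $T_{\sigma_i}T_{\sigma_j}=T_{\sigma_j}T_{\sigma_i}$ for $1\le i,j\le n$, $|i-j|\ge2$; $T_{\sigma_i}T_{t_{n+1}}=T_{t_{n+1}}T_{\sigma_i}$ for $1\le i\le n-1$; $T_{\sigma_i}T_{\sigma_{i+1}}T_{\sigma_i}=T_{\sigma_{i+1}}T_{\sigma_i}T_{\sigma_{i+1}}$ for $1\le i\le n-1$; $T_{\sigma_{\bar 1}}T_{\sigma_2}T_{\sigma_{\bar 1}}=T_{\sigma_2}T_{\sigma_{\bar 1}}T_{\sigma_2}$; $T_{\sigma_{\bar 1}}T_{t_{n+1}}=T_{t_{n+1}}T_{\sigma_{\bar 1}}$ and $T_{\sigma_{\bar 1}}T_{\sigma_i}=T_{\sigma_i}T_{\sigma_{\bar 1}}$ for $1\le i\le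 n$, $i\ne2$; $T_{t_{n+1}}T_{\sigma_n}T_{t_{n+1}}T_{\sigma_n}=T_{\sigma_n}T_{t_{n+1}}T_{\sigma_n}T_{t_{n+1}}$; $T^2=(q-1)T+q$ for every generator $T$; $V(T_{\sigma_{\bar 1}},T_{\sigma_2})=0$, $V(T_{\sigma_i},T_{\sigma_{i+1}})=0$ for $1\le i\le n-1$, and $Z(T_{\sigma_n},T_{t_{n+1}})=0$. Each generator is invertible since $q$ is. One sets $TL\tilde B_2(q)=K$. For $n\ge 3$, writing $h$ instead of $T$ for the generators of $TL\tilde B_n(q)$, $Q_n:TL\tilde B_n(q)\to TL\tilde B_{n+1}(q)$ is the $K$-algebra morphism given by $h_{\sigma_i}\mapsto T_{\sigma_i}$ for $1\le i\le n-1$, $h_{\sigma_{\bar 1}}\mapsto T_{\sigma_{\bar 1}}$, $h_{t_n}\mapsto T_{\sigma_n}T_{t_{n+1}}T_{\sigma_n}^{-1}$ (this is well defined). $Q_2:K\to TL\tilde B_3(q)$ is the unit morphism. *)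

theory Defs
  imports "HOL-Algebra.QuotRing" "HOL-Library.Poly_Mapping"
begin

section \<open>Free associative algebras\<close>

text \<open>The free monoid of words, written additively (although it is not commutative) because
  \<^type>\<open>poly_mapping\<close> takes its convolution product over \<^class>\<open>monoid_add\<close>.  Thus
  \<open>'g fmon \<Rightarrow>\<^sub>0 'k\<close>, with its class structure of \<^class>\<open>ring_1\<close>, is the free associative
  unital algebra over \<open>'k\<close> on the set of all elements of \<open>'g\<close>.\<close>

datatype 'g fmon = Word (letters: "'g list")

instantiation fmon :: (type) monoid_add
begin

definition zero_fmon :: "'a fmon" where
  "zero_fmon = Word []"

definition plus_fmon :: "'a fmon \<Rightarrow> 'a fmon \<Rightarrow> 'a fmon" where
  "plus_fmon u v = Word (letters u @ letters v)"

instance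
  by standard (simp_all add: zero_fmon_def plus_fmon_def)

end

definition scal :: "'k::comm_ring_1 \<Rightarrow> 'g fmon \<Rightarrow>\<^sub>0 'k" where
  "scal c = Poly_Mapping.single 0 c"

definition gvar :: "'g \<Rightarrow> 'g fmon \<Rightarrow>\<^sub>0 'k::comm_ring_1" where
  "gvar g = Poly_Mapping.single (Word [g]) 1"

definition free_alg :: "'g set \<Rightarrow> ('g fmon \<Rightarrow>\<^sub>0 'k::comm_ring_1) ring" where
  "free_alg S =
    \<lparr>carrier = {p. \<forall>w\<in>Poly_Mapping.keys p. set (letters w) \<subseteq> S},
     mult = (*), one = 1, zero = 0, add = (+)\<rparr>"

lemma free_alg_simps [simp]:
  "mult (free_alg S) = (*)" "one (free_alg S) = 1"
  "zero (free_alg S) = 0" "add (free_alg S) = (+)"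
  by (simp_all add: free_alg_def)

lemma free_alg_carrier:
  "p \<in> carrier (free_alg S) \<longleftrightarrow> (\<forall>w\<in>Poly_Mapping.keys p. set (letters w) \<subseteq> S)"
  by (simp add: free_alg_def)

lemma keys_uminus: "Poly_Mapping.keys (- p) = Poly_Mapping.keys (p :: 'a \<Rightarrow>\<^sub>0 'k::ab_group_add)"
  by (auto simp: in_keys_iff)

context
  fixes S :: "'g set" and A :: "('g fmon \<Rightarrow>\<^sub>0 'k::comm_ring_1) set"
  defines "A \<equiv> carrier (free_alg S)"
begin

lemma free_alg_consts: "0 \<in> A" "1 \<in> A" "scal c \<in> A" "g \<in> S \<Longrightarrow> gvar g \<in> A"
  by (auto simp: A_def free_alg_carrier scal_def gvar_def zero_fmon_def)

lemma free_alg_uminus: "p \<in> A \<Longrightarrow> - p \<in> A"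
  by (simp add: A_def free_alg_carrier keys_uminus)

lemma free_alg_add: "p \<in> A \<Longrightarrow> r \<in> A \<Longrightarrow> p + r \<in> A"
  using Poly_Mapping.keys_add[of p r] unfolding A_def free_alg_carrier by blast

lemma free_alg_diff: "p \<in> A \<Longrightarrow> r \<in> A \<Longrightarrow> p - r \<in> A"
  using free_alg_add[of p "- r"] free_alg_uminus[of r] by simp

lemma free_alg_mult: "p \<in> A \<Longrightarrow> r \<in> A \<Longrightarrow> p * r \<in> A"
  using Poly_Mapping.keys_mult[of p r] unfolding A_def free_alg_carrier
  by (fastforce simp: plus_fmon_def)

end

lemmas free_alg_closed [intro, simp] =
  free_alg_consts free_alg_uminus free_alg_add free_alg_diff free_alg_mult

lemma ring_free_alg: "Ring.ring (free_alg S)"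
proof (rule ringI)
  show "abelian_group (free_alg S)"
  proof (rule abelian_groupI)
    fix x assume "x \<in> carrier (free_alg S)"
    then show "\<exists>y\<in>carrier (free_alg S). y \<oplus>\<^bsub>free_alg S\<^esub> x = \<zero>\<^bsub>free_alg S\<^esub>"
      by (intro bexI[of _ "- x"]) auto
  qed (auto simp: algebra_simps)
  show "Group.monoid (free_alg S)"
    by (rule Group.monoidI) (auto simp: algebra_simps)
qed (auto simp: algebra_simps)


section \<open>The affine Temperley--Lieb algebras\<close>

definition TL_V :: "'a::ring_1 \<Rightarrow> 'a \<Rightarrow> 'a" where
  "TL_V x y = x*y*x + x*y + y*x + x + y + 1"

definition TL_Z :: "'a::ring_1 \<Rightarrow> 'a \<Rightarrow> 'a" where
  "TL_Z x y = x*y*x*y + x*y*x + y*x*y + x*y + y*x + x + y + 1"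

datatype gen = SigmaBar | Sigma nat | Tee nat

text \<open>In the algebra with index \<open>N = n + 1\<close> the nodes \<open>\<sigma>\<^sub>i\<close> run over \<open>1 \<le> i \<le> n\<close>, that is
  over \<open>1 \<le> i < N\<close>, and the last generator is \<open>t\<^sub>N\<close>.  The presentation is meant for \<open>N \<ge> 3\<close>.\<close>

definition TLB_gens :: "nat \<Rightarrow> gen set" where
  "TLB_gens N = {SigmaBar} \<union> Sigma ` {1..<N} \<union> {Tee N}"

text \<open>A relation \<open>l = r\<close> is recorded as the element \<open>l - r\<close> of the free algebra.\<close>

definition TLB_rels :: "'k::comm_ring_1 \<Rightarrow> nat \<Rightarrow> (gen fmon \<Rightarrow>\<^sub>0 'k) set" where
  "TLB_rels q N =
    (let n = N - 1; b = gvar SigmaBar; s = (\<lambda>i. gvar (Sigma i)); t = gvar (Tee N) in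
      {s i * s j - s j * s i | i j. 1 \<le> i \<and> i \<le> n \<and> 1 \<le> j \<and> j \<le> n \<and> \<bar>int i - int j\<bar> \<ge> 2}
    \<union> {s i * t - t * s i | i. 1 \<le> i \<and> i \<le> n - 1}
    \<union> {s i * s (i+1) * s i - s (i+1) * s i * s (i+1) | i. 1 \<le> i \<and> i \<le> n - 1}
    \<union> {b * s 2 * b - s 2 * b * s 2}
    \<union> {b * t - t * b}
    \<union> {b * s i - s i * b | i. 1 \<le> i \<and> i \<le> n \<and> i \<noteq> 2}
    \<union> {t * s n * t * s n - s n * t * s n * t}
    \<union> {gvar g * gvar g - (scal (q - 1) * gvar g + scal q) | g. g \<in> TLB_gens N}
    \<union> {TL_V b (s 2)}
    \<union> {TL_V (s i) (s (i+1)) | i. 1 \<le> i \<and> i \<le> n - 1}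
    \<union> {TL_Z (s n) t})"

definition TLB_ideal :: "'k::comm_ring_1 \<Rightarrow> nat \<Rightarrow> (gen fmon \<Rightarrow>\<^sub>0 'k) set" where
  "TLB_ideal q N = Idl\<^bsub>free_alg (TLB_gens N)\<^esub> (TLB_rels q N)"

definition TLB :: "'k::comm_ring_1 \<Rightarrow> nat \<Rightarrow> (gen fmon \<Rightarrow>\<^sub>0 'k) set ring" where
  "TLB q N = free_alg (TLB_gens N) Quot TLB_ideal q N"

text \<open>The structure map of the algebra over \<open>'k\<close> is also the unit morphism; for \<open>N = 3\<close> it is
  the first arrow of the tower, whose source is the coefficient ring \<open>'k\<close> itself.\<close>

definition TLB_unit :: "'k::comm_ring_1 \<Rightarrow> nat \<Rightarrow> 'k \<Rightarrow> (gen fmon \<Rightarrow>\<^sub>0 'k) set" where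
  "TLB_unit q N c = TLB_ideal q N +>\<^bsub>free_alg (TLB_gens N)\<^esub> scal c"

definition TLB_gen :: "'k::comm_ring_1 \<Rightarrow> nat \<Rightarrow> gen \<Rightarrow> (gen fmon \<Rightarrow>\<^sub>0 'k) set" where
  "TLB_gen q N g = TLB_ideal q N +>\<^bsub>free_alg (TLB_gens N)\<^esub> gvar g"

lemma TLB_rels_carrier:
  assumes "N \<ge> 3"
  shows "TLB_rels q N \<subseteq> carrier (free_alg (TLB_gens N))"
proof -
  have "SigmaBar \<in> TLB_gens N" "Tee N \<in> TLB_gens N"
    and "\<And>i. 1 \<le> i \<Longrightarrow> i \<le> N - 1 \<Longrightarrow> Sigma i \<in> TLB_gens N"
    using assms by (auto simp: TLB_gens_def)
  then show ?thesis
    using assms unfolding TLB_rels_def Let_def TL_V_def TL_Z_def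
    by (auto intro!: free_alg_closed)
qed

lemma ideal_TLB_ideal: "N \<ge> 3 \<Longrightarrow> ideal (TLB_ideal q N) (free_alg (TLB_gens N))"
  unfolding TLB_ideal_def
  by (rule ring.genideal_ideal[OF ring_free_alg TLB_rels_carrier])

lemma ring_TLB: "N \<ge> 3 \<Longrightarrow> Ring.ring (TLB q N)"
  unfolding TLB_def by (rule ideal.quotient_is_ring[OF ideal_TLB_ideal])

text \<open>\<open>TLB_arrow q n Q\<close>: \<open>Q\<close> is the morphism of \<open>'k\<close>-algebras from the algebra with index \<open>n\<close> to the
  one with index \<open>n + 1\<close> (for \<open>n \<ge> 3\<close>) with the prescribed values on the generators.\<close>

definition TLB_arrow ::
    "'k::comm_ring_1 \<Rightarrow> nat \<Rightarrow> ((gen fmon \<Rightarrow>\<^sub>0 'k) set \<Rightarrow> (gen fmon \<Rightarrow>\<^sub>0 'k) set) \<Rightarrow> bool" where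
  "TLB_arrow q n Q \<longleftrightarrow>
    Q \<in> ring_hom (TLB q n) (TLB q (n+1)) \<and>
    (\<forall>c. Q (TLB_unit q n c) = TLB_unit q (n+1) c) \<and>
    (\<forall>i. 1 \<le> i \<and> i \<le> n - 1 \<longrightarrow> Q (TLB_gen q n (Sigma i)) = TLB_gen q (n+1) (Sigma i)) \<and>
    Q (TLB_gen q n SigmaBar) = TLB_gen q (n+1) SigmaBar \<and>
    Q (TLB_gen q n (Tee n)) =
      TLB_gen q (n+1) (Sigma n) \<otimes>\<^bsub>TLB q (n+1)\<^esub> TLB_gen q (n+1) (Tee (n+1))
        \<otimes>\<^bsub>TLB q (n+1)\<^esub> inv\<^bsub>TLB q (n+1)\<^esub> TLB_gen q (n+1) (Sigma n)"

end

theory Submission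
  imports Defs "HOL-Library.Multiset"
begin

text \<open>Put \<open>e\<^sub>a = T\<^sub>a + 1\<close>.  For these generators the relations are binomial: \<open>e\<^sub>a e\<^sub>a = (q + 1) e\<^sub>a\<close>, for adjacent
  nodes \<open>e\<^sub>a e\<^sub>b e\<^sub>a = q e\<^sub>a\<close> or \<open>e\<^sub>a e\<^sub>b e\<^sub>a e\<^sub>b = 2 q e\<^sub>a e\<^sub>b\<close> (at the double bond), and commutations.  Read from left to
  right, the relations that are not commutations form a rewriting system that is confluent modulo the commutations.
  Hence the irreducible words modulo commutations form a basis, and each of them has a coefficient functional.

  Write \<open>p\<close>, \<open>e\<close> for the generators at \<open>\<sigma>\<^sub>n\<^sub>-\<^sub>1\<close>, \<open>\<sigma>\<^sub>n\<close>.  Conjugated by \<open>T\<close> at \<open>\<sigma>\<^sub>n\<close>, the morphism \<open>Q\<^sub>n\<close> replaces \<open>t\<^sub>n\<close> by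
  \<open>t\<^sub>n\<^sub>+\<^sub>1\<close>, maps \<open>p\<close> to \<open>p - p e - q\<^sup>-\<^sup>1 e p + e\<close>, and fixes the other generators.  In the image of an irreducible
  word one can choose \<open>p e\<close> or \<open>e p\<close> for every occurrence of \<open>p\<close> such that the resulting word is irreducible
  again; the original word is recovered from it by erasing \<open>e\<close>.  So for a combination of irreducible words the
  coefficient functional of such a leading word, taken for a word of maximal length, detects exactly one
  coefficient, multiplied by a unit.\<close>

section \<open>Words modulo commutations\<close>

text \<open>The ring is arbitrary, so \<open>2 * q\<close> may vanish and a coefficient created by a
  reduction cannot be trusted to be nonzero. Hence the leading word has to be irreducible as it
  stands; its coefficient is then a product of factors -1 and -1/q, a unit over every ring. The
  obstacle is that the choice at an occurrence of p serves the gaps on both of its sides, while each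
  gap dictates the choices at both of its ends. That these demands agree is a fact about irreducible
  words on the forked graph: a gap between consecutive p without t_n has to run down to the fork and
  back, which restricts the neighbouring gaps.

  The conjugation keeps the expansion small: the image of t_n under Q_n is a product of three
  factors, whereas afterwards every letter except p goes to a single letter. The four terms for p
  are the expansion of T^-1 p T with e p e replaced by q e.

  The algebras are never realized as modules on irreducible words. A coefficient functional
  suffices, because the largest two-sided ideal inside its kernel already contains the
  relations.\<close>

text \<open>The locale describes words in generators with \<open>a a = d a\<close>, with \<open>a b a = k3 a\<close> if \<open>m a b = 3\<close>, with
  \<open>a b a b = k4 a b\<close> if \<open>m a b = 4\<close>, and with \<open>a b = b a\<close> if \<open>m a b = 2\<close>.\<close>

locale coxeter_words =
  fixes m :: "'a \<Rightarrow> 'a \<Rightarrow> nat" and d k3 k4 :: "'k::comm_ring_1"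
  assumes m_sym: "m a b = m b a" and m_eq_1: "m a b = 1 \<longleftrightarrow> a = b"
begin

text \<open>Dependence in the sense of trace monoids. It is reflexive because the diagonal of
  \<open>m\<close> has the value 1, so equal letters are never swapped.\<close>

definition dep :: "'a \<Rightarrow> 'a \<Rightarrow> bool" where
  "dep a b \<longleftrightarrow> m a b \<noteq> 2"

lemma dep_sym: "dep a b \<longleftrightarrow> dep b a"
  by (simp add: dep_def m_sym)

lemma dep_refl [simp]: "dep a a"
proof -
  have "m a a = 1" using m_eq_1[of a a] by simp
  then show ?thesis by (simp add: dep_def)
qed

inductive swap :: "'a list \<Rightarrow> 'a list \<Rightarrow> bool" where
  "\<not> dep a b \<Longrightarrow> swap (u @ [a,b] @ v) (u @ [b,a] @ v)"

abbreviation comm_eq :: "'a list \<Rightarrow> 'a list \<Rightarrow> bool" where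
  "comm_eq \<equiv> swap\<^sup>*\<^sup>*"

lemma swap_sym: "swap u v \<Longrightarrow> swap v u"
  by (induction rule: swap.induct) (simp add: swap.intros dep_sym del: append.simps)

lemma comm_eq_sym: "comm_eq u v \<Longrightarrow> comm_eq v u"
  by (induction rule: rtranclp_induct) (auto intro: swap_sym converse_rtranclp_into_rtranclp)

lemma swap_context: "swap u v \<Longrightarrow> swap (x @ u @ y) (x @ v @ y)"
proof (induction rule: swap.induct)
  case (1 a b u v)
  from swap.intros[OF this, of "x @ u" "v @ y"] show ?case by simp
qed

lemma comm_eq_context: "comm_eq u v \<Longrightarrow> comm_eq (x @ u @ y) (x @ v @ y)"
  by (induction rule: rtranclp_induct) (auto intro: swap_context rtranclp.rtrancl_into_rtrancl)

lemma comm_eq_mset: "comm_eq u v \<Longrightarrow> mset u = mset v"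
  by (induction rule: rtranclp_induct) (auto elim!: swap.cases)

lemma comm_eq_move_left: "\<forall>x\<in>set xs. \<not> dep x s \<Longrightarrow> comm_eq (u @ xs @ s # v) (u @ s # xs @ v)"
proof (induction xs arbitrary: u)
  case (Cons x xs)
  have "comm_eq (u @ (x # xs) @ s # v) (u @ x # s # xs @ v)"
    using Cons.IH[of "u @ [x]"] Cons.prems by simp
  moreover have "swap (u @ x # s # xs @ v) (u @ s # x # xs @ v)"
    using swap.intros[of x s u "xs @ v"] Cons.prems by simp
  ultimately show ?case by (simp add: rtranclp.rtrancl_into_rtrancl)
qed simp

lemma comm_eq_move_right: "\<forall>x\<in>set xs. \<not> dep x s \<Longrightarrow> comm_eq (u @ s # xs @ v) (u @ xs @ s # v)"
  by (rule comm_eq_sym) (rule comm_eq_move_left)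

text \<open>\<open>red w c w'\<close>: the monomial of \<open>w\<close> equals \<open>c\<close> times the one of \<open>w'\<close>.\<close>

inductive red :: "'a list \<Rightarrow> 'k \<Rightarrow> 'a list \<Rightarrow> bool" where
  red_refl: "red w 1 w"
| red_swap: "swap w w'' \<Longrightarrow> red w'' c w' \<Longrightarrow> red w c w'"
| red_1: "red (u @ [s] @ v) c w' \<Longrightarrow> red (u @ [s,s] @ v) (d * c) w'"
| red_3: "m s t = 3 \<Longrightarrow> red (u @ [s] @ v) c w' \<Longrightarrow> red (u @ [s,t,s] @ v) (k3 * c) w'"
| red_4: "m s t = 4 \<Longrightarrow> red (u @ [s,t] @ v) c w' \<Longrightarrow> red (u @ [s,t,s,t] @ v) (k4 * c) w'"

lemma red_comm_eq: "comm_eq w w'' \<Longrightarrow> red w'' c w' \<Longrightarrow> red w c w'"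
  by (induction rule: converse_rtranclp_induct) (auto intro: red_swap)

lemma red_trans: "red u c v \<Longrightarrow> red v c' w \<Longrightarrow> red u (c * c') w"
  proof (induction rule: red.induct)
  case (red_1 u s v c w')
  then show ?case using red.red_1[of u s v "c * c'" w] by (simp add: mult.assoc)
next
  case (red_3 s t u v c w')
  then show ?case using red.red_3[of s t u v "c * c'" w] by (simp add: mult.assoc)
next
  case (red_4 s t u v c w')
  then show ?case using red.red_4[of s t u v "c * c'" w] by (simp add: mult.assoc)
qed (auto intro: red_swap)

lemma red_mset: "red w c w' \<Longrightarrow> mset w' \<subseteq># mset w"
proof (induction rule: red.induct)
  case (red_swap w w'' c w')
  then show ?case using comm_eq_mset[of w w''] by (metis r_into_rtranclp)
next
  case (red_1 u s v c w')
  then show ?case using subset_mset.order_trans[of "mset w'" "mset (u @ [s] @ v)" "mset (u @ [s,s] @ v)"] by simp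
next
  case (red_3 s t u v c w')
  then show ?case using subset_mset.order_trans[of "mset w'" "mset (u @ [s] @ v)" "mset (u @ [s,t,s] @ v)"] by simp
next
  case (red_4 s t u v c w')
  then show ?case using subset_mset.order_trans[of "mset w'" "mset (u @ [s,t] @ v)" "mset (u @ [s,t,s,t] @ v)"] by simp
qed simp

section \<open>Overlapping redexes\<close>

text \<open>A redex is recorded by the positions of its letters, which may be separated by commuting letters.\<close>

datatype redex = R1 nat nat | R2 nat nat nat | R3 nat nat nat nat

fun ids :: "redex \<Rightarrow> nat set" where
  "ids (R1 i j) = {i, j}"
| "ids (R2 i k j) = {i, k, j}"
| "ids (R3 i k j l) = {i, k, j, l}"

text \<open>Reducing a redex means to delete some of its letters.  Each of the following choices gives the same word up to
  commutations; this freedom makes most overlapping redexes commute.\<close>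

fun dels :: "redex \<Rightarrow> nat set set" where
  "dels (R1 i j) = {{i}, {j}}"
| "dels (R2 i k j) = {{i, k}, {k, j}}"
| "dels (R3 i k j l) = {{i, k}, {k, j}, {j, l}}"

fun coef :: "redex \<Rightarrow> 'k" where
  "coef (R1 i j) = d"
| "coef (R2 i k j) = k3"
| "coef (R3 i k j l) = k4"

text \<open>\<open>P\<close> holds the positions not yet deleted. A letter inside a redex only has
  to commute with what must pass it: in \<open>R2\<close> it may depend on the middle letter, in
  \<open>R3\<close> a letter of the first stretch may depend on \<open>lab k\<close> and one of the
  last stretch on \<open>lab i\<close>.\<close>

fun is_redex :: "(nat \<Rightarrow> 'a) \<Rightarrow> nat set \<Rightarrow> redex \<Rightarrow> bool" where
  "is_redex lab P (R1 i j) \<longleftrightarrow> i \<in> P \<and> j \<in> P \<and> i < j \<and> lab i = lab j \<and>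
     (\<forall>z\<in>P. i < z \<longrightarrow> z < j \<longrightarrow> \<not> dep (lab z) (lab i))"
| "is_redex lab P (R2 i k j) \<longleftrightarrow> i \<in> P \<and> j \<in> P \<and> k \<in> P \<and> i < k \<and> k < j \<and> lab i = lab j \<and> m (lab i) (lab k) = 3 \<and>
     (\<forall>z\<in>P. i < z \<longrightarrow> z < j \<longrightarrow> z \<noteq> k \<longrightarrow> \<not> dep (lab z) (lab i))"
| "is_redex lab P (R3 i k j l) \<longleftrightarrow> i \<in> P \<and> j \<in> P \<and> k \<in> P \<and> l \<in> P \<and> i < k \<and> k < j \<and> j < l \<and>
     lab i = lab j \<and> lab k = lab l \<and> m (lab i) (lab k) = 4 \<and>
     (\<forall>z\<in>P. i < z \<longrightarrow> z < j \<longrightarrow> z \<noteq> k \<longrightarrow> \<not> dep (lab z) (lab i)) \<and>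
     (\<forall>z\<in>P. k < z \<longrightarrow> z < l \<longrightarrow> z \<noteq> j \<longrightarrow> \<not> dep (lab z) (lab k))"

text \<open>Deleting foreign letters only removes obstructions, and the positions stay what they
  are. This is the gain from recording positions: a redex survives every deletion that avoids
  it.\<close>

lemma is_redex_mono: "is_redex lab P R \<Longrightarrow> ids R \<subseteq> P' \<Longrightarrow> P' \<subseteq> P \<Longrightarrow> is_redex lab P' R"
  by (cases R) auto

lemma is_redex_ids: "is_redex lab P R \<Longrightarrow> ids R \<subseteq> P"
  by (cases R) auto

lemma dels_ids: "D \<in> dels R \<Longrightarrow> D \<subseteq> ids R \<and> D \<noteq> {}"
  by (cases R) auto

lemma m3_dep: "m a b = 3 \<Longrightarrow> dep a b" and m4_dep: "m a b = 4 \<Longrightarrow> dep a b"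
  and m3_dep': "m a b = 3 \<Longrightarrow> dep b a" and m4_dep': "m a b = 4 \<Longrightarrow> dep b a"
  using m_sym[of a b] by (auto simp: dep_def)

text \<open>Here the freedom in \<open>dels\<close> pays off: each deletion must spare the whole of
  the other redex, and for most overlaps a suitable pair of choices exists.\<close>

definition indep_redexes :: "redex \<Rightarrow> redex \<Rightarrow> bool" where
  "indep_redexes R R' \<longleftrightarrow> (\<exists>D\<in>dels R. \<exists>D'\<in>dels R'. ids R \<inter> D' = {} \<and> ids R' \<inter> D = {})"

lemma indep_redexesI:
  "D \<in> dels R \<Longrightarrow> D' \<in> dels R' \<Longrightarrow> ids R \<inter> D' = {} \<Longrightarrow> ids R' \<inter> D = {} \<Longrightarrow> indep_redexes R R'"
  unfolding indep_redexes_def by blast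

lemma redex_R1D:
  assumes "is_redex lab P (R1 i j)"
  shows "i \<in> P" "j \<in> P" "i < j" "lab i = lab j" "z \<in> P \<Longrightarrow> dep (lab z) (lab i) \<Longrightarrow> z \<le> i \<or> j \<le> z"
  using assms by auto

lemma redex_R2D:
  assumes "is_redex lab P (R2 i k j)"
  shows "i \<in> P" "j \<in> P" "k \<in> P" "i < k" "k < j" "lab i = lab j" "m (lab i) (lab k) = 3"
    "z \<in> P \<Longrightarrow> dep (lab z) (lab i) \<Longrightarrow> z \<le> i \<or> j \<le> z \<or> z = k"
    "dep (lab i) (lab k)" "dep (lab k) (lab i)" "lab i \<noteq> lab k"
  using assms m3_dep[of "lab i" "lab k"] m3_dep'[of "lab i" "lab k"] m_eq_1[of "lab i" "lab k"] by auto

lemma redex_R3D: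
  assumes "is_redex lab P (R3 i k j l)"
  shows "i \<in> P" "j \<in> P" "k \<in> P" "l \<in> P" "i < k" "k < j" "j < l" "lab i = lab j" "lab k = lab l" "m (lab i) (lab k) = 4"
    "z \<in> P \<Longrightarrow> dep (lab z) (lab i) \<Longrightarrow> z \<le> i \<or> j \<le> z \<or> z = k"
    "z \<in> P \<Longrightarrow> dep (lab z) (lab k) \<Longrightarrow> z \<le> k \<or> l \<le> z \<or> z = j"
    "dep (lab i) (lab k)" "dep (lab k) (lab i)" "lab i \<noteq> lab k"
  using assms m4_dep[of "lab i" "lab k"] m4_dep'[of "lab i" "lab k"] m_eq_1[of "lab i" "lab k"] by auto

lemma overlap_11:
  assumes "is_redex lab P (R1 i j)" "is_redex lab P (R1 a b)"
  shows "indep_redexes (R1 i j) (R1 a b) \<or> i = a \<and> j = b"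
proof (rule disjCI)
  assume n: "\<not> (i = a \<and> j = b)"
  note R = redex_R1D[OF assms(1)] and R' = redex_R1D[OF assms(2)]
  note o = R(3) R'(3)
  note labs = R(4) R'(4)
  have "i = a \<Longrightarrow> j = b" using R(5)[OF R'(2)] R'(5)[OF R(2)] o labs by auto
  moreover have "j = b \<Longrightarrow> i = a" using R(5)[OF R'(1)] R'(5)[OF R(1)] o labs by auto
  ultimately have d: "i \<noteq> a" "j \<noteq> b" using n by auto
  consider "j = a" | "i = b" | "j \<noteq> a" "i \<noteq> b" by blast
  then show "indep_redexes (R1 i j) (R1 a b)"
  proof cases
    case 1
    show ?thesis
      by (rule indep_redexesI[of "{i}" _ "{b}"]) (use 1 o in auto)
  next
    case 2
    show ?thesis
      by (rule indep_redexesI[of "{j}" _ "{a}"]) (use 2 o in auto)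
  next
    case 3
    show ?thesis
      by (rule indep_redexesI[of "{i}" _ "{a}"]) (use 3 d in auto)
  qed
qed

text \<open>The two redexes can share only an end, as in s s t s, since any other coincidence would
  put a dependent letter inside one of them. Deleting away from the shared end keeps the reductions
  apart.\<close>

lemma overlap_12:
  assumes "is_redex lab P (R1 i j)" "is_redex lab P (R2 a c b)"
  shows "indep_redexes (R1 i j) (R2 a c b)"
proof -
  note R = redex_R1D[OF assms(1)] and R' = redex_R2D[OF assms(2)]
  note o = R(3) R'(4,5)
  note labs = R(4) R'(6,9-11)
  have ia: "i \<noteq> a" using R(5)[OF R'(2)] R'(8)[OF R(2)] R(5)[OF R'(3)] o labs by auto
  have jb: "j \<noteq> b" using R(5)[OF R'(1)] R'(8)[OF R(1)] R(5)[OF R'(3)] o labs by auto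
  have d: "i \<noteq> c" using R(5)[OF R'(2)] R'(8)[OF R(2)] o labs by auto
  have d': "j \<noteq> c" using R(5)[OF R'(1)] R'(8)[OF R(1)] o labs by auto
  consider "j = a" | "i = b" | "j \<noteq> a" "i \<noteq> b" by blast
  then show "indep_redexes (R1 i j) (R2 a c b)"
  proof cases
    case 1
    show ?thesis
      by (rule indep_redexesI[of "{i}" _ "{c,b}"]) (use 1 o in auto)
  next
    case 2
    show ?thesis
      by (rule indep_redexesI[of "{j}" _ "{a,c}"]) (use 2 o in auto)
  next
    case 3
    show ?thesis
      by (rule indep_redexesI[of "{i}" _ "{a,c}"]) (use 3 ia jb d d' in auto)
  qed
qed

lemma overlap_13:
  assumes "is_redex lab P (R1 i j)" "is_redex lab P (R3 a c b e)"
  shows "indep_redexes (R1 i j) (R3 a c b e)"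
proof -
  note R = redex_R1D[OF assms(1)] and R' = redex_R3D[OF assms(2)]
  note o = R(3) R'(5-7)
  note labs = R(4) R'(8,9,13-15)
  have d: "i \<noteq> a" using R(5)[OF R'(2)] R'(11)[OF R(2)] R(5)[OF R'(3)] o labs by auto
  have d2: "j \<noteq> b" using R(5)[OF R'(1)] R'(11)[OF R(1)] R(5)[OF R'(3)] o labs by auto
  have d3: "i \<noteq> c" using R(5)[OF R'(4)] R'(12)[OF R(2)] R(5)[OF R'(2)] o labs by auto
  have d4: "j \<noteq> e" using R(5)[OF R'(3)] R'(12)[OF R(1)] R(5)[OF R'(2)] o labs by auto
  have d5: "i \<noteq> b" using R(5)[OF R'(4)] R'(12)[OF R(2)] o labs by auto
  have d6: "j \<noteq> c" using R(5)[OF R'(1)] R'(11)[OF R(1)] o labs by auto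
  note d = d d2 d3 d4 d5 d6
  consider "j = a" | "i = e" | "j \<noteq> a" "i \<noteq> e" by blast
  then show ?thesis
  proof cases
    case 1
    show ?thesis
      by (rule indep_redexesI[of "{i}" _ "{b,e}"]) (use 1 o in auto)
  next
    case 2
    show ?thesis
      by (rule indep_redexesI[of "{j}" _ "{a,c}"]) (use 2 o in auto)
  next
    case 3
    show ?thesis
      by (rule indep_redexesI[of "{i}" _ "{a,c}"]) (use 3 d in auto)
  qed
qed

lemma overlap_22_aux:
  assumes "is_redex lab P (R2 i k j)" "is_redex lab P (R2 a c b)"
  shows "i = a \<Longrightarrow> j = b" "j = b \<Longrightarrow> i = a" "i = a \<Longrightarrow> k = c" "k = a \<Longrightarrow> j = c" "j = c \<Longrightarrow> k = a"
proof -
  note R = redex_R2D[OF assms(1)] and R' = redex_R2D[OF assms(2)]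
  note o = R(4,5) R'(4,5)
  note labs = R(6,9-11) R'(6,9-11)
  show ia: "i = a \<Longrightarrow> j = b" using R(8)[OF R'(2)] R'(8)[OF R(2)] o labs by auto
  show "j = b \<Longrightarrow> i = a" using R(8)[OF R'(1)] R'(8)[OF R(1)] o labs by auto
  show "i = a \<Longrightarrow> k = c" using R(8)[OF R'(3)] ia o labs by auto
  show "k = a \<Longrightarrow> j = c" using R(8)[OF R'(2)] R'(8)[OF R(2)] o labs by auto
  show "j = c \<Longrightarrow> k = a" using R(8)[OF R'(1)] R'(8)[OF R(1)] o labs by auto
qed

text \<open>With \<open>k = a\<close> and \<open>j = c\<close> the word is s t s t with
  \<open>m s t = 3\<close>, and both redexes allow the deletion of the same two letters. The last
  exception, such as s u t s u, is a genuine clash around one middle letter; it is resolved in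
  \<open>redex_confluent\<close>.\<close>

lemma overlap_22:
  assumes "is_redex lab P (R2 i k j)" "is_redex lab P (R2 a c b)"
  shows "indep_redexes (R2 i k j) (R2 a c b) \<or> i = a \<and> k = c \<and> j = b \<or> k = a \<and> j = c \<or> i = c \<and> k = b
    \<or> k = c \<and> i \<noteq> a \<and> i \<noteq> b \<and> j \<noteq> a \<and> j \<noteq> b"
proof (rule disjCI)
  assume n: "\<not> (i = a \<and> k = c \<and> j = b \<or> k = a \<and> j = c \<or> i = c \<and> k = b
    \<or> k = c \<and> i \<noteq> a \<and> i \<noteq> b \<and> j \<noteq> a \<and> j \<noteq> b)"
  note A = overlap_22_aux[OF assms] and A' = overlap_22_aux[OF assms(2,1)]
  have o: "i < k" "k < j" "a < c" "c < b"
    using redex_R2D(4,5)[OF assms(1)] redex_R2D(4,5)[OF assms(2)] by auto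
  have d: "i \<noteq> a" "j \<noteq> b" "k \<noteq> a" "j \<noteq> c" "i \<noteq> c" "k \<noteq> b" using n A A' by blast+
  then have d': "k \<noteq> c" using n o by auto
  consider "j = a" | "i = b" | "j \<noteq> a" "i \<noteq> b" by blast
  then show "indep_redexes (R2 i k j) (R2 a c b)"
  proof cases
    case 1
    show ?thesis
      by (rule indep_redexesI[of "{i,k}" _ "{c,b}"]) (use 1 o in auto)
  next
    case 2
    show ?thesis
      by (rule indep_redexesI[of "{k,j}" _ "{a,c}"]) (use 2 o in auto)
  next
    case 3
    show ?thesis
      by (rule indep_redexesI[of "{i,k}" _ "{a,c}"]) (use 3 d d' in auto)
  qed
qed

text \<open>A pair of labels cannot carry both values 3 and 4. This excludes every coincidence
  except that of an end of the short redex with an end of the long one.\<close>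

lemma overlap_23:
  assumes "is_redex lab P (R2 i k j)" "is_redex lab P (R3 a c b e)"
  shows "indep_redexes (R2 i k j) (R3 a c b e)"
proof -
  note R = redex_R2D[OF assms(1)] and R' = redex_R3D[OF assms(2)]
  note o = R(4,5) R'(5-7)
  note labs = R(6,9-11) R'(8,9,13-15)
  have m: "\<not> (lab i = lab a \<and> lab k = lab c)" "\<not> (lab i = lab c \<and> lab k = lab a)"
    using R(7) R'(10) m_sym[of "lab a" "lab c"] by auto
  have d1: "i \<noteq> a" using R(8)[OF R'(2)] R'(11)[OF R(2)] R(8)[OF R'(3)] m o labs by auto
  have d2: "j \<noteq> b" using R(8)[OF R'(1)] R'(11)[OF R(1)] R(8)[OF R'(3)] m o labs by auto
  have d3: "i \<noteq> c" using R(8)[OF R'(4)] R'(12)[OF R(2)] R(8)[OF R'(2)] m o labs by auto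
  have d4: "j \<noteq> e" using R(8)[OF R'(3)] R'(12)[OF R(1)] R(8)[OF R'(2)] m o labs by auto
  have d5: "i \<noteq> b" using R(8)[OF R'(4)] R'(12)[OF R(2)] m o labs by auto
  have d6: "j \<noteq> c" using R(8)[OF R'(1)] R'(11)[OF R(1)] m o labs by auto
  have d7: "k \<noteq> a" using R(8)[OF R'(2)] R'(11)[OF R(2)] m o labs by auto
  have d8: "k \<noteq> b" using R(8)[OF R'(1)] R'(11)[OF R(1)] m o labs by auto
  have d9: "k \<noteq> c" using R(8)[OF R'(4)] R'(12)[OF R(2)] m o labs by auto
  have d10: "k \<noteq> e" using R(8)[OF R'(3)] R'(12)[OF R(1)] m o labs by auto
  note d = d1 d2 d3 d4 d5 d6 d7 d8 d9 d10
  consider "j = a" | "i = e" | "j \<noteq> a" "i \<noteq> e" by blast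
  then show ?thesis
  proof cases
    case 1
    show ?thesis
      by (rule indep_redexesI[of "{i,k}" _ "{b,e}"]) (use 1 o in auto)
  next
    case 2
    show ?thesis
      by (rule indep_redexesI[of "{k,j}" _ "{a,c}"]) (use 2 o in auto)
  next
    case 3
    show ?thesis
      by (rule indep_redexesI[of "{i,k}" _ "{a,c}"]) (use 3 d in auto)
  qed
qed

lemma overlap_33_aux:
  assumes "is_redex lab P (R3 i k j l)" "is_redex lab P (R3 a c b e)"
  shows "i = a \<Longrightarrow> j = b" "j = b \<Longrightarrow> i = a" "k = c \<Longrightarrow> l = e" "l = e \<Longrightarrow> k = c"
    "k = a \<Longrightarrow> l = b" "l = b \<Longrightarrow> k = a"
    "i = a \<Longrightarrow> k = c" "k = c \<Longrightarrow> j = b" "k = a \<Longrightarrow> j = c" "j = c \<Longrightarrow> k = a" "l = c \<Longrightarrow> j = a"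
proof -
  note R = redex_R3D[OF assms(1)] and R' = redex_R3D[OF assms(2)]
  note o = R(5-7) R'(5-7)
  note labs = R(8,9,13-15) R'(8,9,13-15)
  note order = le_antisym leD less_trans nat_neq_iff order.strict_trans1
  show ia: "i = a \<Longrightarrow> j = b"
    using R(11)[OF R'(2)] R'(11)[OF R(2)] o labs dep_refl[of "lab a"] by (metis order)
  show "j = b \<Longrightarrow> i = a"
    using R(11)[OF R'(1)] R'(11)[OF R(1)] o labs dep_refl[of "lab a"] by (metis order)
  show kc: "k = c \<Longrightarrow> l = e"
    using R(12)[OF R'(4)] R'(12)[OF R(4)] o labs dep_refl[of "lab c"] by (metis order)
  show "l = e \<Longrightarrow> k = c"
    using R(12)[OF R'(3)] R'(12)[OF R(3)] o labs dep_refl[of "lab c"] by (metis order)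
  show ka: "k = a \<Longrightarrow> l = b"
    using R(12)[OF R'(2)] R'(11)[OF R(4)] o labs dep_refl[of "lab a"] by (metis order)
  show "l = b \<Longrightarrow> k = a"
    using R(12)[OF R'(1)] R'(11)[OF R(3)] o labs dep_refl[of "lab a"] by (metis order)
  show "i = a \<Longrightarrow> k = c"
    using R(11)[OF R'(3)] ia o labs by (metis not_le)
  show "k = c \<Longrightarrow> j = b"
    using R'(12)[OF R(2)] kc o labs by (metis not_le)
  show "k = a \<Longrightarrow> j = c"
    using R'(11)[OF R(2)] ka o labs by (metis not_le)
  show "k = a" if "j = c"
  proof -
    have "a \<le> i \<or> a = k" using R(11)[OF R'(1)] o labs that by auto
    moreover have "i \<le> a" using R'(11)[OF R(1)] o labs that by auto
    moreover have "i \<noteq> a" using labs that by auto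
    ultimately show ?thesis by auto
  qed
  show "j = a" if "l = c"
  proof -
    have "a \<le> k \<or> a = j" using R(12)[OF R'(1)] o labs that by auto
    moreover have "k \<le> a" using R'(11)[OF R(3)] o labs that by auto
    moreover have "k \<noteq> a" using labs that by auto
    ultimately show ?thesis by auto
  qed
qed

text \<open>Besides equal redexes the exceptions are words s t s t s, where the middle pair of one
  redex is the initial pair of the other, so that a common deletion is available.\<close>

lemma overlap_33:
  assumes "is_redex lab P (R3 i k j l)" "is_redex lab P (R3 a c b e)"
  shows "indep_redexes (R3 i k j l) (R3 a c b e) \<or> i = a \<and> k = c \<and> j = b \<or> k = a \<and> j = c \<or> i = c \<and> k = b"
proof (rule disjCI)
  assume n: "\<not> (i = a \<and> k = c \<and> j = b \<or> k = a \<and> j = c \<or> i = c \<and> k = b)"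
  note A = overlap_33_aux[OF assms] and A' = overlap_33_aux[OF assms(2,1)]
  have o: "i < k" "k < j" "j < l" "a < c" "c < b" "b < e"
    using redex_R3D(5-7)[OF assms(1)] redex_R3D(5-7)[OF assms(2)] by auto
  have d: "i \<noteq> a" "k \<noteq> c" "j \<noteq> b" "l \<noteq> e" "k \<noteq> a" "j \<noteq> c" "l \<noteq> b" "i \<noteq> c" "k \<noteq> b" "j \<noteq> e"
    using n A A' by blast+
  consider "j = a \<or> l = a" | "b = i \<or> e = i" | "j \<noteq> a" "l \<noteq> a" "b \<noteq> i" "e \<noteq> i" by blast
  then show "indep_redexes (R3 i k j l) (R3 a c b e)"
  proof cases
    case 1
    show ?thesis
      by (rule indep_redexesI[of "{i,k}" _ "{b,e}"]) (use 1 o d(4,7) in auto)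
  next
    case 2
    show ?thesis
      by (rule indep_redexesI[of "{j,l}" _ "{a,c}"]) (use 2 o d(4,10) in auto)
  next
    case 3
    then have "l \<noteq> c" "k \<noteq> e" using A(11) A'(11) by auto
    then show ?thesis
      by (intro indep_redexesI[of "{i,k}" _ "{a,c}"]) (use 3 d in auto)
  qed
qed

section \<open>Confluence\<close>

definition seg :: "(nat \<Rightarrow> 'a) \<Rightarrow> nat set \<Rightarrow> nat \<Rightarrow> nat \<Rightarrow> 'a list" where
  "seg lab P a b = map lab (filter (\<lambda>i. i \<in> P) [a..<b])"

lemma seg_split: "a \<le> i \<Longrightarrow> i < b \<Longrightarrow> seg lab P a b = seg lab P a i @ (if i \<in> P then [lab i] else []) @ seg lab P (Suc i) b"
proof -
  assume "a \<le> i" "i < b"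
  then have "[a..<b] = [a..<i] @ i # [Suc i..<b]"
    by (metis le_Suc_ex less_imp_le_nat upt_add_eq_append upt_conv_Cons)
  then show ?thesis by (simp add: seg_def)
qed

lemma seg_cong: "(\<And>z. a \<le> z \<Longrightarrow> z < b \<Longrightarrow> z \<in> P \<longleftrightarrow> z \<in> P') \<Longrightarrow> seg lab P a b = seg lab P' a b"
  unfolding seg_def by (intro arg_cong[where f = "map lab"] filter_cong) auto

lemma set_seg: "set (seg lab P a b) = lab ` {z\<in>P. a \<le> z \<and> z < b}"
  by (auto simp: seg_def)

lemma red_comm_eq_right: "red w c w' \<Longrightarrow> comm_eq w' w'' \<Longrightarrow> red w c w''"
  using red_trans[of w c w' 1 w''] red_comm_eq[OF _ red_refl] by simp

lemma red_far_1: "\<forall>x\<in>set X. \<not> dep x s \<Longrightarrow> red (A @ s # X @ s # B) d (A @ s # X @ B)"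
  using red_comm_eq[OF comm_eq_move_left[of X s "A @ [s]" B], of d "A @ s # X @ B"]
    red_1[of A s "X @ B" 1] red_refl by simp

lemma red_far_3:
  assumes "\<forall>x\<in>set X. \<not> dep x s" "\<forall>x\<in>set Y. \<not> dep x s" "m s t = 3"
  shows "red (A @ s # X @ t # Y @ s # B) k3 (A @ s # X @ Y @ B)"
proof -
  have 1: "comm_eq (A @ s # X @ t # Y @ s # B) (A @ X @ [s,t,s] @ Y @ B)"
    using rtranclp_trans[OF comm_eq_move_right[of X s A "t # Y @ s # B"]] assms
      comm_eq_move_left[of Y s "A @ X @ [s,t]" B] by simp
  have 2: "red (A @ X @ [s,t,s] @ Y @ B) k3 (A @ X @ [s] @ Y @ B)"
    using red_3[of s t "A @ X" "Y @ B" 1] assms red_refl by simp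
  have 3: "comm_eq (A @ X @ [s] @ Y @ B) (A @ s # X @ Y @ B)"
    using comm_eq_move_left[of X s A "Y @ B"] assms by simp
  show ?thesis using red_comm_eq[OF 1 red_comm_eq_right[OF 2 3]] .
qed

lemma red_far_4:
  assumes "\<forall>x\<in>set X. \<not> dep x s" "\<forall>x\<in>set Y. \<not> dep x s" "\<forall>x\<in>set Y. \<not> dep x t" "\<forall>x\<in>set Z. \<not> dep x t" "m s t = 4"
  shows "red (A @ s # X @ t # Y @ s # Z @ t # B) k4 (A @ s # X @ t # Y @ Z @ B)"
proof -
  have 1: "comm_eq (A @ s # X @ t # Y @ s # Z @ t # B) (A @ X @ [s,t] @ Y @ s # Z @ t # B)"
    using comm_eq_move_right[of X s A "t # Y @ s # Z @ t # B"] assms by simp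
  have 2: "comm_eq (A @ X @ [s,t] @ Y @ s # Z @ t # B) (A @ X @ [s,t,s] @ Y @ Z @ t # B)"
    using comm_eq_move_left[of Y s "A @ X @ [s,t]" "Z @ t # B"] assms by simp
  have 3: "comm_eq (A @ X @ [s,t,s] @ Y @ Z @ t # B) (A @ X @ [s,t,s,t] @ Y @ Z @ B)"
    using comm_eq_move_left[of "Y @ Z" t "A @ X @ [s,t,s]" B] assms by auto
  have 4: "red (A @ X @ [s,t,s,t] @ Y @ Z @ B) k4 (A @ X @ [s,t] @ Y @ Z @ B)"
    using red_4[of s t "A @ X" "Y @ Z @ B" 1] assms red_refl by simp
  have 5: "comm_eq (A @ X @ [s,t] @ Y @ Z @ B) (A @ s # X @ t # Y @ Z @ B)"
    using comm_eq_move_left[of X s A "t # Y @ Z @ B"] assms by simp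
  show ?thesis
    using red_comm_eq[OF 1 red_comm_eq[OF 2 red_comm_eq[OF 3 red_comm_eq_right[OF 4 5]]]] .
qed

definition word_on :: "(nat \<Rightarrow> 'a) \<Rightarrow> nat set \<Rightarrow> nat \<Rightarrow> 'a list" where
  "word_on lab P n = seg lab P 0 n"

text \<open>The deletion at the right end of the redex is the one realized by reductions; the other
  choices result from it by moving the letters that remain.\<close>

lemma redex_red_ex:
  assumes R: "is_redex lab P R" and P: "P \<subseteq> {..<n}"
  shows "\<exists>D\<in>dels R. red (word_on lab P n) (coef R) (word_on lab (P - D) n) \<and>
    (\<forall>E\<in>dels R. comm_eq (word_on lab (P - D) n) (word_on lab (P - E) n))"
proof (cases R)
  case [simp]: (R1 i j)
  from R P have i: "i \<in> P" "j \<in> P" "i < j" "j < n" "i < n" and l: "lab j = lab i"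
    and X: "\<forall>x\<in>set (seg lab P (Suc i) j). \<not> dep x (lab i)"
    by (auto simp: set_seg)
  have split: "word_on lab Q n = seg lab Q 0 i @ (if i \<in> Q then [lab i] else []) @ seg lab Q (Suc i) j
      @ (if j \<in> Q then [lab j] else []) @ seg lab Q (Suc j) n" for Q
    using seg_split[of 0 i n lab Q] seg_split[of "Suc i" j n lab Q] i by (simp add: word_on_def)
  have eq: "seg lab (P - E) 0 i = seg lab P 0 i" "seg lab (P - E) (Suc i) j = seg lab P (Suc i) j"
    "seg lab (P - E) (Suc j) n = seg lab P (Suc j) n" if "E \<subseteq> {i,j}" for E
    by (rule seg_cong, use that i in auto)+
  have 1: "red (word_on lab P n) d (word_on lab (P - {j}) n)"
    unfolding split using i l eq[of "{j}"] red_far_1[OF X] by simp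
  have 2: "comm_eq (word_on lab (P - {j}) n) (word_on lab (P - {i}) n)"
    unfolding split using i l eq[of "{j}"] eq[of "{i}"] comm_eq_move_right[OF X] by simp
  show ?thesis using 1 2 by (intro bexI[of _ "{j}"]) auto
next
  case [simp]: (R2 i k j)
  from R P have i: "i \<in> P" "j \<in> P" "k \<in> P" "i < k" "k < j" "j < n" "k < n" "i < n" and l: "lab j = lab i" and m: "m (lab i) (lab k) = 3"
    and X: "\<forall>x\<in>set (seg lab P (Suc i) k). \<not> dep x (lab i)" and Y: "\<forall>x\<in>set (seg lab P (Suc k) j). \<not> dep x (lab i)"
    by (auto simp: set_seg)
  have split: "word_on lab Q n = seg lab Q 0 i @ (if i \<in> Q then [lab i] else []) @ seg lab Q (Suc i) k
      @ (if k \<in> Q then [lab k] else []) @ seg lab Q (Suc k) j @ (if j \<in> Q then [lab j] else []) @ seg lab Q (Suc j) n" for Q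
    using seg_split[of 0 i n lab Q] seg_split[of "Suc i" k n lab Q] seg_split[of "Suc k" j n lab Q] i
    by (simp add: word_on_def)
  have eq: "seg lab (P - E) 0 i = seg lab P 0 i" "seg lab (P - E) (Suc i) k = seg lab P (Suc i) k"
    "seg lab (P - E) (Suc k) j = seg lab P (Suc k) j"
    "seg lab (P - E) (Suc j) n = seg lab P (Suc j) n" if "E \<subseteq> {i,k,j}" for E
    by (rule seg_cong, use that i in auto)+
  have 1: "red (word_on lab P n) k3 (word_on lab (P - {k,j}) n)"
    unfolding split using i l eq[of "{k,j}"] red_far_3[OF X Y m] by simp
  have 2: "comm_eq (word_on lab (P - {k,j}) n) (word_on lab (P - {i,k}) n)"
    unfolding split using i l eq[of "{k,j}"] eq[of "{i,k}"] X Y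
      comm_eq_move_right[of "seg lab P (Suc i) k @ seg lab P (Suc k) j" "lab i" "seg lab P 0 i" "seg lab P (Suc j) n"] by auto
  show ?thesis using 1 2 by (intro bexI[of _ "{k,j}"]) auto
next
  case [simp]: (R3 i k j l)
  from R P have i: "i \<in> P" "j \<in> P" "k \<in> P" "l \<in> P" "i < k" "k < j" "j < l" "l < n" "j < n" "k < n" "i < n"
    and l: "lab j = lab i" "lab l = lab k" and m: "m (lab i) (lab k) = 4"
    and X: "\<forall>x\<in>set (seg lab P (Suc i) k). \<not> dep x (lab i)" and Y: "\<forall>x\<in>set (seg lab P (Suc k) j). \<not> dep x (lab i)"
    and Y': "\<forall>x\<in>set (seg lab P (Suc k) j). \<not> dep x (lab k)" and Z: "\<forall>x\<in>set (seg lab P (Suc j) l). \<not> dep x (lab k)"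
    by (auto simp: set_seg)
  have split: "word_on lab Q n = seg lab Q 0 i @ (if i \<in> Q then [lab i] else []) @ seg lab Q (Suc i) k
      @ (if k \<in> Q then [lab k] else []) @ seg lab Q (Suc k) j @ (if j \<in> Q then [lab j] else []) @ seg lab Q (Suc j) l
      @ (if l \<in> Q then [lab l] else []) @ seg lab Q (Suc l) n" for Q
    using seg_split[of 0 i n lab Q] seg_split[of "Suc i" k n lab Q] seg_split[of "Suc k" j n lab Q]
      seg_split[of "Suc j" l n lab Q] i
    by (simp add: word_on_def)
  have eq: "seg lab (P - E) 0 i = seg lab P 0 i" "seg lab (P - E) (Suc i) k = seg lab P (Suc i) k"
    "seg lab (P - E) (Suc k) j = seg lab P (Suc k) j" "seg lab (P - E) (Suc j) l = seg lab P (Suc j) l"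
    "seg lab (P - E) (Suc l) n = seg lab P (Suc l) n" if "E \<subseteq> {i,k,j,l}" for E
    by (rule seg_cong, use that i in auto)+
  have 1: "red (word_on lab P n) k4 (word_on lab (P - {j,l}) n)"
    unfolding split using i l eq[of "{j,l}"] red_far_4[OF X Y Y' Z m] by simp
  have 2: "comm_eq (word_on lab (P - {j,l}) n) (word_on lab (P - {k,j}) n)"
    unfolding split using i l eq[of "{j,l}"] eq[of "{k,j}"] Y' Z
      comm_eq_move_right[of "seg lab P (Suc k) j @ seg lab P (Suc j) l" "lab k" "seg lab P 0 i @ lab i # seg lab P (Suc i) k" "seg lab P (Suc l) n"] by auto
  have 3: "comm_eq (word_on lab (P - {k,j}) n) (word_on lab (P - {i,k}) n)"
    unfolding split using i l eq[of "{k,j}"] eq[of "{i,k}"] X Y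
      comm_eq_move_right[of "seg lab P (Suc i) k @ seg lab P (Suc k) j" "lab i" "seg lab P 0 i" "seg lab P (Suc j) l @ lab k # seg lab P (Suc l) n"] by auto
  show ?thesis using 1 2 rtranclp_trans[OF 2 3] by (intro bexI[of _ "{j,l}"]) auto
qed

lemma redex_red:
  assumes "is_redex lab P R" "P \<subseteq> {..<n}" "D \<in> dels R"
  shows "red (word_on lab P n) (coef R) (word_on lab (P - D) n)"
  using redex_red_ex[OF assms(1,2)] assms(3) red_comm_eq_right by blast

lemma dels_comm_eq:
  assumes "is_redex lab P R" "P \<subseteq> {..<n}" "D \<in> dels R" "E \<in> dels R"
  shows "comm_eq (word_on lab (P - D) n) (word_on lab (P - E) n)"
  using redex_red_ex[OF assms(1,2)] assms(3,4) by (meson rtranclp_trans comm_eq_sym)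

lemma length_word_on: "P \<subseteq> {..<n} \<Longrightarrow> length (word_on lab P n) = card P"
proof -
  assume "P \<subseteq> {..<n}"
  then have "set (filter (\<lambda>i. i \<in> P) [0..<n]) = P" by auto
  then show ?thesis unfolding word_on_def seg_def
    using distinct_card[of "filter (\<lambda>i. i \<in> P) [0..<n]"] by simp
qed

lemma indep_redexes_sym: "indep_redexes R R' \<Longrightarrow> indep_redexes R' R"
  unfolding indep_redexes_def by blast

lemma redex_overlap:
  assumes R: "is_redex lab P R" and R': "is_redex lab P R'"
  shows "indep_redexes R R' \<or> (coef R = coef R' \<and> dels R \<inter> dels R' \<noteq> {})
    \<or> (\<exists>i k j a b. R = R2 i k j \<and> R' = R2 a k b \<and> i \<noteq> a \<and> i \<noteq> b \<and> j \<noteq> a \<and> j \<noteq> b)"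
proof (cases R; cases R')
  fix i j a b assume eq: "R = R1 i j" "R' = R1 a b"
  show ?thesis unfolding eq using overlap_11[OF R[unfolded eq] R'[unfolded eq]] by auto
next
  fix i j a c b assume eq: "R = R1 i j" "R' = R2 a c b"
  show ?thesis unfolding eq using overlap_12[OF R[unfolded eq] R'[unfolded eq]] by auto
next
  fix i j a c b e assume eq: "R = R1 i j" "R' = R3 a c b e"
  show ?thesis unfolding eq using overlap_13[OF R[unfolded eq] R'[unfolded eq]] by auto
next
  fix i j a c b assume eq: "R = R2 a c b" "R' = R1 i j"
  show ?thesis unfolding eq using overlap_12[OF R'[unfolded eq] R[unfolded eq], THEN indep_redexes_sym] by blast
next
  fix i k j a c b assume eq: "R = R2 i k j" "R' = R2 a c b"
  show ?thesis unfolding eq using overlap_22[OF R[unfolded eq] R'[unfolded eq]] by auto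
next
  fix i k j a c b e assume eq: "R = R2 i k j" "R' = R3 a c b e"
  show ?thesis unfolding eq using overlap_23[OF R[unfolded eq] R'[unfolded eq]] by auto
next
  fix i j a c b e assume eq: "R = R3 a c b e" "R' = R1 i j"
  show ?thesis unfolding eq using overlap_13[OF R'[unfolded eq] R[unfolded eq], THEN indep_redexes_sym] by blast
next
  fix i k j a c b e assume eq: "R = R3 a c b e" "R' = R2 i k j"
  show ?thesis unfolding eq using overlap_23[OF R'[unfolded eq] R[unfolded eq], THEN indep_redexes_sym] by blast
next
  fix i k j l a c b e assume eq: "R = R3 i k j l" "R' = R3 a c b e"
  have c: "coef R = coef R'" by (simp add: eq)
  from overlap_33[OF R[unfolded eq] R'[unfolded eq]] show ?thesis
  proof (elim disjE conjE)
    assume "i = a" "k = c"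
    then have "{i,k} \<in> dels R \<inter> dels R'" by (simp add: eq)
    then show ?thesis using c by blast
  next
    assume "k = a" "j = c"
    then have "{k,j} \<in> dels R \<inter> dels R'" by (simp add: eq)
    then show ?thesis using c by blast
  next
    assume "i = c" "k = b"
    then have "{i,k} \<in> dels R \<inter> dels R'" by (simp add: eq)
    then show ?thesis using c by blast
  next
    assume "indep_redexes (R3 i k j l) (R3 a c b e)"
    then show ?thesis unfolding eq by blast
  qed
qed

text \<open>Local confluence, seen through a function \<open>g\<close> that is already known to
  respect reductions of words of length below \<open>n\<close>: any two reductions of one word of
  length \<open>n\<close> agree under \<open>g\<close>. Induction on the length, as in Newman's
  lemma, will turn this into a well-defined value on all words.\<close>

lemma redex_confluent:
  fixes g :: "'a list \<Rightarrow> 'k"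
  assumes g: "\<And>w c v. length w < n \<Longrightarrow> red w c v \<Longrightarrow> g w = c * g v"
    and R: "is_redex lab {..<n} R" "D \<in> dels R" and R': "is_redex lab {..<n} R'" "D' \<in> dels R'"
  shows "coef R * g (word_on lab ({..<n} - D) n) = coef R' * g (word_on lab ({..<n} - D') n)"
proof -
  let ?P = "{..<n}" and ?w = "\<lambda>P. word_on lab P n"
  have len: "length (?w (?P - E)) < n" if "E \<in> dels S" "is_redex lab ?P S" for E S
  proof -
    have "E \<subseteq> ?P" "E \<noteq> {}" using dels_ids[OF that(1)] is_redex_ids[OF that(2)] by auto
    then have "card (?P - E) < card ?P" by (intro psubset_card_mono) auto
    then show ?thesis using length_word_on[of "?P - E" n lab] by auto
  qed
  have same: "g (?w (?P - E)) = g (?w (?P - E'))" if "is_redex lab ?P S" "E \<in> dels S" "E' \<in> dels S" for E E' S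
    using g[OF len[OF that(2,1)] red_comm_eq[OF dels_comm_eq[OF that(1) subset_refl that(2,3)] red_refl]] by simp
  have sub: "g (?w (?P - E)) = coef S' * g (?w (?P - E - E'))"
    if "is_redex lab ?P S" "E \<in> dels S" "is_redex lab (?P - E) S'" "E' \<in> dels S'" for E E' S S'
    using g[OF len[OF that(2,1)] redex_red[OF that(3) _ that(4)]] by auto
  from redex_overlap[OF R(1) R'(1)] consider (indep) "indep_redexes R R'"
    | (eq) "coef R = coef R'" "dels R \<inter> dels R' \<noteq> {}"
    | (mid) i k j a b where "R = R2 i k j" "R' = R2 a k b" "i \<noteq> a" "i \<noteq> b" "j \<noteq> a" "j \<noteq> b" by blast
  then show ?thesis
  proof cases
    case indep
    then obtain E E' where E: "E \<in> dels R" "E' \<in> dels R'" "ids R \<inter> E' = {}" "ids R' \<inter> E = {}"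
      unfolding indep_redexes_def by blast
    have 1: "is_redex lab (?P - E) R'" using E is_redex_ids[OF R'(1)] by (intro is_redex_mono[OF R'(1)]) auto
    have 2: "is_redex lab (?P - E') R" using E is_redex_ids[OF R(1)] by (intro is_redex_mono[OF R(1)]) auto
    show ?thesis
      using sub[OF R(1) E(1) 1 E(2)] sub[OF R'(1) E(2) 2 E(1)] same[OF R(1) R(2) E(1)] same[OF R'(1) R'(2) E(2)]
      by (simp add: Diff_eq Int_ac mult_ac)
  next
    case eq
    then obtain E where "E \<in> dels R" "E \<in> dels R'" by blast
    then show ?thesis using same[OF R(1) R(2)] same[OF R'(1) R'(2)] eq(1) by metis
  next
    case mid
    \<comment> \<open>Deleting the shared middle letter leaves the outer pair of the other redex as
      a square, so both orders produce the factor \<open>k3 * d\<close>.\<close>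
    have 1: "is_redex lab (?P - {k,j}) (R1 a b)" "is_redex lab (?P - {k,b}) (R1 i j)"
      using R(1) R'(1) mid by auto
    have 2: "{k,j} \<in> dels R" "{k,b} \<in> dels R'" using mid by auto
    have 3: "?P - {k,j} - {b} = ?P - {k,b} - {j}" by auto
    show ?thesis
      using sub[OF R(1) 2(1) 1(1), of "{b}"] sub[OF R'(1) 2(2) 1(2), of "{j}"]
        same[OF R(1) R(2) 2(1)] same[OF R'(1) R'(2) 2(2)] mid 3
      by simp
  qed
qed

section \<open>Irreducible words\<close>

lemma seg_nth: "b \<le> length w \<Longrightarrow> {a..<b} \<subseteq> P \<Longrightarrow> seg ((!) w) P a b = drop a (take b w)"
proof -
  assume *: "b \<le> length w" "{a..<b} \<subseteq> P"
  then have "filter (\<lambda>i. i \<in> P) [a..<b] = [a..<b]" by (intro filter_True) auto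
  moreover have "map ((!) w) [a..<b] = drop a (take b w)"
    using *(1) by (intro nth_equalityI) auto
  ultimately show ?thesis by (simp add: seg_def)
qed

lemma word_on_full: "word_on ((!) w) {..<length w} (length w) = w"
  by (simp add: word_on_def seg_nth atLeast0LessThan)

text \<open>A single reduction with the necessary commutations built into the redex; thus
  irreducibility can be stated without quantifying over equivalent words.\<close>

definition step :: "'a list \<Rightarrow> 'k \<Rightarrow> 'a list \<Rightarrow> bool" where
  "step w c v \<longleftrightarrow> (\<exists>R D. is_redex ((!) w) {..<length w} R \<and> D \<in> dels R \<and> c = coef R \<and>
     v = word_on ((!) w) ({..<length w} - D) (length w))"

lemma step_red: "step w c v \<Longrightarrow> red w c v"
  unfolding step_def using redex_red[of "(!) w" "{..<length w}" _ "length w"] by (auto simp: word_on_full)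

lemma step_length: "step w c v \<Longrightarrow> length v < length w"
proof -
  assume "step w c v"
  then obtain R D where *: "is_redex ((!) w) {..<length w} R" "D \<in> dels R"
    "v = word_on ((!) w) ({..<length w} - D) (length w)"
    unfolding step_def by blast
  then have "D \<subseteq> {..<length w}" "D \<noteq> {}" using dels_ids[of D R] is_redex_ids[OF *(1)] by auto
  then have "card ({..<length w} - D) < card {..<length w}" by (intro psubset_card_mono) auto
  then show ?thesis using * length_word_on[of "{..<length w} - D" "length w"] by auto
qed

fun map_redex :: "(nat \<Rightarrow> nat) \<Rightarrow> redex \<Rightarrow> redex" where
  "map_redex p (R1 i j) = R1 (p i) (p j)"
| "map_redex p (R2 i k j) = R2 (p i) (p k) (p j)"
| "map_redex p (R3 i k j l) = R3 (p i) (p k) (p j) (p l)"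

text \<open>A redex sees only the relative order of dependent letters. The lemma is meant for the
  transposition of two neighbouring positions whose letters commute.\<close>

lemma is_redex_map:
  assumes inv: "\<And>x. p (p x) = x" and lab: "\<And>x. lab' (p x) = lab x" and P: "\<And>x. p x \<in> P \<longleftrightarrow> x \<in> P"
    and mono: "\<And>x y. dep (lab x) (lab y) \<Longrightarrow> p x < p y \<longleftrightarrow> x < y"
    and R: "is_redex lab P R"
  shows "is_redex lab' P (map_redex p R)"
proof -
  have far: "\<not> dep (lab' z) (lab i)"
    if a: "\<And>z. z \<in> P \<Longrightarrow> dep (lab z) (lab i) \<Longrightarrow> z \<le> i \<or> j \<le> z \<or> z \<in> K"
      and b: "lab j = lab i" "z \<in> P" "p i < z" "z < p j" "z \<notin> p ` K" for i j z K
  proof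
    assume d: "dep (lab' z) (lab i)"
    have z: "lab' z = lab (p z)" using lab[of "p z"] inv by simp
    have "p i < p (p z) \<longleftrightarrow> i < p z" "p (p z) < p j \<longleftrightarrow> p z < j"
      using mono[of i "p z"] mono[of "p z" j] d z b(1) dep_sym by auto
    moreover have "p z \<notin> K" using b(5) inv by (metis imageI)
    ultimately show False using a[of "p z"] b d z P inv by force
  qed
  show ?thesis
  proof (cases R)
    case eq: (R1 i j)
    note R' = redex_R1D[OF R[unfolded eq]]
    have "\<forall>z\<in>P. p i < z \<longrightarrow> z < p j \<longrightarrow> \<not> dep (lab' z) (lab i)"
    proof (intro ballI impI)
      fix z assume z: "z \<in> P" "p i < z" "z < p j"
      show "\<not> dep (lab' z) (lab i)"
        by (rule far[where K = "{}" and j = j]) (use R'(4) z in \<open>simp_all add: R'(5)\<close>)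
    qed
    then show ?thesis unfolding eq map_redex.simps is_redex.simps lab P
      using R'(1-4) mono[of i j] by simp
  next
    case eq: (R2 i k j)
    note R' = redex_R2D[OF R[unfolded eq]]
    have "\<forall>z\<in>P. p i < z \<longrightarrow> z < p j \<longrightarrow> z \<noteq> p k \<longrightarrow> \<not> dep (lab' z) (lab i)"
    proof (intro ballI impI)
      fix z assume z: "z \<in> P" "p i < z" "z < p j" "z \<noteq> p k"
      show "\<not> dep (lab' z) (lab i)"
        by (rule far[where K = "{k}" and j = j]) (use R'(6) z in \<open>simp_all add: R'(8)\<close>)
    qed
    then show ?thesis unfolding eq map_redex.simps is_redex.simps lab P
      using R'(1-7,9,10) mono[of i k] mono[of k j] by simp
  next
    case eq: (R3 i k j l)
    note R' = redex_R3D[OF R[unfolded eq]]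
    have "\<forall>z\<in>P. p i < z \<longrightarrow> z < p j \<longrightarrow> z \<noteq> p k \<longrightarrow> \<not> dep (lab' z) (lab i)"
    proof (intro ballI impI)
      fix z assume z: "z \<in> P" "p i < z" "z < p j" "z \<noteq> p k"
      show "\<not> dep (lab' z) (lab i)"
        by (rule far[where K = "{k}" and j = j]) (use R'(8) z in \<open>simp_all add: R'(11)\<close>)
    qed
    moreover have "\<forall>z\<in>P. p k < z \<longrightarrow> z < p l \<longrightarrow> z \<noteq> p j \<longrightarrow> \<not> dep (lab' z) (lab k)"
    proof (intro ballI impI)
      fix z assume z: "z \<in> P" "p k < z" "z < p l" "z \<noteq> p j"
      show "\<not> dep (lab' z) (lab k)"
        by (rule far[where K = "{j}" and j = l]) (use R'(9) z in \<open>simp_all add: R'(12)\<close>)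
    qed
    ultimately show ?thesis unfolding eq map_redex.simps is_redex.simps lab P
      using R'(1-10,13,14) mono[of i k] mono[of k j] mono[of j l] by simp
  qed
qed

lemma dels_map: "D \<in> dels R \<Longrightarrow> p ` D \<in> dels (map_redex p R)"
  by (cases R) auto

lemma coef_map: "coef (map_redex p R) = coef R"
  by (cases R) auto

lemma swap_step:
  assumes "swap w w'" "step w c v"
  shows "\<exists>v'. step w' c v' \<and> comm_eq v v'"
  using assms(1)
proof cases
  case (1 a b x y)
  define n where "n = length w"
  define p where "p = length x"
  define t where "t i = (if i = p then Suc p else if i = Suc p then p else i)" for i
  have n: "length w' = n" "Suc p < n" using 1 by (auto simp: n_def p_def)
  have w: "w ! p = a" "w ! Suc p = b" "w' ! p = b" "w' ! Suc p = a"
    using 1 by (auto simp: p_def nth_append)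
  have w': "w' ! i = w ! i" if "i \<noteq> p" "i \<noteq> Suc p" for i
    using that 1 by (auto simp: p_def nth_append nth_Cons split: nat.split)
  have tt: "t (t i) = i" for i by (simp add: t_def)
  have tn: "t i < n \<longleftrightarrow> i < n" for i using n by (auto simp: t_def)
  have lab: "w' ! t i = w ! i" for i using w w' by (auto simp: t_def)
  have mono: "t i < t j \<longleftrightarrow> i < j" if "dep (w ! i) (w ! j)" for i j
    using that 1(3) w dep_sym by (auto simp: t_def)
  obtain R D where R: "is_redex ((!) w) {..<n} R" "D \<in> dels R" "c = coef R"
    and v: "v = word_on ((!) w) ({..<n} - D) n"
    using assms(2) unfolding step_def n_def by blast
  have R': "is_redex ((!) w') {..<n} (map_redex t R)"
    by (rule is_redex_map[OF tt, where lab = "(!) w"]) (use lab tn mono R in auto)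
  have "step w' c (word_on ((!) w') ({..<n} - t ` D) n)"
    unfolding step_def using R' dels_map[OF R(2)] coef_map R(3) n by metis
  moreover have "comm_eq v (word_on ((!) w') ({..<n} - t ` D) n)"
  proof -
    let ?Q = "{..<n} - D" and ?Q' = "{..<n} - t ` D"
    have mem: "t i \<in> t ` D \<longleftrightarrow> i \<in> D" for i using tt by (metis imageE imageI)
    have Q: "p \<in> ?Q' \<longleftrightarrow> Suc p \<in> ?Q" "Suc p \<in> ?Q' \<longleftrightarrow> p \<in> ?Q"
      using mem[of p] mem[of "Suc p"] n by (auto simp: t_def)
    have Q2: "i \<in> ?Q' \<longleftrightarrow> i \<in> ?Q" if "i \<noteq> p" "i \<noteq> Suc p" for i
      using mem[of i] that by (auto simp: t_def)
    have s: "seg ((!) w') ?Q' i j = seg ((!) w) ?Q i j" if "j \<le> p \<or> Suc p < i" for i j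
    proof -
      have ne: "z \<noteq> p" "z \<noteq> Suc p" if "z \<in> set [i..<j]" for z
        using that \<open>j \<le> p \<or> Suc p < i\<close> by auto
      have "filter (\<lambda>z. z \<in> ?Q') [i..<j] = filter (\<lambda>z. z \<in> ?Q) [i..<j]"
        by (rule filter_cong[OF refl], rule Q2) (use ne in auto)
      moreover have "map ((!) w') (filter (\<lambda>z. z \<in> ?Q) [i..<j]) = map ((!) w) (filter (\<lambda>z. z \<in> ?Q) [i..<j])"
        by (rule map_cong[OF refl], rule w') (use ne in auto)
      ultimately show ?thesis unfolding seg_def by simp
    qed
    have split: "word_on ((!) z) Q n = seg ((!) z) Q 0 p @ (if p \<in> Q then [z ! p] else []) @
        (if Suc p \<in> Q then [z ! Suc p] else []) @ seg ((!) z) Q (Suc (Suc p)) n" for z Q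
      using seg_split[of 0 p n "(!) z" Q] seg_split[of "Suc p" "Suc p" n "(!) z" Q] n
      by (simp add: word_on_def seg_def)
    have sw: "swap (A @ w ! p # w ! Suc p # B) (A @ w ! Suc p # w ! p # B)" for A B
      using swap.intros[of "w ! p" "w ! Suc p" A B] 1(3) w by simp
    show ?thesis
      unfolding v split[of w'] split[of w] Q using w s sw by auto
  qed
  ultimately show ?thesis by blast
qed

definition form1 :: "'a list \<Rightarrow> bool" where
  "form1 w \<longleftrightarrow> (\<exists>A s X B. w = A @ s # X @ s # B \<and> (\<forall>x\<in>set X. \<not> dep x s))"

definition form2 :: "'a list \<Rightarrow> bool" where
  "form2 w \<longleftrightarrow> (\<exists>A s X t Y B. w = A @ s # X @ t # Y @ s # B \<and> m s t = 3 \<and>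
     (\<forall>x\<in>set X. \<not> dep x s) \<and> (\<forall>x\<in>set Y. \<not> dep x s))"

definition form3 :: "'a list \<Rightarrow> bool" where
  "form3 w \<longleftrightarrow> (\<exists>A s X t Y Z B. w = A @ s # X @ t # Y @ s # Z @ t # B \<and> m s t = 4 \<and>
     (\<forall>x\<in>set X. \<not> dep x s) \<and> (\<forall>x\<in>set Y. \<not> dep x s) \<and> (\<forall>x\<in>set Y. \<not> dep x t) \<and> (\<forall>x\<in>set Z. \<not> dep x t))"

definition irred :: "'a list \<Rightarrow> bool" where
  "irred w \<longleftrightarrow> \<not> (\<exists>c v. step w c v)"

lemma stepI:
  assumes "is_redex ((!) w) {..<length w} R" "D \<in> dels R" "seg ((!) w) ({..<length w} - D) 0 (length w) = v"
  shows "step w (coef R) v"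
  using assms unfolding step_def word_on_def by blast

lemma step_far_1:
  assumes "\<forall>x\<in>set X. \<not> dep x s"
  shows "step (A @ s # X @ s # B) d (A @ s # X @ B)"
proof -
  let ?w = "A @ s # X @ s # B" and ?i = "length A" and ?j = "Suc (length A + length X)"
  have X: "?w ! z \<in> set X" if "?i < z" "z < ?j" for z
    using that by (auto simp: nth_append nth_Cons' intro!: nth_mem)
  have R: "is_redex ((!) ?w) {..<length ?w} (R1 ?i ?j)"
    using assms X by (auto simp: nth_append)
  have S: "seg ((!) ?w) ({..<length ?w} - {?j}) 0 (length ?w) = A @ s # X @ B"
    using seg_split[of 0 ?j "length ?w" "(!) ?w" "{..<length ?w} - {?j}"]
    by (simp add: seg_nth subset_iff eval_nat_numeral)
  show ?thesis using stepI[OF R, of "{?j}", OF _ S] by simp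
qed

lemma step_far_3:
  assumes "\<forall>x\<in>set X. \<not> dep x s" "\<forall>x\<in>set Y. \<not> dep x s" "m s t = 3"
  shows "step (A @ s # X @ t # Y @ s # B) k3 (A @ s # X @ Y @ B)"
proof -
  let ?w = "A @ s # X @ t # Y @ s # B" and ?i = "length A" and ?k = "Suc (length A + length X)"
    and ?j = "Suc (Suc (length A + length X + length Y))"
  have X: "?w ! z \<in> set X" if "?i < z" "z < ?k" for z
    using that by (auto simp: nth_append nth_Cons' intro!: nth_mem)
  have Y: "?w ! z \<in> set Y" if "?k < z" "z < ?j" for z
    using that by (auto simp: nth_append nth_Cons' intro!: nth_mem)
  have nths: "?w ! ?i = s" "?w ! ?k = t" "?w ! ?j = s"
    by (auto simp: nth_append nth_Cons')
  have XY: "\<not> dep (?w ! z) s" if "?i < z" "z < ?j" "z \<noteq> ?k" for z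
    using X[of z] Y[of z] that assms by (cases "z < ?k") auto
  have R: "is_redex ((!) ?w) {..<length ?w} (R2 ?i ?k ?j)"
    using assms XY by (simp only: is_redex.simps nths) auto
  have S: "seg ((!) ?w) ({..<length ?w} - {?k,?j}) 0 (length ?w) = A @ s # X @ Y @ B"
    using seg_split[of 0 ?k "length ?w" "(!) ?w" "{..<length ?w} - {?k,?j}"]
      seg_split[of "Suc ?k" ?j "length ?w" "(!) ?w" "{..<length ?w} - {?k,?j}"]
    by (simp add: seg_nth subset_iff eval_nat_numeral)
  show ?thesis using stepI[OF R, of "{?k,?j}", OF _ S] by simp
qed

lemma step_far_4:
  assumes "\<forall>x\<in>set X. \<not> dep x s" "\<forall>x\<in>set Y. \<not> dep x s" "\<forall>x\<in>set Y. \<not> dep x t" "\<forall>x\<in>set Z. \<not> dep x t" "m s t = 4"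
  shows "step (A @ s # X @ t # Y @ s # Z @ t # B) k4 (A @ s # X @ t # Y @ Z @ B)"
proof -
  let ?w = "A @ s # X @ t # Y @ s # Z @ t # B" and ?i = "length A" and ?k = "Suc (length A + length X)"
    and ?j = "Suc (Suc (length A + length X + length Y))"
    and ?l = "Suc (Suc (Suc (length A + length X + length Y + length Z)))"
  have X: "?w ! z \<in> set X" if "?i < z" "z < ?k" for z
    using that by (auto simp: nth_append nth_Cons' intro!: nth_mem)
  have Y: "?w ! z \<in> set Y" if "?k < z" "z < ?j" for z
    using that by (auto simp: nth_append nth_Cons' intro!: nth_mem)
  have Z: "?w ! z \<in> set Z" if "?j < z" "z < ?l" for z
    using that by (auto simp: nth_append nth_Cons' intro!: nth_mem)
  have nths: "?w ! ?i = s" "?w ! ?k = t" "?w ! ?j = s" "?w ! ?l = t"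
    by (auto simp: nth_append nth_Cons')
  have XY: "\<not> dep (?w ! z) s" if "?i < z" "z < ?j" "z \<noteq> ?k" for z
    using X[of z] Y[of z] that assms by (cases "z < ?k") auto
  have YZ: "\<not> dep (?w ! z) t" if "?k < z" "z < ?l" "z \<noteq> ?j" for z
    using Y[of z] Z[of z] that assms by (cases "z < ?j") auto
  have R: "is_redex ((!) ?w) {..<length ?w} (R3 ?i ?k ?j ?l)"
    using assms XY YZ by (simp only: is_redex.simps nths) auto
  have S: "seg ((!) ?w) ({..<length ?w} - {?j,?l}) 0 (length ?w) = A @ s # X @ t # Y @ Z @ B"
    using seg_split[of 0 ?j "length ?w" "(!) ?w" "{..<length ?w} - {?j,?l}"]
      seg_split[of "Suc ?j" ?l "length ?w" "(!) ?w" "{..<length ?w} - {?j,?l}"]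
    by (simp add: seg_nth subset_iff eval_nat_numeral)
  show ?thesis using stepI[OF R, of "{?j,?l}", OF _ S] by simp
qed

text \<open>Translates positions into factorizations; the combinatorics of words from here on uses
  only the latter.\<close>

lemma irred_iff: "irred w \<longleftrightarrow> \<not> form1 w \<and> \<not> form2 w \<and> \<not> form3 w"
proof
  assume "irred w"
  then have n: "\<not> step w c v" for c v by (auto simp: irred_def)
  show "\<not> form1 w \<and> \<not> form2 w \<and> \<not> form3 w"
  proof (intro conjI notI)
    assume "form1 w"
    then obtain A s X B where "w = A @ s # X @ s # B" "\<forall>x\<in>set X. \<not> dep x s"
      unfolding form1_def by blast
    then show False using n step_far_1[of X s A B] by simp
  next
    assume "form2 w"
    then obtain A s X t Y B where "w = A @ s # X @ t # Y @ s # B" "m s t = 3"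
      "\<forall>x\<in>set X. \<not> dep x s" "\<forall>x\<in>set Y. \<not> dep x s"
      unfolding form2_def by blast
    then show False using n step_far_3[of X s Y t A B] by simp
  next
    assume "form3 w"
    then obtain A s X t Y Z B where "w = A @ s # X @ t # Y @ s # Z @ t # B" "m s t = 4"
      "\<forall>x\<in>set X. \<not> dep x s" "\<forall>x\<in>set Y. \<not> dep x s" "\<forall>x\<in>set Y. \<not> dep x t" "\<forall>x\<in>set Z. \<not> dep x t"
      unfolding form3_def by blast
    then show False using n step_far_4[of X s Y t Z A B] by simp
  qed
next
  assume n: "\<not> form1 w \<and> \<not> form2 w \<and> \<not> form3 w"
  let ?s = "\<lambda>a b. seg ((!) w) {..<length w} a b"
  have w: "w = ?s 0 (length w)" using word_on_full by (simp add: word_on_def)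
  have "\<not> is_redex ((!) w) {..<length w} R" for R
  proof
    assume R: "is_redex ((!) w) {..<length w} R"
    show False
    proof (cases R)
      case eq: (R1 i j)
      note R' = redex_R1D[OF R[unfolded eq]]
      have "w = ?s 0 i @ w ! i # ?s (Suc i) j @ w ! i # ?s (Suc j) (length w)"
        using w seg_split[of 0 i "length w" "(!) w" "{..<length w}"]
          seg_split[of "Suc i" j "length w" "(!) w" "{..<length w}"] R' by simp
      moreover have "\<forall>x\<in>set (?s (Suc i) j). \<not> dep x (w ! i)"
        using R[unfolded eq] by (auto simp: set_seg)
      ultimately show False using n unfolding form1_def by blast
    next
      case eq: (R2 i k j)
      note R' = redex_R2D[OF R[unfolded eq]]
      have "w = ?s 0 i @ w ! i # ?s (Suc i) k @ w ! k # ?s (Suc k) j @ w ! i # ?s (Suc j) (length w)"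
        using w seg_split[of 0 i "length w" "(!) w" "{..<length w}"]
          seg_split[of "Suc i" k "length w" "(!) w" "{..<length w}"]
          seg_split[of "Suc k" j "length w" "(!) w" "{..<length w}"] R' by simp
      moreover have "\<forall>x\<in>set (?s (Suc i) k). \<not> dep x (w ! i)" "\<forall>x\<in>set (?s (Suc k) j). \<not> dep x (w ! i)"
        using R[unfolded eq] by (auto simp: set_seg)
      ultimately show False using n R'(7) unfolding form2_def by blast
    next
      case eq: (R3 i k j l)
      note R' = redex_R3D[OF R[unfolded eq]]
      have "w = ?s 0 i @ w ! i # ?s (Suc i) k @ w ! k # ?s (Suc k) j @ w ! i # ?s (Suc j) l @ w ! k # ?s (Suc l) (length w)"
        using w seg_split[of 0 i "length w" "(!) w" "{..<length w}"]
          seg_split[of "Suc i" k "length w" "(!) w" "{..<length w}"]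
          seg_split[of "Suc k" j "length w" "(!) w" "{..<length w}"]
          seg_split[of "Suc j" l "length w" "(!) w" "{..<length w}"] R'(1-10) by simp
      moreover have "\<forall>x\<in>set (?s (Suc i) k). \<not> dep x (w ! i)" "\<forall>x\<in>set (?s (Suc k) j). \<not> dep x (w ! i)"
        "\<forall>x\<in>set (?s (Suc k) j). \<not> dep x (w ! k)" "\<forall>x\<in>set (?s (Suc j) l). \<not> dep x (w ! k)"
        using R[unfolded eq] by (auto simp: set_seg)
      ultimately show False using n R'(10) unfolding form3_def by blast
    qed
  qed
  then show "irred w" unfolding irred_def step_def by blast
qed

lemma swap_irred: "swap w w' \<Longrightarrow> irred w \<longleftrightarrow> irred w'"
  using swap_step swap_sym unfolding irred_def by blast

section \<open>Coefficient functionals\<close>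

text \<open>Extends values given on irreducible words by reducing along an arbitrarily chosen step.
  That the choice does not matter is the content of \<open>ext_red_upto\<close>.\<close>

function ext :: "('a list \<Rightarrow> 'k) \<Rightarrow> 'a list \<Rightarrow> 'k" where
  "ext \<beta> w = (if irred w then \<beta> w else
     (let p = (SOME p. step w (fst p) (snd p)) in fst p * ext \<beta> (snd p)))"
  by pat_completeness auto
termination
proof (relation "measure (\<lambda>(\<beta>, w). length w)", simp, clarsimp)
  fix w assume "\<not> irred w"
  then have "\<exists>p. step w (fst p) (snd p)" by (simp add: irred_def)
  from someI_ex[OF this] show "length (snd (SOME p. step w (fst p) (snd p))) < length w"
    by (rule step_length)
qed

declare ext.simps [simp del]

lemma ext_irred: "irred w \<Longrightarrow> ext \<beta> w = \<beta> w"
  by (simp add: ext.simps)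

text \<open>Induction on the length, with three claims for words of length exactly \<open>n\<close>:
  any single step gives the chosen value, by local confluence; a commutation preserves the value,
  since steps carry over along it; hence so does a whole chain of reductions.\<close>

lemma ext_red_upto:
  assumes \<beta>: "\<And>w w'. swap w w' \<Longrightarrow> \<beta> w = \<beta> w'"
  shows "length w < n \<Longrightarrow> red w c v \<Longrightarrow> ext \<beta> w = c * ext \<beta> v"
proof (induction n arbitrary: w c v)
  case (Suc n)
  note IH = Suc.IH
  have st: "ext \<beta> w = c * ext \<beta> v" if w: "length w = n" and s: "step w c v" for w c v
  proof -
    let ?p = "SOME p. step w (fst p) (snd p)"
    have ir: "\<not> irred w" using s by (auto simp: irred_def)
    have "step w (fst ?p) (snd ?p)" by (rule someI[of _ "(c, v)"]) (simp add: s)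
    then obtain R D where R: "is_redex ((!) w) {..<n} R" "D \<in> dels R" "fst ?p = coef R"
      "snd ?p = word_on ((!) w) ({..<n} - D) n" using w unfolding step_def by auto
    from s obtain R' D' where R': "is_redex ((!) w) {..<n} R'" "D' \<in> dels R'" "c = coef R'"
      "v = word_on ((!) w) ({..<n} - D') n" using w unfolding step_def by auto
    have "fst ?p * ext \<beta> (snd ?p) = c * ext \<beta> v"
      unfolding R(3,4) R'(3,4) by (rule redex_confluent[OF IH R(1,2) R'(1,2)])
    then show ?thesis using ir by (subst ext.simps) (simp add: Let_def)
  qed
  have sw: "ext \<beta> w = ext \<beta> w'" if w: "length w = n" and s: "swap w w'" for w w'
  proof (cases "irred w")
    case True
    then show ?thesis using swap_irred[OF s] \<beta>[OF s] by (simp add: ext_irred)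
  next
    case False
    then obtain c v where v: "step w c v" by (auto simp: irred_def)
    then obtain v' where v': "step w' c v'" "comm_eq v v'" using swap_step[OF s] by blast
    have "length w' = n" using w s by (auto elim: swap.cases)
    then have "ext \<beta> w' = c * ext \<beta> v'" using st v' by blast
    moreover have "ext \<beta> w = c * ext \<beta> v" using st[OF w v] .
    moreover have "ext \<beta> v = ext \<beta> v'"
      using IH[OF _ red_comm_eq[OF v'(2) red_refl]] step_length[OF v] w by simp
    ultimately show ?thesis by simp
  qed
  have "red w c v \<Longrightarrow> length w = n \<Longrightarrow> ext \<beta> w = c * ext \<beta> v" for w c v
  proof (induction rule: red.induct)
    case (red_swap w w'' c w')
    then show ?case using sw[of w w''] by (auto elim: swap.cases)
  next
    case (red_1 u s v c w')
    have "ext \<beta> (u @ [s,s] @ v) = d * ext \<beta> (u @ [s] @ v)"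
      using st[OF _ step_far_1[of "[]" s u v]] red_1.prems by simp
    moreover have "ext \<beta> (u @ [s] @ v) = c * ext \<beta> w'"
      using IH red_1 by simp
    ultimately show ?case by (simp add: mult.assoc)
  next
    case (red_3 s t u v c w')
    have "ext \<beta> (u @ [s,t,s] @ v) = k3 * ext \<beta> (u @ [s] @ v)"
      using st[OF _ step_far_3[of "[]" s "[]" t u v]] red_3.prems red_3.hyps by simp
    moreover have "ext \<beta> (u @ [s] @ v) = c * ext \<beta> w'"
      using IH red_3 by simp
    ultimately show ?case by (simp add: mult.assoc)
  next
    case (red_4 s t u v c w')
    have "ext \<beta> (u @ [s,t,s,t] @ v) = k4 * ext \<beta> (u @ [s,t] @ v)"
      using st[OF _ step_far_4[of "[]" s "[]" t "[]" u v]] red_4.prems red_4.hyps by simp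
    moreover have "ext \<beta> (u @ [s,t] @ v) = c * ext \<beta> w'"
      using IH red_4 by simp
    ultimately show ?case by (simp add: mult.assoc)
  qed simp
  then show ?case using IH Suc.prems by (cases "length w = n") auto
qed simp

text \<open>For irreducible \<open>\<mu>\<close>, the coefficient of its commutation class after
  complete reduction. The indicator function is constant on classes, as \<open>ext_red_upto\<close>
  requires.\<close>

definition coeff_of :: "'a list \<Rightarrow> 'a list \<Rightarrow> 'k" where
  "coeff_of \<mu> = ext (\<lambda>w. if comm_eq w \<mu> then 1 else 0)"

lemma coeff_of_red: "red w c v \<Longrightarrow> coeff_of \<mu> w = c * coeff_of \<mu> v"
proof -
  have "(if comm_eq w \<mu> then 1 else 0) = (if comm_eq w' \<mu> then 1 else (0::'k))" if "swap w w'" for w w'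
    using that swap_sym[OF that] converse_rtranclp_into_rtranclp[of swap] by auto
  then show "red w c v \<Longrightarrow> coeff_of \<mu> w = c * coeff_of \<mu> v"
    unfolding coeff_of_def by (rule ext_red_upto[OF _ lessI])
qed

lemma red_irred_exists: "\<exists>c v. red w c v \<and> irred v"
proof (induction w rule: length_induct)
  case (1 w)
  show ?case
  proof (cases "irred w")
    case True
    then show ?thesis using red_refl by blast
  next
    case False
    then obtain c v where v: "step w c v" by (auto simp: irred_def)
    then obtain c' v' where "red v c' v'" "irred v'" using 1 step_length by blast
    then show ?thesis using red_trans[OF step_red[OF v]] by blast
  qed
qed

text \<open>Every rule other than a commutation shortens the word, so equal lengths leave only
  commutations and the factor 1.\<close>

lemma red_mset_eq: "red w c v \<Longrightarrow> length v = length w \<Longrightarrow> c = 1 \<and> comm_eq w v"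
proof (induction rule: red.induct)
  case (red_swap w w'' c w')
  then show ?case by (auto elim!: swap.cases intro: converse_rtranclp_into_rtranclp swap.intros)
next
  case (red_1 u s v c w')
  then show ?case using size_mset_mono[OF red_mset[OF red_1.hyps]] by simp
next
  case (red_3 s t u v c w')
  then show ?case using size_mset_mono[OF red_mset[OF red_3.hyps(2)]] by simp
next
  case (red_4 s t u v c w')
  then show ?case using size_mset_mono[OF red_mset[OF red_4.hyps(2)]] by simp
qed simp

text \<open>Reductions only delete and permute letters, and the irreducible word finally reached
  must be equivalent to \<open>\<mu>\<close>.\<close>

lemma coeff_of_nonzero:
  assumes "coeff_of \<mu> w \<noteq> 0"
  shows "mset \<mu> \<subseteq># mset w" "length w = length \<mu> \<Longrightarrow> comm_eq w \<mu>"
proof -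
  obtain c v where v: "red w c v" "irred v" using red_irred_exists by blast
  have "comm_eq v \<mu>"
    using assms coeff_of_red[OF v(1), of \<mu>] ext_irred[OF v(2)] by (auto simp: coeff_of_def split: if_splits)
  then have m: "mset v = mset \<mu>" by (rule comm_eq_mset)
  then show "mset \<mu> \<subseteq># mset w" using red_mset[OF v(1)] by simp
  assume "length w = length \<mu>"
  then have "length v = length w" using m by (metis size_mset)
  then show "comm_eq w \<mu>" using red_mset_eq[OF v(1)] \<open>comm_eq v \<mu>\<close> by (meson rtranclp_trans)
qed

lemma coeff_of_irred: "irred \<mu> \<Longrightarrow> comm_eq w \<mu> \<Longrightarrow> coeff_of \<mu> w = 1"
  using coeff_of_red[OF red_comm_eq[OF _ red_refl], of w \<mu> \<mu>] by (simp add: coeff_of_def ext_irred)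

section \<open>Commutation classes and their projections to dependent pairs of letters\<close>

definition proj :: "'a \<Rightarrow> 'a \<Rightarrow> 'a list \<Rightarrow> 'a list" where
  "proj a b = filter (\<lambda>x. x = a \<or> x = b)"

lemma comm_eq_proj: "comm_eq u v \<Longrightarrow> dep a b \<Longrightarrow> proj a b u = proj a b v"
proof (induction rule: rtranclp_induct)
  case (step v w)
  then show ?case by (auto elim!: swap.cases simp: proj_def dep_sym)
qed simp

text \<open>The classical embedding of a trace monoid into a product of free monoids. The letter
  \<open>s\<close> at the head of \<open>u\<close> can be brought to the front of \<open>v\<close>:
  a dependent letter before its first occurrence in \<open>v\<close> would precede it in a
  projection that starts with \<open>s\<close>.\<close>

lemma proj_comm_eq: "(\<And>a b. dep a b \<Longrightarrow> proj a b u = proj a b v) \<Longrightarrow> comm_eq u v"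
proof (induction u arbitrary: v)
  case Nil
  have "v = []"
  proof (cases v)
    case (Cons x xs)
    then show ?thesis using Nil[of x x] by (simp add: proj_def)
  qed simp
  then show ?case by simp
next
  case (Cons s u)
  have "s \<in> set (proj s s (s # u))" by (simp add: proj_def)
  then have "s \<in> set v" unfolding Cons.prems[OF dep_refl] by (simp add: proj_def)
  then obtain x y where v: "v = x @ s # y" "s \<notin> set x" by (meson split_list_first)
  have far: "\<not> dep z s" if "z \<in> set x" for z
  proof
    assume "dep z s"
    then have "s # proj z s u = proj z s x @ s # proj z s y"
      using Cons.prems[of z s] v by (simp add: proj_def)
    moreover have "proj z s x \<noteq> []" using that by (auto simp: proj_def filter_empty_conv)
    ultimately have "s \<in> set (proj z s x)" by (metis append_self_conv2 hd_append2 hd_in_set list.sel(1))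
    then show False using v by (simp add: proj_def)
  qed
  have t: "comm_eq v (s # x @ y)" using comm_eq_move_left[of x s "[]" y] far v by simp
  have "proj a b u = proj a b (x @ y)" if "dep a b" for a b
    using Cons.prems[OF that] comm_eq_proj[OF t that] by (auto simp: proj_def split: if_splits)
  then have "comm_eq u (x @ y)" by (rule Cons.IH)
  then have "comm_eq (s # u) (s # x @ y)" using comm_eq_context[of u "x @ y" "[s]" "[]"] by simp
  then show ?case using t comm_eq_sym by (meson rtranclp_trans)
qed

lemma comm_eq_irred: "comm_eq u v \<Longrightarrow> irred u \<longleftrightarrow> irred v"
  by (induction rule: rtranclp_induct) (simp_all add: swap_irred)

section \<open>Reversal, and irreducibility as a condition on gaps\<close>

lemma form_rev:
  "form1 (rev w) \<longleftrightarrow> form1 w" "form2 (rev w) \<longleftrightarrow> form2 w" "form3 (rev w) \<longleftrightarrow> form3 w"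
proof -
  have 1: "form1 (rev w)" if "form1 w" for w
  proof -
    from that obtain A s X B where "w = A @ s # X @ s # B" "\<forall>x\<in>set X. \<not> dep x s"
      unfolding form1_def by blast
    then have "rev w = rev B @ s # rev X @ s # rev A" "\<forall>x\<in>set (rev X). \<not> dep x s" by auto
    then show ?thesis unfolding form1_def by blast
  qed
  have 2: "form2 (rev w)" if "form2 w" for w
  proof -
    from that obtain A s X t Y B where "w = A @ s # X @ t # Y @ s # B" "m s t = 3"
      "\<forall>x\<in>set X. \<not> dep x s" "\<forall>x\<in>set Y. \<not> dep x s"
      unfolding form2_def by blast
    then have "rev w = rev B @ s # rev Y @ t # rev X @ s # rev A" "m s t = 3"
      "\<forall>x\<in>set (rev X). \<not> dep x s" "\<forall>x\<in>set (rev Y). \<not> dep x s" by auto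
    then show ?thesis unfolding form2_def by blast
  qed
  have 3: "form3 (rev w)" if "form3 w" for w
  proof -
    from that obtain A s X t Y Z B where "w = A @ s # X @ t # Y @ s # Z @ t # B" "m s t = 4"
      "\<forall>x\<in>set X. \<not> dep x s" "\<forall>x\<in>set Y. \<not> dep x s" "\<forall>x\<in>set Y. \<not> dep x t" "\<forall>x\<in>set Z. \<not> dep x t"
      unfolding form3_def by blast
    then have "rev w = rev B @ t # rev Z @ s # rev Y @ t # rev X @ s # rev A" "m t s = 4"
      "\<forall>x\<in>set (rev Z). \<not> dep x t" "\<forall>x\<in>set (rev Y). \<not> dep x t" "\<forall>x\<in>set (rev Y). \<not> dep x s" "\<forall>x\<in>set (rev X). \<not> dep x s"
      using m_sym[of t s] by auto
    then show ?thesis unfolding form3_def by blast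
  qed
  show "form1 (rev w) \<longleftrightarrow> form1 w" "form2 (rev w) \<longleftrightarrow> form2 w" "form3 (rev w) \<longleftrightarrow> form3 w"
    using 1[of w] 1[of "rev w"] 2[of w] 2[of "rev w"] 3[of w] 3[of "rev w"] by auto
qed

lemma irred_rev: "irred (rev w) \<longleftrightarrow> irred w"
  by (simp add: irred_iff form_rev)

lemma filter_singleD: "filter P x = [t] \<Longrightarrow> \<exists>X Y. x = X @ t # Y \<and> (\<forall>z\<in>set X. \<not> P z) \<and> (\<forall>z\<in>set Y. \<not> P z)"
proof -
  assume a: "filter P x = [t]"
  then obtain X Y where x: "x = X @ t # Y" "\<forall>z\<in>set X. \<not> P z" "P t" and r: "filter P Y = []"
    unfolding filter_eq_Cons_iff by auto
  then show ?thesis by (auto simp: filter_empty_conv)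
qed

text \<open>Of the letters between two occurrences of \<open>s\<close>, only those that depend on
  \<open>s\<close> matter. Without any of them there would be a square; \<open>irred_2\<close>
  treats the case of exactly one.\<close>

lemma irred_1: "irred (A @ s # x @ s # B) \<Longrightarrow> filter (\<lambda>z. dep z s) x \<noteq> []"
proof
  assume "irred (A @ s # x @ s # B)" "filter (\<lambda>z. dep z s) x = []"
  moreover from this have "form1 (A @ s # x @ s # B)"
    unfolding form1_def filter_empty_conv by blast
  ultimately show False by (simp add: irred_iff)
qed

lemma irred_2:
  assumes "irred (A @ s # x @ s # B)" "filter (\<lambda>z. dep z s) x = [t]"
  shows "m s t \<noteq> 3"
proof
  assume "m s t = 3"
  moreover obtain X Y where "x = X @ t # Y" "\<forall>z\<in>set X. \<not> dep z s" "\<forall>z\<in>set Y. \<not> dep z s"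
    using filter_singleD[OF assms(2)] by blast
  ultimately have "A @ s # x @ s # B = A @ s # X @ t # Y @ s # B" "m s t = 3"
    "\<forall>z\<in>set X. \<not> dep z s" "\<forall>z\<in>set Y. \<not> dep z s" by auto
  then have "form2 (A @ s # x @ s # B)" unfolding form2_def by blast
  then show False using assms irred_iff by blast
qed

lemma irred_3:
  assumes "irred (A @ s # X @ t # Y @ s # Z @ t # B)" "m s t = 4"
    "\<forall>z\<in>set X. \<not> dep z s" "\<forall>z\<in>set Y. \<not> dep z s" "\<forall>z\<in>set Y. \<not> dep z t" "\<forall>z\<in>set Z. \<not> dep z t"
  shows False
proof -
  have "form3 (A @ s # X @ t # Y @ s # Z @ t # B)" unfolding form3_def using assms(2-) by blast
  then show False using assms(1) irred_iff by blast
qed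

end

section \<open>The Coxeter graphs\<close>

definition adj3 :: "gen \<Rightarrow> gen \<Rightarrow> bool" where
  "adj3 a b \<longleftrightarrow> (\<exists>i. a = Sigma i \<and> b = Sigma (Suc i)) \<or> a = SigmaBar \<and> b = Sigma 2"

definition adj4 :: "nat \<Rightarrow> gen \<Rightarrow> gen \<Rightarrow> bool" where
  "adj4 N a b \<longleftrightarrow> a = Sigma (N - 1) \<and> b = Tee N"

text \<open>The Coxeter matrix of affine type B, with the fork at \<open>Sigma 2\<close> and the
  double bond at \<open>Tee N\<close>.\<close>

definition cox :: "nat \<Rightarrow> gen \<Rightarrow> gen \<Rightarrow> nat" where
  "cox N a b = (if a = b then 1 else if adj3 a b \<or> adj3 b a then 3 else if adj4 N a b \<or> adj4 N b a then 4 else 2)"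

lemma cox_sym: "cox N a b = cox N b a"
  by (simp add: cox_def)

lemma cox_eq_1: "cox N a b = 1 \<longleftrightarrow> a = b"
  by (simp add: cox_def)

locale tlb_pair =
  fixes q :: "'k::comm_ring_1" and n :: nat
  assumes n3: "3 \<le> n"
begin

text \<open>\<open>A\<close> belongs to the source of the arrow and \<open>B\<close> to its target.
  The target has one node more: the double bond moves from \<open>p\<close>, \<open>f\<close> to
  \<open>e\<close>, \<open>f'\<close>, and \<open>e\<close> separates \<open>p\<close> from
  \<open>f'\<close>, which now commute.\<close>

sublocale A: coxeter_words "cox n" "q + 1" q "2 * q"
  by standard (rule cox_sym cox_eq_1)+

sublocale B: coxeter_words "cox (Suc n)" "q + 1" q "2 * q"
  by standard (rule cox_sym cox_eq_1)+

abbreviation "p \<equiv> Sigma (n - 1)"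
abbreviation "e \<equiv> Sigma n"
abbreviation "f \<equiv> Tee n"
abbreviation "f' \<equiv> Tee (Suc n)"

text \<open>The neighbours of \<open>Sigma j\<close> towards the fork; for \<open>j = 2\<close>
  these are both prongs.\<close>

definition lower :: "nat \<Rightarrow> gen \<Rightarrow> bool" where
  "lower j x \<longleftrightarrow> x = Sigma (j - 1) \<or> j = 2 \<and> x = SigmaBar"

definition upper :: "nat \<Rightarrow> gen" where
  "upper j = (if j = n - 1 then f else Sigma (Suc j))"

lemma dep_Sigma:
  "2 \<le> j \<Longrightarrow> j \<le> n - 1 \<Longrightarrow> x \<in> TLB_gens n \<Longrightarrow> A.dep x (Sigma j) \<longleftrightarrow> x = Sigma j \<or> lower j x \<or> x = upper j"
  using n3 by (cases x) (auto simp: A.dep_def cox_def adj3_def adj4_def lower_def upper_def TLB_gens_def)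

lemma dep_end:
  "a = Sigma 1 \<or> a = SigmaBar \<Longrightarrow> x \<in> TLB_gens n \<Longrightarrow> A.dep x a \<longleftrightarrow> x = a \<or> x = Sigma 2"
  using n3 by (cases x) (auto simp: A.dep_def cox_def adj3_def adj4_def TLB_gens_def)

lemma dep_f: "x \<in> TLB_gens n \<Longrightarrow> A.dep x f \<longleftrightarrow> x = f \<or> x = p"
  using n3 by (cases x) (auto simp: A.dep_def cox_def adj3_def adj4_def TLB_gens_def)

lemma cox_lower: "2 \<le> j \<Longrightarrow> lower j x \<Longrightarrow> cox N (Sigma j) x = 3"
  by (cases j) (auto simp: lower_def cox_def adj3_def)

section \<open>Gaps between two occurrences of the same letter\<close>

lemma last_two:
  assumes "filter P x \<noteq> []" "\<nexists>t. filter P x = [t]"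
  shows "\<exists>x1 a x2 b x3. x = x1 @ a # x2 @ b # x3 \<and> P a \<and> P b \<and> (\<forall>z\<in>set x2. \<not> P z) \<and> (\<forall>z\<in>set x3. \<not> P z)"
proof -
  obtain y b x3 where x: "x = y @ b # x3" "P b" "\<forall>z\<in>set x3. \<not> P z"
    using split_list_last_prop[of x P] assms(1) by (auto simp: filter_empty_conv)
  then have "filter P y \<noteq> []" using assms(2) by (auto simp: filter_empty_conv)
  then obtain x1 a x2 where "y = x1 @ a # x2" "P a" "\<forall>z\<in>set x2. \<not> P z"
    using split_list_last_prop[of y P] by (auto simp: filter_empty_conv)
  then show ?thesis using x by (metis append.assoc append_Cons)
qed

text \<open>No dependent letter in the gap would leave a square, and a single lower one would allow
  the rule for \<open>m = 3\<close>; with the upper neighbour absent, at least two lower ones must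
  be there.\<close>

lemma irred_pair_low:
  assumes ir: "A.irred (U @ Sigma j # x @ Sigma j # V)" and w: "set x \<subseteq> TLB_gens n"
    and j: "2 \<le> j" "j \<le> n - 1" and x: "Sigma j \<notin> set x" "upper j \<notin> set x"
  shows "\<exists>x1 a x2 b x3. x = x1 @ a # x2 @ b # x3 \<and> lower j a \<and> lower j b \<and>
    (\<forall>z\<in>set x2. \<not> lower j z) \<and> (\<forall>z\<in>set x3. \<not> lower j z)"
proof (rule last_two)
  have F: "filter (\<lambda>z. A.dep z (Sigma j)) x = filter (lower j) x"
    by (rule filter_cong[OF refl]) (use dep_Sigma[OF j] w x in auto)
  show "filter (lower j) x \<noteq> []" using A.irred_1[OF ir] F by simp
  show "\<nexists>t. filter (lower j) x = [t]"
  proof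
    assume "\<exists>t. filter (lower j) x = [t]"
    then obtain t where t: "filter (lower j) x = [t]" by blast
    have "t \<in> set (filter (lower j) x)" unfolding t by simp
    then have "lower j t" by simp
    then show False using A.irred_2[OF ir, of t] F t cox_lower[OF j(1)] by simp
  qed
qed

text \<open>Once the letters between two occurrences of \<open>\<sigma>\<^sub>j\<close> all lie below \<open>j\<close>, they make a full turn at the fork,
  which leaves no room for a further lower letter next to it.\<close>

lemma turn_right:
  assumes "2 \<le> j" "j \<le> n - 1"
    and "A.irred (U @ Sigma j # x @ Sigma j # y @ Sigma j # V)"
    and "set x \<subseteq> TLB_gens n" "set y \<subseteq> TLB_gens n" "Sigma j \<notin> set x" "Sigma j \<notin> set y" "upper j \<notin> set x"
  shows "\<forall>c\<in>set y. \<not> lower j c"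
  using assms
proof (induction j arbitrary: U x y V rule: nat_induct_at_least)
  case base
  show ?case
  proof (rule ccontr)
    assume "\<not> (\<forall>c\<in>set y. \<not> lower 2 c)"
    then obtain y1 c y2 where y: "y = y1 @ c # y2" "lower 2 c" "\<forall>z\<in>set y1. \<not> lower 2 z"
      using split_list_first_prop[of y "lower 2"] by auto
    obtain x1 a x2 b x3 where x: "x = x1 @ a # x2 @ b # x3" "lower 2 a" "lower 2 b"
      "\<forall>z\<in>set x2. \<not> lower 2 z" "\<forall>z\<in>set x3. \<not> lower 2 z"
      using irred_pair_low[of U 2 x "y @ Sigma 2 # V"] base by auto
    have ends: "z = Sigma 1 \<or> z = SigmaBar" if "lower 2 z" for z using that by (auto simp: lower_def)
    have no: "\<not> A.dep z s" if "z \<in> set x2 \<union> set x3 \<union> set y1" "lower 2 s" for z s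
    proof -
      have "z \<in> TLB_gens n" "z \<noteq> Sigma 2" "\<not> lower 2 z" using that x y base.prems by auto
      then show ?thesis using dep_end[OF ends[OF that(2)], of z] that(2) by auto
    qed
    \<comment> \<open>The last two lower letters are different prongs: between equal ones nothing
      would depend on them, as \<open>Sigma 2\<close> does not occur in \<open>x\<close>.\<close>
    have ab: "a \<noteq> b"
    proof
      assume "a = b"
      then have "filter (\<lambda>z. A.dep z b) x2 = []" using no x by (auto simp: filter_empty_conv)
      then show False using A.irred_1[of "U @ Sigma 2 # x1" b x2] base.prems(2) x \<open>a = b\<close> by auto
    qed
    have S2: "A.dep (Sigma 2) s" "cox n s (Sigma 2) = 3" if "lower 2 s" for s
      using cox_lower[of 2 s n] that by (auto simp: A.dep_def cox_sym)
    have nab: "\<not> A.dep b a" using ab dep_end[OF ends[OF x(2)], of b] base.prems(3) x ends[OF x(3)] by auto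
    \<comment> \<open>Both prongs have just been visited, so \<open>c\<close> repeats one of them
      with a single dependent letter \<open>Sigma 2\<close> in between.\<close>
    have c: "c = a \<or> c = b" using ends[OF y(2)] ends[OF x(2)] ends[OF x(3)] ab by auto
    show False
    proof (cases "c = b")
      case True
      have "filter (\<lambda>z. A.dep z b) (x3 @ Sigma 2 # y1) = [Sigma 2]"
        using no S2[OF x(3)] x(3) by (auto simp: filter_empty_conv)
      then show False
        using A.irred_2[of "U @ Sigma 2 # x1 @ a # x2" b "x3 @ Sigma 2 # y1" "y2 @ Sigma 2 # V"]
          base.prems(2) x(1) y(1) True S2[OF x(3)] by auto
    next
      case False
      then have [simp]: "c = a" using c by simp
      have "filter (\<lambda>z. A.dep z a) (x2 @ b # x3 @ Sigma 2 # y1) = [Sigma 2]"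
        using no S2[OF x(2)] x(2) nab by (auto simp: filter_empty_conv)
      then show False
        using A.irred_2[of "U @ Sigma 2 # x1" a "x2 @ b # x3 @ Sigma 2 # y1" "y2 @ Sigma 2 # V"]
          base.prems(2) x(1) y(1) S2[OF x(2)] by auto
    qed
  qed
next
  case (Suc j)
  have low: "lower (Suc j) z \<longleftrightarrow> z = Sigma j" for z using Suc.hyps by (auto simp: lower_def)
  have up: "upper j = Sigma (Suc j)" using Suc.prems(1) by (auto simp: upper_def)
  show ?case
  proof (rule ccontr)
    assume "\<not> (\<forall>c\<in>set y. \<not> lower (Suc j) c)"
    then obtain y1 y2 where y: "y = y1 @ Sigma j # y2" "Sigma j \<notin> set y1"
      using split_list_first[of "Sigma j" y] by (auto simp: low)
    have "A.irred (U @ Sigma (Suc j) # x @ Sigma (Suc j) # (y @ Sigma (Suc j) # V))"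
      using Suc.prems(2) by simp
    from irred_pair_low[OF this Suc.prems(3) _ Suc.prems(1,5,7)]
    obtain x1 x2 x3 where "x = x1 @ Sigma j # x2 @ Sigma j # x3" "\<forall>z\<in>set x2. z \<noteq> Sigma j" "\<forall>z\<in>set x3. z \<noteq> Sigma j"
      unfolding low using Suc.hyps by auto
    then have x: "x = x1 @ Sigma j # x2 @ Sigma j # x3" "Sigma j \<notin> set x2" "Sigma j \<notin> set x3" by auto
    \<comment> \<open>The gap after the last two occurrences of \<open>Sigma j\<close> in
      \<open>x\<close>. The induction hypothesis excludes lower letters from it, so the single
      \<open>Sigma (Suc j)\<close> is its only letter that depends on
      \<open>Sigma j\<close>.\<close>
    let ?y = "x3 @ Sigma (Suc j) # y1"
    have ir: "A.irred ((U @ Sigma (Suc j) # x1) @ Sigma j # x2 @ Sigma j # ?y @ Sigma j # (y2 @ Sigma (Suc j) # V))"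
      using Suc.prems(2) x(1) y(1) by simp
    have "Sigma (Suc j) \<in> TLB_gens n" using Suc.prems(1) by (auto simp: TLB_gens_def)
    then have sub: "set ?y \<subseteq> TLB_gens n" "set x2 \<subseteq> TLB_gens n" using Suc.prems x y by auto
    have nl: "\<forall>c\<in>set ?y. \<not> lower j c"
      by (rule Suc.IH[OF _ ir]) (use Suc.prems x y sub up in auto)
    have "filter (\<lambda>z. A.dep z (Sigma j)) ?y = [Sigma (Suc j)]"
    proof -
      have "\<not> A.dep z (Sigma j)" if "z \<in> set x3 \<union> set y1" for z
        using that nl sub dep_Sigma[of j z] Suc.hyps Suc.prems x y up by auto
      moreover have "A.dep (Sigma (Suc j)) (Sigma j)"
        by (simp add: A.dep_def cox_def adj3_def)
      ultimately show ?thesis by (auto simp: filter_empty_conv)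
    qed
    then have "cox n (Sigma j) (Sigma (Suc j)) \<noteq> 3"
      using A.irred_2[of "U @ Sigma (Suc j) # x1 @ Sigma j # x2" "Sigma j" ?y] ir by simp
    then show False by (simp add: cox_def adj3_def)
  qed
qed

lemma turn_left:
  assumes "2 \<le> j" "j \<le> n - 1"
    and "A.irred (U @ Sigma j # y @ Sigma j # x @ Sigma j # V)"
    and "set x \<subseteq> TLB_gens n" "set y \<subseteq> TLB_gens n" "Sigma j \<notin> set x" "Sigma j \<notin> set y" "upper j \<notin> set x"
  shows "\<forall>c\<in>set y. \<not> lower j c"
  using turn_right[of j "rev V" "rev x" "rev y" "rev U"] assms
    A.irred_rev[of "U @ Sigma j # y @ Sigma j # x @ Sigma j # V"]
  by simp

section \<open>Leading words\<close>

text \<open>A decorated word: the mark of an occurrence of \<open>\<sigma>\<^sub>n\<^sub>-\<^sub>1\<close> tells on which side \<open>\<sigma>\<^sub>n\<close> is put.\<close>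

fun lead_letter :: "gen \<times> bool \<Rightarrow> gen list" where
  "lead_letter (a, r) = (if a = p then (if r then [p, e] else [e, p]) else if a = f then [f'] else [a])"

definition lead_word :: "(gen \<times> bool) list \<Rightarrow> gen list" where
  "lead_word d = concat (map lead_letter d)"

lemma lead_word_simps [simp]: "lead_word [] = []" "lead_word (x # d) = lead_letter x @ lead_word d" "lead_word (d1 @ d2) = lead_word d1 @ lead_word d2"
  by (simp_all add: lead_word_def)

text \<open>Irreducibility of the decorated word forces the marks around each gap between consecutive occurrences of
  \<open>\<sigma>\<^sub>n\<^sub>-\<^sub>1\<close>: a gap without \<open>t\<^sub>n\<close> must be kept free of \<open>\<sigma>\<^sub>n\<close>, a gap with \<open>t\<^sub>n\<close> must contain \<open>\<sigma>\<^sub>n\<close>, and twice if there is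
  no lower neighbour in it.\<close>

definition good :: "(gen \<times> bool) list \<Rightarrow> bool" where
  "good d \<longleftrightarrow> (\<forall>d1 r x s d2. d = d1 @ (p, r) # x @ (p, s) # d2 \<longrightarrow> p \<notin> fst ` set x \<longrightarrow>
     (if f \<notin> fst ` set x then \<not> r \<and> s
      else if \<exists>a\<in>fst ` set x. lower (n - 1) a then r \<and> s else r \<and> \<not> s))"

lemma goodD:
  "good d \<Longrightarrow> d = d1 @ (p, r) # x @ (p, s) # d2 \<Longrightarrow> p \<notin> fst ` set x \<Longrightarrow>
     (if f \<notin> fst ` set x then \<not> r \<and> s
      else if \<exists>a\<in>fst ` set x. lower (n - 1) a then r \<and> s else r \<and> \<not> s)"
  unfolding good_def by blast

lemma notin_fst_iff: "a \<notin> fst ` S \<longleftrightarrow> (\<forall>z\<in>S. fst z \<noteq> a)"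
  by (metis imageE imageI)

lemma first_split_unique:
  "x @ a # y = x' @ a' # y' \<Longrightarrow> P a \<Longrightarrow> P a' \<Longrightarrow> \<forall>z\<in>set x. \<not> P z \<Longrightarrow> \<forall>z\<in>set x'. \<not> P z
    \<Longrightarrow> x = x' \<and> a = a' \<and> y = y'"
proof (induction x arbitrary: x')
  case Nil
  then show ?case by (cases x') auto
next
  case (Cons z x)
  then show ?case by (cases x') auto
qed

lemma irred_infix: "A.irred (u @ w @ v) \<Longrightarrow> A.irred w"
proof (rule ccontr)
  assume ir: "A.irred (u @ w @ v)" and "\<not> A.irred w"
  then consider "A.form1 w" | "A.form2 w" | "A.form3 w" by (auto simp: A.irred_iff)
  then show False
  proof cases
    case 1
    then obtain C s X D where "w = C @ s # X @ s # D" "\<forall>x\<in>set X. \<not> A.dep x s"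
      unfolding A.form1_def by blast
    then show False using A.irred_1[of "u @ C" s X "D @ v"] ir by (auto simp: filter_empty_conv)
  next
    case 2
    then obtain C s X t Y D where w: "w = C @ s # X @ t # Y @ s # D" "cox n s t = 3"
      "\<forall>x\<in>set X. \<not> A.dep x s" "\<forall>x\<in>set Y. \<not> A.dep x s"
      unfolding A.form2_def by blast
    then have "u @ w @ v = (u @ C) @ s # X @ t # Y @ s # (D @ v)" by simp
    then have "A.form2 (u @ w @ v)" unfolding A.form2_def using w(2-) by blast
    then show False using ir A.irred_iff by blast
  next
    case 3
    then obtain C s X t Y Z D where w: "w = C @ s # X @ t # Y @ s # Z @ t # D" "cox n s t = 4"
      "\<forall>x\<in>set X. \<not> A.dep x s" "\<forall>x\<in>set Y. \<not> A.dep x s" "\<forall>x\<in>set Y. \<not> A.dep x t" "\<forall>x\<in>set Z. \<not> A.dep x t"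
      unfolding A.form3_def by blast
    then show False using A.irred_3[of "u @ C" s X t Y Z "D @ v"] ir by auto
  qed
qed

lemma p_bounds: "2 \<le> n - 1" "n - 1 \<le> n - 1" and upper_p: "upper (n - 1) = f"
  and p_gens: "p \<in> TLB_gens n" "f \<in> TLB_gens n" and e_gens: "e \<notin> TLB_gens n"
  using n3 by (auto simp: upper_def TLB_gens_def)

lemma dep_p: "x \<in> TLB_gens n \<Longrightarrow> A.dep x p \<longleftrightarrow> x = p \<or> lower (n - 1) x \<or> x = f"
  by (drule dep_Sigma[OF p_bounds]) (simp only: upper_p)

lemma cox_pf: "cox n p f = 4" "cox n f p = 4"
  by (auto simp: cox_def adj3_def adj4_def)

lemma lower_neq: "lower (n - 1) z \<Longrightarrow> z \<noteq> p \<and> z \<noteq> f"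
  using n3 by (auto simp: lower_def)

text \<open>In \<open>good\<close>, a gap without \<open>f\<close> leads from mark False to True, a
  gap with \<open>f\<close> and a lower letter from True to True, and a gap with \<open>f\<close>
  alone from True to False. So the marks fit if the first two kinds are followed by a gap with
  \<open>f\<close> and the third kind by a gap without. The former follows from the turn at the
  fork; if the latter failed, the word would contain p f p f up to commutations.\<close>

lemma gaps_consistent:
  assumes ir: "A.irred (p # x @ p # y @ p # V)" and w: "set x \<subseteq> TLB_gens n" "set y \<subseteq> TLB_gens n" "p \<notin> set x" "p \<notin> set y"
  shows "f \<notin> set x \<Longrightarrow> f \<in> set y"
    and "f \<in> set x \<Longrightarrow> \<forall>a\<in>set x. \<not> lower (n - 1) a \<Longrightarrow> f \<notin> set y"
    and "f \<in> set x \<Longrightarrow> \<exists>a\<in>set x. lower (n - 1) a \<Longrightarrow> f \<in> set y"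
proof -
  have y: "filter (\<lambda>z. A.dep z p) y \<noteq> []"
    using A.irred_1[of "p # x" p y V] ir by simp
  show "f \<in> set y" if "f \<notin> set x"
  proof -
    have "\<forall>c\<in>set y. \<not> lower (n - 1) c"
      using turn_right[OF p_bounds, of "[]" x y V] ir w that upper_p by simp
    then show ?thesis using y w dep_p by (auto simp: filter_empty_conv)
  qed
  show "f \<in> set y" if "f \<in> set x" "\<exists>a\<in>set x. lower (n - 1) a"
    using turn_left[OF p_bounds, of "[]" x y V] ir w that upper_p by auto
  show "f \<notin> set y" if fx: "f \<in> set x" and lx: "\<forall>a\<in>set x. \<not> lower (n - 1) a"
  proof
    assume "f \<in> set y"
    then obtain y1 y2 where y: "y = y1 @ f # y2" "f \<notin> set y1" by (meson split_list_first)
    obtain x1 x2 where x: "x = x1 @ f # x2" "f \<notin> set x2" using fx by (meson split_list_last)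
    \<comment> \<open>Two \<open>f\<close> without a \<open>p\<close> between them would form a
      square.\<close>
    have "f \<notin> set x1"
    proof
      assume "f \<in> set x1"
      then obtain x3 x4 where x1: "x1 = x3 @ f # x4" "f \<notin> set x4" by (meson split_list_last)
      then have "filter (\<lambda>z. A.dep z f) x4 = []" using w x dep_f by (auto simp: filter_empty_conv)
      then show False using A.irred_1[of "p # x3" f x4 "x2 @ p # y @ p # V"] ir x x1 by simp
    qed
    have "\<not> A.dep z p" if "z \<in> set x1 \<union> set x2" for z
      using that \<open>f \<notin> set x1\<close> x w lx dep_p[of z] by auto
    moreover have "\<not> A.dep z f" if "z \<in> set x2 \<union> set y1" for z
      using that x y w dep_f[of z] by auto
    ultimately show False
      using A.irred_3[of "[]" p x1 f x2 y1 "y2 @ p # V"] ir x y cox_pf by simp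
  qed
qed

text \<open>The marks are assigned from the right. A new \<open>p\<close> fixes its own mark and
  that of the next \<open>p\<close>; the latter is still free if no further \<open>p\<close>
  follows, and otherwise has the required value already by \<open>gaps_consistent\<close>.\<close>

lemma good_exists: "A.irred w \<Longrightarrow> set w \<subseteq> TLB_gens n \<Longrightarrow> \<exists>d. map fst d = w \<and> good d"
proof (induction w)
  case Nil
  then show ?case by (auto simp: good_def)
next
  case (Cons a w)
  have "A.irred w" using irred_infix[of "[a]" w "[]"] Cons.prems by simp
  then obtain d where d: "map fst d = w" "good d" using Cons by auto
  show ?case
  proof (cases "a = p")
    case False
    have "good ((a, True) # d)"
      unfolding good_def
    proof (intro allI impI)
      fix d1 r x s d2
      assume *: "(a, True) # d = d1 @ (p, r) # x @ (p, s) # d2" "p \<notin> fst ` set x"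
      then obtain d1' where "d1 = (a, True) # d1'" using False by (cases d1) auto
      then show "if f \<notin> fst ` set x then \<not> r \<and> s
      else if \<exists>a\<in>fst ` set x. lower (n - 1) a then r \<and> s else r \<and> \<not> s" using goodD[OF d(2), of d1' r x s d2] * by simp
    qed
    then show ?thesis using d by (intro exI[of _ "(a, True) # d"]) simp
  next
    case a: True
    show ?thesis
    proof (cases "p \<in> set w")
      case False
      \<comment> \<open>No later \<open>p\<close> closes a gap here, so the mark may be chosen
        freely.\<close>
      have "good ((a, True) # d)"
        unfolding good_def
      proof (intro allI impI)
        fix d1 r x s d2
        assume *: "(a, True) # d = d1 @ (p, r) # x @ (p, s) # d2" "p \<notin> fst ` set x"
        then have "(p, s) \<in> set d" by (cases d1) auto
        then have "p \<in> set w" using d(1) by force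
        then show "if f \<notin> fst ` set x then \<not> r \<and> s
          else if \<exists>a\<in>fst ` set x. lower (n - 1) a then r \<and> s else r \<and> \<not> s" using False by simp
      qed
      then show ?thesis using d by (intro exI[of _ "(a, True) # d"]) simp
    next
      case True
      then have "\<exists>z\<in>set d. fst z = p" using d(1) by force
      then obtain dx z dy where z: "d = dx @ z # dy" "fst z = p" "\<forall>z\<in>set dx. fst z \<noteq> p"
        using split_list_first_prop[of d "\<lambda>z. fst z = p"] by blast
      then obtain s0 where "z = (p, s0)" by (cases z) simp
      then have dd: "d = dx @ (p, s0) # dy" "p \<notin> fst ` set dx" using z(1,3) unfolding notin_fst_iff by simp_all
      \<comment> \<open>The values demanded by \<open>good\<close>: the first \<open>p\<close> sends
        \<open>e\<close> into the gap exactly if \<open>f\<close> occurs there, and the second keeps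
        it out unless the gap contains \<open>f\<close> but no lower letter.\<close>
      define r0 where "r0 \<longleftrightarrow> f \<in> fst ` set dx"
      define s1 where "s1 \<longleftrightarrow> f \<notin> fst ` set dx \<or> (\<exists>a\<in>fst ` set dx. lower (n - 1) a)"
      let ?d = "(p, r0) # dx @ (p, s1) # dy"
      have w: "w = map fst dx @ p # map fst dy" using d(1) dd by simp
      have s01: "s1 = s0" if "p \<in> fst ` set dy"
      proof -
        have "\<exists>z\<in>set dy. fst z = p" using that by force
        then obtain y z d2 where z: "dy = y @ z # d2" "fst z = p" "\<forall>z\<in>set y. fst z \<noteq> p"
          using split_list_first_prop[of dy "\<lambda>z. fst z = p"] by blast
        then obtain t0 where "z = (p, t0)" by (cases z) simp
        then have dy: "dy = y @ (p, t0) # d2" "p \<notin> fst ` set y" using z(1,3) unfolding notin_fst_iff by simp_all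
        have g: "if f \<notin> fst ` set y then \<not> s0 \<and> t0
          else if \<exists>a\<in>fst ` set y. lower (n - 1) a then s0 \<and> t0 else s0 \<and> \<not> t0"
          using goodD[OF d(2), of dx s0 y t0 d2] dd dy by simp
        have "A.irred (p # map fst dx @ p # map fst y @ p # map fst d2)"
          using Cons.prems(1) a w dy by simp
        note gc = gaps_consistent[OF this]
        have "set (map fst dx) \<subseteq> TLB_gens n" "set (map fst y) \<subseteq> TLB_gens n"
          using Cons.prems(2) w dy by auto
        note gc = gc[OF this]
        show ?thesis
        proof (cases "f \<in> fst ` set y")
          case True
          then show ?thesis using gc(2) dd dy g by (auto simp: s1_def split: if_splits)
        next
          case False
          then show ?thesis using gc(1,3) dd dy g by (auto simp: s1_def)
        qed
      qed
      have "good ?d"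
        unfolding good_def
      proof (intro allI impI)
        fix d1 r x s d2
        assume *: "?d = d1 @ (p, r) # x @ (p, s) # d2" "p \<notin> fst ` set x"
        show "if f \<notin> fst ` set x then \<not> r \<and> s
          else if \<exists>a\<in>fst ` set x. lower (n - 1) a then r \<and> s else r \<and> \<not> s"
        proof (cases d1)
          case Nil
          then have r: "r = r0" and eq: "dx @ (p, s1) # dy = x @ (p, s) # d2" using *(1) by auto
          have "dx = x \<and> (p, s1) = (p, s) \<and> dy = d2"
            by (rule first_split_unique[OF eq, where P = "\<lambda>z. fst z = p",
                  OF _ _ dd(2)[unfolded notin_fst_iff] *(2)[unfolded notin_fst_iff]]) simp_all
          then have "x = dx" "s = s1" by simp_all
          then show ?thesis unfolding r r0_def s1_def by simp
        next
          case (Cons z d1')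
          then have eq: "dx @ (p, s1) # dy = d1' @ (p, r) # x @ (p, s) # d2" using * by simp
          have "p \<in> fst ` set dy"
          proof -
            have "length (filter (\<lambda>z. fst z = p) (dx @ (p, s1) # dy)) \<ge> 2" unfolding eq by simp
            moreover have "filter (\<lambda>z. fst z = p) dx = []"
              using dd(2) unfolding notin_fst_iff filter_empty_conv .
            ultimately have "filter (\<lambda>z. fst z = p) dy \<noteq> []" by auto
            then obtain z where "z \<in> set dy" "fst z = p" unfolding filter_empty_conv by blast
            then show ?thesis using imageI[of z "set dy" fst] by simp
          qed
          then have "s1 = s0" by (rule s01)
          then show ?thesis using goodD[OF d(2), of d1' r x s d2] eq dd * by simp
        qed
      qed
      then show ?thesis using w a by (intro exI[of _ ?d]) simp
    qed
  qed
qed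

lemma e_neq: "p \<noteq> e" "e \<noteq> p" "e \<noteq> f'" "f' \<noteq> e" "p \<noteq> f'" "f' \<noteq> p" "p \<noteq> f" "f \<noteq> p" "e \<noteq> f" "f \<noteq> e" "f \<noteq> f'" "f' \<noteq> f"
  using n3 by auto

lemma f'_gens: "f' \<notin> TLB_gens n"
  by (auto simp: TLB_gens_def)

lemma lead_word_split:
  "lead_word d = u @ c # v \<Longrightarrow> \<exists>d1 x d2 l1 l2. d = d1 @ x # d2 \<and> lead_letter x = l1 @ c # l2 \<and> u = lead_word d1 @ l1 \<and> v = l2 @ lead_word d2"
proof (induction d arbitrary: u)
  case (Cons x d)
  then have "lead_letter x @ lead_word d = u @ c # v" by simp
  then consider us where "lead_letter x = u @ us" "us @ lead_word d = c # v" | us where "u = lead_letter x @ us" "lead_word d = us @ c # v"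
    by (auto simp: append_eq_append_conv2)
  then show ?case
  proof cases
    case 1
    show ?thesis
    proof (cases us)
      case Nil
      then have "lead_word d = [] @ c # v" using 1 by simp
      from Cons.IH[OF this] obtain d1 y d2 l1 l2 where
        *: "d = d1 @ y # d2" "lead_letter y = l1 @ c # l2" "[] = lead_word d1 @ l1" "v = l2 @ lead_word d2" by blast
      then have "x # d = (x # d1) @ y # d2" "u = lead_word (x # d1) @ l1" using 1 Nil by auto
      then show ?thesis using * by blast
    next
      case (Cons c' l2)
      then have "lead_letter x = u @ c # l2" "v = l2 @ lead_word d" using 1 by auto
      then show ?thesis by (intro exI[of _ "[]"] exI[of _ x] exI[of _ d] exI[of _ u] exI[of _ l2]) simp
    qed
  next
    case 2
    from Cons.IH[OF 2(2)] obtain d1 y d2 l1 l2 where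
      *: "d = d1 @ y # d2" "lead_letter y = l1 @ c # l2" "us = lead_word d1 @ l1" "v = l2 @ lead_word d2" by blast
    then have "x # d = (x # d1) @ y # d2" "u = lead_word (x # d1) @ l1" using 2 by auto
    then show ?thesis using * by blast
  qed
qed simp

lemma lead_letter_split_e: "lead_letter (a, r) = l1 @ e # l2 \<Longrightarrow> a \<in> TLB_gens n \<Longrightarrow>
    a = p \<and> l1 = (if r then [p] else []) \<and> l2 = (if r then [] else [p])"
  using e_gens e_neq by (auto simp: Cons_eq_append_conv split: if_splits)

lemma lead_letter_split_p: "lead_letter (a, r) = l1 @ p # l2 \<Longrightarrow>
    a = p \<and> l1 = (if r then [] else [e]) \<and> l2 = (if r then [e] else [])"
  using e_neq by (auto simp: Cons_eq_append_conv split: if_splits)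

lemma lead_letter_split_f: "lead_letter (a, r) = l1 @ f' # l2 \<Longrightarrow> a \<in> TLB_gens n \<Longrightarrow> a = f \<and> l1 = [] \<and> l2 = []"
  using e_neq f'_gens by (auto simp: Cons_eq_append_conv split: if_splits)

lemma lead_letter_split_other: "lead_letter (a, r) = l1 @ c # l2 \<Longrightarrow> c \<noteq> p \<Longrightarrow> c \<noteq> e \<Longrightarrow> c \<noteq> f' \<Longrightarrow> a = c \<and> c \<noteq> f \<and> l1 = [] \<and> l2 = []"
  by (auto simp: Cons_eq_append_conv split: if_splits)

lemma set_lead_word: "set (lead_word d) = (\<Union>x\<in>set d. set (lead_letter x))"
  by (simp add: lead_word_def)

lemma lead_word_mem:
  assumes "fst ` set d \<subseteq> TLB_gens n"
  shows "e \<in> set (lead_word d) \<longleftrightarrow> p \<in> fst ` set d" "p \<in> set (lead_word d) \<longleftrightarrow> p \<in> fst ` set d" "f' \<in> set (lead_word d) \<longleftrightarrow> f \<in> fst ` set d"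
    "c \<noteq> p \<Longrightarrow> c \<noteq> e \<Longrightarrow> c \<noteq> f' \<Longrightarrow> c \<in> set (lead_word d) \<longleftrightarrow> c \<in> fst ` set d \<and> c \<noteq> f"
proof -
  have 1: "e \<in> set (lead_letter x) \<longleftrightarrow> fst x = p" "p \<in> set (lead_letter x) \<longleftrightarrow> fst x = p" "f' \<in> set (lead_letter x) \<longleftrightarrow> fst x = f"
    if "x \<in> set d" for x
  proof -
    obtain a r where x: "x = (a, r)" by (cases x)
    have "a \<in> TLB_gens n" using that assms x imageI[of x "set d" fst] by auto
    then have "a \<noteq> e" "a \<noteq> f'" using e_gens f'_gens by auto
    then show "e \<in> set (lead_letter x) \<longleftrightarrow> fst x = p" "p \<in> set (lead_letter x) \<longleftrightarrow> fst x = p" "f' \<in> set (lead_letter x) \<longleftrightarrow> fst x = f"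
      using e_neq by (auto simp: x)
  qed
  have 2: "c \<in> set (lead_letter x) \<longleftrightarrow> fst x = c \<and> c \<noteq> f" if "c \<noteq> p" "c \<noteq> e" "c \<noteq> f'" for x
    using that by (cases x) auto
  show "e \<in> set (lead_word d) \<longleftrightarrow> p \<in> fst ` set d" "p \<in> set (lead_word d) \<longleftrightarrow> p \<in> fst ` set d" "f' \<in> set (lead_word d) \<longleftrightarrow> f \<in> fst ` set d"
    unfolding set_lead_word using 1 by (simp_all add: image_iff eq_commute)
  show "c \<noteq> p \<Longrightarrow> c \<noteq> e \<Longrightarrow> c \<noteq> f' \<Longrightarrow> c \<in> set (lead_word d) \<longleftrightarrow> c \<in> fst ` set d \<and> c \<noteq> f"
    unfolding set_lead_word using 2 by (simp add: image_iff eq_commute)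
qed

lemma dep_B:
  assumes "z \<in> TLB_gens (Suc n)"
  shows "B.dep z e \<longleftrightarrow> z = e \<or> z = p \<or> z = f'"
    and "B.dep z p \<longleftrightarrow> z = p \<or> z = e \<or> lower (n - 1) z"
    and "B.dep z f' \<longleftrightarrow> z = f' \<or> z = e"
    and "c \<in> TLB_gens n \<Longrightarrow> c \<noteq> p \<Longrightarrow> c \<noteq> f \<Longrightarrow> B.dep z c \<longleftrightarrow> z \<in> TLB_gens n \<and> A.dep z c"
  using assms n3
  by (cases z; auto simp: B.dep_def A.dep_def cox_def adj3_def adj4_def lower_def TLB_gens_def)+

lemma cox_Suc: "c \<in> TLB_gens n \<Longrightarrow> c \<noteq> p \<Longrightarrow> c \<noteq> f \<Longrightarrow> cox (Suc n) c z = 3 \<Longrightarrow> cox n c z = 3"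
  "cox (Suc n) e f' = 4" "cox (Suc n) e z = 3 \<Longrightarrow> z \<noteq> f'" "cox (Suc n) f' e = 4"
  "cox (Suc n) s t = 4 \<Longrightarrow> s = e \<and> t = f' \<or> s = f' \<and> t = e"
  by (auto simp: cox_def adj3_def adj4_def split: if_splits)

section \<open>Irreducibility of leading words\<close>

lemma gens_Suc: "p \<in> TLB_gens (Suc n)" "e \<in> TLB_gens (Suc n)" "f' \<in> TLB_gens (Suc n)"
  using n3 unfolding TLB_gens_def by (auto intro!: imageI)

lemma lead_letter_distinct: "distinct (lead_letter z)"
  using e_neq by (cases z) auto

text \<open>The two occurrences of \<open>c\<close> stem from different entries of \<open>d\<close>,
  because a single entry contributes pairwise distinct letters.\<close>

lemma lead_word_pair:
  assumes "lead_word d = U @ c # X @ c # V"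
  shows "\<exists>d1 z1 x z2 d2 l1 l2 l1' l2'. d = d1 @ z1 # x @ z2 # d2 \<and> lead_letter z1 = l1 @ c # l2 \<and> lead_letter z2 = l1' @ c # l2' \<and>
    U = lead_word d1 @ l1 \<and> X = l2 @ lead_word x @ l1' \<and> V = l2' @ lead_word d2"
proof -
  from lead_word_split[OF assms] obtain d1 z1 d' l1 l2 where
    1: "d = d1 @ z1 # d'" "lead_letter z1 = l1 @ c # l2" "U = lead_word d1 @ l1" "X @ c # V = l2 @ lead_word d'" by blast
  have c: "c \<notin> set l2" using lead_letter_distinct[of z1] 1(2) by simp
  from 1(4) consider us where "X = l2 @ us" "us @ c # V = lead_word d'" | us where "l2 = X @ us" "c # V = us @ lead_word d'"
    by (auto simp: append_eq_append_conv2)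
  then have "\<exists>X'. X = l2 @ X' \<and> lead_word d' = X' @ c # V"
  proof cases
    case 1
    then show ?thesis by metis
  next
    case 2
    then have "us = []" using c by (cases us) auto
    then show ?thesis using 2 by (intro exI[of _ "[]"]) simp
  qed
  then obtain X' where X: "X = l2 @ X'" "lead_word d' = X' @ c # V" by blast
  from lead_word_split[OF X(2)] obtain x z2 d2 l1' l2' where
    "d' = x @ z2 # d2" "lead_letter z2 = l1' @ c # l2'" "X' = lead_word x @ l1'" "V = l2' @ lead_word d2" by blast
  with 1 X show ?thesis
    by (intro exI[of _ d1] exI[of _ z1] exI[of _ x] exI[of _ z2] exI[of _ d2] exI[of _ l1] exI[of _ l2] exI[of _ l1'] exI[of _ l2']) simp
qed

context
  fixes d :: "(gen \<times> bool) list"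
  assumes gens: "fst ` set d \<subseteq> TLB_gens n" and good: "good d" and ir: "A.irred (map fst d)"
begin

lemma sub_gens: "d = d1 @ z1 # x @ z2 # d2 \<Longrightarrow> fst z1 \<in> TLB_gens n \<and> fst z2 \<in> TLB_gens n \<and> fst ` set x \<subseteq> TLB_gens n
    \<and> fst ` set d1 \<subseteq> TLB_gens n \<and> fst ` set d2 \<subseteq> TLB_gens n"
  using gens by auto

lemma pair_e:
  assumes "lead_word d = U @ e # X @ e # V" "e \<notin> set X"
  obtains d1 r x s d2 where "d = d1 @ (p, r) # x @ (p, s) # d2" "p \<notin> fst ` set x"
    "X = (if r then [] else [p]) @ lead_word x @ (if s then [p] else [])"
    "U = lead_word d1 @ (if r then [p] else [])" "V = (if s then [] else [p]) @ lead_word d2"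
proof -
  from lead_word_pair[OF assms(1)] obtain d1 z1 x z2 d2 l1 l2 l1' l2' where *: "d = d1 @ z1 # x @ z2 # d2"
    "lead_letter z1 = l1 @ e # l2" "lead_letter z2 = l1' @ e # l2'" "U = lead_word d1 @ l1" "X = l2 @ lead_word x @ l1'" "V = l2' @ lead_word d2" by blast
  obtain a r b s where z: "z1 = (a, r)" "z2 = (b, s)" by (cases z1, cases z2)
  note sg = sub_gens[OF *(1)]
  note b1 = lead_letter_split_e[OF *(2)[unfolded z]] and b2 = lead_letter_split_e[OF *(3)[unfolded z]]
  have "p \<notin> fst ` set x" using lead_word_mem(1)[of x] sg assms(2) *(5) by auto
  then show ?thesis using that[of d1 r x s d2] * b1 b2 sg by (simp add: z)
qed

lemma pair_p:
  assumes "lead_word d = U @ p # X @ p # V" "p \<notin> set X"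
  obtains d1 r x s d2 where "d = d1 @ (p, r) # x @ (p, s) # d2" "p \<notin> fst ` set x"
    "X = (if r then [e] else []) @ lead_word x @ (if s then [] else [e])"
proof -
  from lead_word_pair[OF assms(1)] obtain d1 z1 x z2 d2 l1 l2 l1' l2' where *: "d = d1 @ z1 # x @ z2 # d2"
    "lead_letter z1 = l1 @ p # l2" "lead_letter z2 = l1' @ p # l2'" "U = lead_word d1 @ l1" "X = l2 @ lead_word x @ l1'" "V = l2' @ lead_word d2" by blast
  obtain a r b s where z: "z1 = (a, r)" "z2 = (b, s)" by (cases z1, cases z2)
  note sg = sub_gens[OF *(1)]
  note b1 = lead_letter_split_p[OF *(2)[unfolded z]] and b2 = lead_letter_split_p[OF *(3)[unfolded z]]
  have "p \<notin> fst ` set x" using lead_word_mem(2)[of x] sg assms(2) *(5) by auto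
  then show ?thesis using that[of d1 r x s d2] * b1 b2 sg by (simp add: z)
qed

text \<open>Without \<open>p\<close> in \<open>x\<close> there is no \<open>e\<close> in its leading
  word, and \<open>f'\<close> is not adjacent to \<open>p\<close>. Only the lower neighbours
  remain.\<close>

lemma lead_word_filter_p:
  assumes "fst ` set x \<subseteq> TLB_gens n" "p \<notin> fst ` set x"
  shows "filter (\<lambda>z. B.dep z p) (lead_word x) = filter (lower (n - 1)) (map fst x)"
  using assms
proof (induction x)
  case (Cons z x)
  obtain a r where z: "z = (a, r)" by (cases z)
  have a: "a \<in> TLB_gens n" "a \<noteq> p" "a \<noteq> e" using Cons.prems e_gens z by auto
  have "filter (\<lambda>z. B.dep z p) (lead_letter z) = filter (lower (n - 1)) [a]"
  proof (cases "a = f")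
    case True
    have "f' \<in> TLB_gens (Suc n)" by (simp add: TLB_gens_def)
    then show ?thesis using True e_neq dep_B(2)[of f'] lower_neq by (auto simp: z lower_def)
  next
    case False
    have "a \<in> TLB_gens (Suc n)" using a False by (auto simp: TLB_gens_def)
    then show ?thesis using a False dep_B(2)[of a] by (simp add: z)
  qed
  then show ?case using Cons by (simp add: z)
qed simp

text \<open>Away from \<open>p\<close> and \<open>f\<close> both graphs have the same bonds, and the
  added letters \<open>e\<close> commute with \<open>c\<close>.\<close>

lemma lead_word_filter_other:
  assumes "fst ` set x \<subseteq> TLB_gens n" "c \<in> TLB_gens n" "c \<noteq> p" "c \<noteq> f"
  shows "filter (\<lambda>z. B.dep z c) (lead_word x) = filter (\<lambda>z. A.dep z c) (map fst x)"
  using assms(1)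
proof (induction x)
  case (Cons z x)
  obtain a r where z: "z = (a, r)" by (cases z)
  have a: "a \<in> TLB_gens n" using Cons.prems z by auto
  note g = gens_Suc
  have ff: "\<not> A.dep f c" using dep_f[OF assms(2)] assms A.dep_sym by auto
  have "filter (\<lambda>z. B.dep z c) (lead_letter z) = filter (\<lambda>z. A.dep z c) [a]"
  proof -
    consider "a = p" | "a = f" | "a \<noteq> p" "a \<noteq> f" by blast
    then show ?thesis
    proof cases
      case 1
      then show ?thesis using g dep_B(4)[OF _ assms(2-4)] p_gens e_gens e_neq by (simp add: z)
    next
      case 2
      then show ?thesis using g dep_B(4)[OF _ assms(2-4)] f'_gens ff e_neq by (simp add: z)
    next
      case 3
      have "a \<in> TLB_gens (Suc n)" using a 3 by (auto simp: TLB_gens_def)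
      then show ?thesis using 3 a dep_B(4)[OF _ assms(2-4)] by (simp add: z)
    qed
  qed
  then show ?case using Cons by (simp add: z)
qed simp

text \<open>Both conditions concern the gap between consecutive occurrences of \<open>c\<close>;
  together they exclude squares and the rule for \<open>m = 3\<close>. They come either from the
  original word or from the marks.\<close>

lemma lead_word_between:
  assumes eq: "lead_word d = U @ c # X @ c # V" and c: "c \<notin> set X"
  shows "filter (\<lambda>z. B.dep z c) X \<noteq> []" and "filter (\<lambda>z. B.dep z c) X = [t] \<Longrightarrow> cox (Suc n) c t \<noteq> 3"
proof -
  note g = gens_Suc
  have "filter (\<lambda>z. B.dep z c) X \<noteq> [] \<and> (filter (\<lambda>z. B.dep z c) X = [t] \<longrightarrow> cox (Suc n) c t \<noteq> 3)"
  proof -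
    consider "c = e" | "c = p" | "c = f'" | "c \<noteq> e" "c \<noteq> p" "c \<noteq> f'" by blast
    then show ?thesis
    proof cases
      \<comment> \<open>Between consecutive \<open>e\<close> the marks leave two letters
        \<open>p\<close>, or \<open>f'\<close> together with \<open>p\<close>, or only letters
        \<open>f'\<close> among those dependent on \<open>e\<close>; in the last case the bond is
        double.\<close>
      case 1
      obtain d1 r x s d2 where *: "d = d1 @ (p, r) # x @ (p, s) # d2" "p \<notin> fst ` set x"
        "X = (if r then [] else [p]) @ lead_word x @ (if s then [p] else [])"
        using pair_e[of U X V] eq c 1 by metis
      note sg = sub_gens[OF *(1)]
      note gd = goodD[OF good *(1,2)]
      have de: "B.dep p e" "B.dep f' e" using dep_B(1) g by auto
      show ?thesis
      proof (cases "f \<in> fst ` set x")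
        case False
        then show ?thesis using gd *(3) de 1 by simp
      next
        case True
        then have "f' \<in> set (lead_word x)" using lead_word_mem(3) sg by blast
        then have ne: "filter (\<lambda>z. B.dep z e) (lead_word x) \<noteq> []" using de by (auto simp: filter_empty_conv)
        show ?thesis
        proof (cases "\<exists>a\<in>fst ` set x. lower (n - 1) a")
          case l: True
          then show ?thesis using gd True *(3) de 1 ne by (simp add: append_eq_Cons_conv)
        next
          case l: False
          then have X: "X = lead_word x" using gd True *(3) by simp
          have "f' \<in> set (filter (\<lambda>z. B.dep z e) X)" using \<open>f' \<in> set (lead_word x)\<close> X de by simp
          then have "t = f'" if "filter (\<lambda>z. B.dep z e) X = [t]" using that by simp
          then show ?thesis using ne X 1 cox_Suc(2) by auto
        qed
      qed
    next
      \<comment> \<open>Between consecutive \<open>p\<close> without \<open>f\<close> no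
        \<open>e\<close> enters, and the lower letters are those of the original word. With
        \<open>f\<close>, an \<open>e\<close> joins a lower letter, or two \<open>e\<close>
        enter.\<close>
      case 2
      obtain d1 r x s d2 where *: "d = d1 @ (p, r) # x @ (p, s) # d2" "p \<notin> fst ` set x"
        "X = (if r then [e] else []) @ lead_word x @ (if s then [] else [e])"
        using pair_p[of U X V] eq c 2 by metis
      note sg = sub_gens[OF *(1)]
      note gd = goodD[OF good *(1,2)]
      note F = lead_word_filter_p[OF _ *(2)]
      have de: "B.dep e p" using dep_B(2) g by auto
      have w: "A.irred (map fst d1 @ p # map fst x @ p # map fst d2)" using ir *(1) by simp
      show ?thesis
      proof (cases "f \<in> fst ` set x")
        case False
        then have "filter (\<lambda>z. B.dep z p) X = filter (lower (n - 1)) (map fst x)" using gd F sg *(3) by simp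
        also have "\<dots> = filter (\<lambda>z. A.dep z p) (map fst x)"
        proof (rule filter_cong[OF refl])
          fix z assume "z \<in> set (map fst x)"
          then have "z \<in> fst ` set x" by simp
          then have "z \<in> TLB_gens n" "z \<noteq> f" "z \<noteq> p" using sg False *(2) by blast+
          then show "lower (n - 1) z \<longleftrightarrow> A.dep z p" using dep_p by blast
        qed
        finally have X: "filter (\<lambda>z. B.dep z p) X = filter (\<lambda>z. A.dep z p) (map fst x)"
          and X': "filter (\<lambda>z. B.dep z p) X = filter (lower (n - 1)) (map fst x)"
          using gd F sg *(3) False by simp_all
        have "cox n p t = 3" if "filter (\<lambda>z. B.dep z p) X = [t]"
        proof -
          have "t \<in> set (filter (lower (n - 1)) (map fst x))" unfolding X'[symmetric] that by simp
          then show ?thesis using cox_lower p_bounds by auto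
        qed
        then show ?thesis using A.irred_1[OF w] A.irred_2[OF w] X 2 by auto
      next
        case True
        show ?thesis
        proof (cases "\<exists>a\<in>fst ` set x. lower (n - 1) a")
          case l: True
          then have "filter (lower (n - 1)) (map fst x) \<noteq> []" by (auto simp: filter_empty_conv)
          then show ?thesis using gd True l *(3) de 2 F sg by simp
        next
          case l: False
          then show ?thesis using gd True *(3) de 2 by simp
        qed
      qed
    next
      \<comment> \<open>Between consecutive \<open>f\<close> the original word has a
        \<open>p\<close>, which brings an \<open>e\<close>; its bond to \<open>f'\<close> is
        double.\<close>
      case 3
      from lead_word_pair[OF eq] obtain d1 z1 x z2 d2 l1 l2 l1' l2' where *: "d = d1 @ z1 # x @ z2 # d2"
        "lead_letter z1 = l1 @ c # l2" "lead_letter z2 = l1' @ c # l2'" "X = l2 @ lead_word x @ l1'" by blast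
      obtain a r b s where z: "z1 = (a, r)" "z2 = (b, s)" by (cases z1, cases z2)
      note sg = sub_gens[OF *(1)]
      have ab: "a \<in> TLB_gens n" "b \<in> TLB_gens n" using sg z by simp_all
      note b = lead_letter_split_f[OF *(2)[unfolded z(1) 3] ab(1)] lead_letter_split_f[OF *(3)[unfolded z(2) 3] ab(2)]
      then have X: "X = lead_word x" using * by simp
      have w: "A.irred (map fst d1 @ f # map fst x @ f # map fst d2)" using ir *(1) b z by simp
      have "f \<notin> fst ` set x" using lead_word_mem(3)[of x] sg X c 3 by auto
      obtain y where y: "y \<in> set (map fst x)" "A.dep y f"
        using A.irred_1[OF w] unfolding filter_empty_conv by blast
      then have "y \<in> fst ` set x" by simp
      moreover from this have "y \<noteq> f" "y \<in> TLB_gens n" using \<open>f \<notin> fst ` set x\<close> sg by blast+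
      ultimately have "p \<in> fst ` set x" using dep_f[of y] y(2) by auto
      then have "e \<in> set X" using lead_word_mem(1)[of x] sg X by auto
      moreover have de: "B.dep e f'" using dep_B(3) g by auto
      ultimately have ne: "e \<in> set (filter (\<lambda>z. B.dep z c) X)" using 3 by simp
      have ne2: "filter (\<lambda>z. B.dep z c) X \<noteq> []" by (metis empty_iff empty_set ne)
      have "t = e" if "filter (\<lambda>z. B.dep z c) X = [t]" using ne unfolding that by simp
      then show ?thesis using ne2 3 cox_Suc(4) by auto
    next
      case 4
      from lead_word_pair[OF eq] obtain d1 z1 x z2 d2 l1 l2 l1' l2' where *: "d = d1 @ z1 # x @ z2 # d2"
        "lead_letter z1 = l1 @ c # l2" "lead_letter z2 = l1' @ c # l2'" "X = l2 @ lead_word x @ l1'" by blast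
      obtain a r b s where z: "z1 = (a, r)" "z2 = (b, s)" by (cases z1, cases z2)
      note sg = sub_gens[OF *(1)]
      note b = lead_letter_split_other[OF *(2)[unfolded z(1)] 4(2,1,3)] lead_letter_split_other[OF *(3)[unfolded z(2)] 4(2,1,3)]
      have cg: "c \<in> TLB_gens n" using sg z(1) b(1) by simp
      have "filter (\<lambda>z. B.dep z c) X = filter (\<lambda>z. A.dep z c) (map fst x)"
        using lead_word_filter_other[of x c] sg cg 4 b *(4) by simp
      moreover have w: "A.irred (map fst d1 @ c # map fst x @ c # map fst d2)" using ir *(1) b z by simp
      ultimately show ?thesis
        using A.irred_1[OF w] A.irred_2[OF w, of t] cox_Suc(1)[OF cg 4(2) conjunct1[OF conjunct2[OF b(1)]], of t] by simp blast
    qed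
  qed
  then show "filter (\<lambda>z. B.dep z c) X \<noteq> []" "filter (\<lambda>z. B.dep z c) X = [t] \<Longrightarrow> cox (Suc n) c t \<noteq> 3" by auto
qed

text \<open>The double bond of the target joins \<open>e\<close> and \<open>f'\<close>. An
  alternation of these with no \<open>p\<close> between the two \<open>e\<close> forces that gap to
  contain \<open>f\<close> and no lower letter. The marks then turn both \<open>p\<close> outwards,
  and the original word contains p f p f or f p f p up to commutations.\<close>

lemma irred_lead_word: "B.irred (lead_word d)"
proof -
  have n1: "\<not> B.form1 (lead_word d)"
  proof
    assume "B.form1 (lead_word d)"
    then obtain U c X V where w: "lead_word d = U @ c # X @ c # V" "\<forall>x\<in>set X. \<not> B.dep x c"
      unfolding B.form1_def by blast
    then have "c \<notin> set X" "filter (\<lambda>z. B.dep z c) X = []" by (auto simp: filter_empty_conv)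
    then show False using lead_word_between(1)[OF w(1)] by blast
  qed
  have n2: "\<not> B.form2 (lead_word d)"
  proof
    assume "B.form2 (lead_word d)"
    then obtain U c X t Y V where w: "lead_word d = U @ c # X @ t # Y @ c # V" "cox (Suc n) c t = 3"
      "\<forall>x\<in>set X. \<not> B.dep x c" "\<forall>x\<in>set Y. \<not> B.dep x c"
      unfolding B.form2_def by blast
    have "t \<noteq> c" using w(2) cox_eq_1[of "Suc n" c t] by auto
    then have "c \<notin> set (X @ t # Y)" using w(3,4) by auto
    moreover have "B.dep t c" using w(2) by (simp add: B.dep_def cox_sym)
    then have "filter (\<lambda>z. B.dep z c) (X @ t # Y) = [t]" using w(3,4) by (simp add: filter_empty_conv)
    ultimately show False using lead_word_between(2)[of U c "X @ t # Y" V t] w(1,2) by simp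
  qed
  have n3': "\<not> B.form3 (lead_word d)"
  proof
    assume "B.form3 (lead_word d)"
    then obtain U s0 X t0 Y Z V where w: "lead_word d = U @ s0 # X @ t0 # Y @ s0 # Z @ t0 # V" "cox (Suc n) s0 t0 = 4"
      and far: "\<forall>x\<in>set X. \<not> B.dep x s0" "\<forall>x\<in>set Y. \<not> B.dep x s0"
        "\<forall>x\<in>set Y. \<not> B.dep x t0" "\<forall>x\<in>set Z. \<not> B.dep x t0"
      unfolding B.form3_def by blast
    have de: "B.dep p e" "B.dep e f'" "B.dep f' e" using dep_B gens_Suc by auto
    from cox_Suc(5)[OF w(2)] show False
    proof (elim disjE conjE)
      assume st: "s0 = e" "t0 = f'"
      let ?X = "X @ f' # Y"
      have ne: "e \<notin> set ?X" "p \<notin> set ?X" using far(1,2) de st e_neq by auto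
      have eq: "lead_word d = U @ e # ?X @ e # (Z @ f' # V)" using w st by simp
      obtain d1 r x s d2 where *: "d = d1 @ (p, r) # x @ (p, s) # d2" "p \<notin> fst ` set x"
        "?X = (if r then [] else [p]) @ lead_word x @ (if s then [p] else [])"
        "Z @ f' # V = (if s then [] else [p]) @ lead_word d2"
        using pair_e[OF eq ne(1)] by metis
      have rs: "r" "\<not> s" and Xx: "lead_word x = ?X" using *(3) ne(2) by (auto split: if_splits)
      note sg = sub_gens[OF *(1)]
      have low: "\<not> lower (n - 1) a" if "a \<in> fst ` set x" for a
        using goodD[OF good *(1,2)] rs that by (auto split: if_splits)
      \<comment> \<open>The mark of the second \<open>p\<close> is False, so this \<open>p\<close>
        stands directly behind its \<open>e\<close> and begins \<open>Z\<close>.\<close>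
      obtain Z' where Z: "Z = p # Z'" "lead_word d2 = Z' @ f' # V" using *(4) rs e_neq by (cases Z) auto
      from lead_word_split[OF Z(2)] obtain y z3 d4 l1 l2 where y: "d2 = y @ z3 # d4" "lead_letter z3 = l1 @ f' # l2" "Z' = lead_word y @ l1" by blast
      obtain b3 r3 where z3: "z3 = (b3, r3)" by (cases z3)
      have b3: "b3 = f" "l1 = []" using lead_letter_split_f[of b3 r3 l1 l2] y z3 sg by auto
      from lead_word_split[OF Xx[unfolded append.assoc]] obtain x1 z4 x2 l3 l4 where
        x: "x = x1 @ z4 # x2" "lead_letter z4 = l3 @ f' # l4" "X = lead_word x1 @ l3" "Y = l4 @ lead_word x2" by blast
      obtain b4 r4 where z4: "z4 = (b4, r4)" by (cases z4)
      have b4: "b4 = f" "l3 = []" "l4 = []" using lead_letter_split_f[of b4 r4 l3 l4] x z4 sg by auto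
      have eqw: "map fst d = map fst d1 @ p # map fst x1 @ f # map fst x2 @ p # map fst y @ f # map fst d4"
        using *(1) x(1) y(1) z3 z4 b3 b4 by simp
      have g1: "fst ` set x1 \<subseteq> TLB_gens n" "fst ` set x2 \<subseteq> TLB_gens n" "fst ` set y \<subseteq> TLB_gens n"
        using sg x(1) y(1) by auto
      have fx: "f \<notin> fst ` set x1" "f \<notin> fst ` set x2" using lead_word_mem(3)[OF g1(1)] lead_word_mem(3)[OF g1(2)] x b4 far(1,2) de st by auto
      have px: "p \<notin> fst ` set x1" "p \<notin> fst ` set x2" using *(2) x(1) by auto
      have fy: "f \<notin> fst ` set y" "p \<notin> fst ` set y"
        using lead_word_mem(3)[OF g1(3)] lead_word_mem(1)[OF g1(3)] y b3 far(4) Z de st by auto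
      have "\<not> A.dep a p" if "a \<in> fst ` set x1 \<union> fst ` set x2" for a
      proof -
        have "a \<in> fst ` set x" unfolding x(1) using that by auto
        moreover have "a \<in> TLB_gens n" "a \<noteq> f" "a \<noteq> p" using that g1 fx px by blast+
        ultimately show ?thesis using dep_p low by blast
      qed
      moreover have "\<not> A.dep a f" if "a \<in> fst ` set x2 \<union> fst ` set y" for a
      proof -
        have "a \<in> TLB_gens n" "a \<noteq> f" "a \<noteq> p" using that g1 fx px fy by blast+
        then show ?thesis using dep_f by blast
      qed
      ultimately show False
        using A.irred_3[OF ir[unfolded eqw] cox_pf(1)] by simp
    next
      assume st: "s0 = f'" "t0 = e"
      let ?X = "Y @ f' # Z"
      have ne: "e \<notin> set ?X" "p \<notin> set ?X" using far(3,4) de st e_neq by auto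
      have eq: "lead_word d = (U @ f' # X) @ e # ?X @ e # V" using w st by simp
      obtain d1 r x s d2 where *: "d = d1 @ (p, r) # x @ (p, s) # d2" "p \<notin> fst ` set x"
        "?X = (if r then [] else [p]) @ lead_word x @ (if s then [p] else [])"
        "U @ f' # X = lead_word d1 @ (if r then [p] else [])"
        using pair_e[OF eq ne(1)] by metis
      have rs: "r" "\<not> s" and Xx: "lead_word x = ?X" using *(3) ne(2) by (auto split: if_splits)
      note sg = sub_gens[OF *(1)]
      have low: "\<not> lower (n - 1) a" if "a \<in> fst ` set x" for a
        using goodD[OF good *(1,2)] rs that by (auto split: if_splits)
      obtain X' where X: "X = X' @ [p]" "lead_word d1 = U @ f' # X'"
        using *(4) rs e_neq by (cases X rule: rev_cases) auto
      from lead_word_split[OF X(2)] obtain d4 z3 y l1 l2 where y: "d1 = d4 @ z3 # y" "lead_letter z3 = l1 @ f' # l2" "X' = l2 @ lead_word y" by blast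
      obtain b3 r3 where z3: "z3 = (b3, r3)" by (cases z3)
      have b3: "b3 = f" "l2 = []" using lead_letter_split_f[of b3 r3 l1 l2] y z3 sg by auto
      from lead_word_split[OF Xx[unfolded append.assoc]] obtain x1 z4 x2 l3 l4 where
        x: "x = x1 @ z4 # x2" "lead_letter z4 = l3 @ f' # l4" "Y = lead_word x1 @ l3" "Z = l4 @ lead_word x2" by blast
      obtain b4 r4 where z4: "z4 = (b4, r4)" by (cases z4)
      have b4: "b4 = f" "l3 = []" "l4 = []" using lead_letter_split_f[of b4 r4 l3 l4] x z4 sg by auto
      have eqw: "map fst d = map fst d4 @ f # map fst y @ p # map fst x1 @ f # map fst x2 @ p # map fst d2"
        using *(1) x(1) y(1) z3 z4 b3 b4 by simp
      have g1: "fst ` set x1 \<subseteq> TLB_gens n" "fst ` set x2 \<subseteq> TLB_gens n" "fst ` set y \<subseteq> TLB_gens n"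
        using sg x(1) y(1) by auto
      have fx: "f \<notin> fst ` set x1" "f \<notin> fst ` set x2" using lead_word_mem(3)[OF g1(1)] lead_word_mem(3)[OF g1(2)] x b4 far(3,4) de st by auto
      have px: "p \<notin> fst ` set x1" "p \<notin> fst ` set x2" using *(2) x(1) by auto
      have fy: "f \<notin> fst ` set y" "p \<notin> fst ` set y"
        using lead_word_mem(3)[OF g1(3)] lead_word_mem(1)[OF g1(3)] y b3 far(1) X de st by auto
      have "\<not> A.dep a p" if "a \<in> fst ` set x1 \<union> fst ` set x2" for a
      proof -
        have "a \<in> fst ` set x" unfolding x(1) using that by auto
        moreover have "a \<in> TLB_gens n" "a \<noteq> f" "a \<noteq> p" using that g1 fx px by blast+
        ultimately show ?thesis using dep_p low by blast
      qed
      moreover have "\<not> A.dep a f" if "a \<in> fst ` set x1 \<union> fst ` set y" for a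
      proof -
        have "a \<in> TLB_gens n" "a \<noteq> f" "a \<noteq> p" using that g1 fx px fy by blast+
        then show ?thesis using dep_f by blast
      qed
      ultimately show False
        using A.irred_3[OF ir[unfolded eqw] cox_pf(2)] by simp
    qed
  qed
  show ?thesis using n1 n2 n3' by (simp add: B.irred_iff)
qed

end
section \<open>Coefficients of leading words\<close>

text \<open>Recovers the original word from the leading word, one projection at a time. The bond
  between \<open>p\<close> and \<open>f\<close> has no counterpart between \<open>p\<close> and
  \<open>f'\<close>, but every \<open>p\<close> carries exactly one \<open>e\<close>, and
  \<open>e\<close> depends on \<open>f'\<close>.\<close>

lemma proj_lead_word:
  assumes "fst ` set d \<subseteq> TLB_gens n"
  shows "a \<in> TLB_gens n \<Longrightarrow> b \<in> TLB_gens n \<Longrightarrow> a \<noteq> f \<Longrightarrow> b \<noteq> f \<Longrightarrow> A.proj a b (map fst d) = B.proj a b (lead_word d)"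
    and "A.proj p f (map fst d) = map (\<lambda>x. if x = e then p else f) (B.proj e f' (lead_word d))"
    and "A.proj f f (map fst d) = map (\<lambda>x. f) (B.proj f' f' (lead_word d))"
proof -
  have neq: "x \<noteq> e" "x \<noteq> f'" if "x \<in> TLB_gens n" for x using that e_gens f'_gens by auto
  show "A.proj a b (map fst d) = B.proj a b (lead_word d)"
    if ab: "a \<in> TLB_gens n" "b \<in> TLB_gens n" "a \<noteq> f" "b \<noteq> f"
    using assms
  proof (induction d)
    case (Cons z d)
    have "filter (\<lambda>x. x = a \<or> x = b) (lead_letter z) = filter (\<lambda>x. x = a \<or> x = b) [fst z]"
      using neq[OF ab(1)] neq[OF ab(2)] ab by (cases z) auto
    then show ?case using Cons by (auto simp: A.proj_def B.proj_def)
  qed (simp add: A.proj_def B.proj_def)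
  show "A.proj p f (map fst d) = map (\<lambda>x. if x = e then p else f) (B.proj e f' (lead_word d))"
    using assms
  proof (induction d)
    case (Cons z d)
    then have "fst z \<in> TLB_gens n" by simp
    then have "map (\<lambda>x. if x = e then p else f) (filter (\<lambda>x. x = e \<or> x = f') (lead_letter z)) = filter (\<lambda>x. x = p \<or> x = f) [fst z]"
      using neq[of "fst z"] e_neq by (cases z) simp
    then show ?case using Cons by (simp add: A.proj_def B.proj_def split: if_splits)
  qed (simp add: A.proj_def B.proj_def)
  show "A.proj f f (map fst d) = map (\<lambda>x. f) (B.proj f' f' (lead_word d))"
    using assms
  proof (induction d)
    case (Cons z d)
    then have "fst z \<in> TLB_gens n" by simp
    then have "map (\<lambda>x. f) (filter (\<lambda>x. x = f' \<or> x = f') (lead_letter z)) = filter (\<lambda>x. x = f \<or> x = f) [fst z]"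
      using neq[of "fst z"] e_neq by (cases z) simp
    then show ?case using Cons by (simp add: A.proj_def B.proj_def split: if_splits)
  qed (simp add: A.proj_def B.proj_def)
qed

lemma lead_word_comm_eq:
  assumes d: "fst ` set d \<subseteq> TLB_gens n" and d': "fst ` set d' \<subseteq> TLB_gens n" and t: "B.comm_eq (lead_word d) (lead_word d')"
  shows "A.comm_eq (map fst d) (map fst d')"
proof (rule A.proj_comm_eq)
  have B: "B.proj a b (lead_word d) = B.proj a b (lead_word d')" if "B.dep a b" for a b
    using B.comm_eq_proj[OF t that] .
  have in_gens: "A.proj a b (map fst d) = A.proj a b (map fst d')"
    if ab: "a \<in> TLB_gens n" "b \<in> TLB_gens n" "A.dep a b" for a b
  proof -
    have pf: "A.proj p f (map fst d) = A.proj p f (map fst d')"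
      using proj_lead_word(2)[OF d] proj_lead_word(2)[OF d'] B[of e f'] by (simp add: B.dep_def cox_Suc(2))
    have fp: "A.proj f p w = A.proj p f w" for w by (simp add: A.proj_def disj_commute)
    have ff: "A.proj f f (map fst d) = A.proj f f (map fst d')"
      using proj_lead_word(3)[OF d] proj_lead_word(3)[OF d'] B[of f' f'] by simp
    show ?thesis
    proof (cases "a = f \<or> b = f")
      case True
      then show ?thesis using pf fp ff dep_f[of a] dep_f[of b] ab A.dep_sym by metis
    next
      case False
      have "B.dep a b"
        using ab False n3 by (cases a; cases b) (auto simp: A.dep_def B.dep_def cox_def adj3_def adj4_def TLB_gens_def split: if_splits)
      then show ?thesis using B proj_lead_word(1)[OF d ab(1,2)] proj_lead_word(1)[OF d' ab(1,2)] False by simp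
    qed
  qed
  fix a b assume ab: "A.dep a b"
  \<comment> \<open>A letter outside the graph does not occur in the words, so a pair containing it
    reduces to the other letter.\<close>
  have skip: "A.proj a b w = A.proj b b w" if "a \<notin> TLB_gens n" "set w \<subseteq> TLB_gens n" for a b w
    unfolding A.proj_def by (rule filter_cong[OF refl]) (use that in auto)
  have comm: "A.proj a b w = A.proj b a w" for a b w by (simp add: A.proj_def disj_commute)
  have w: "set (map fst d) \<subseteq> TLB_gens n" "set (map fst d') \<subseteq> TLB_gens n" using d d' by auto
  have one: "A.proj b b (map fst d) = A.proj b b (map fst d')" for b
  proof (cases "b \<in> TLB_gens n")
    case True
    then show ?thesis by (rule in_gens[OF _ True A.dep_refl])
  next
    case False
    have "A.proj b b v = []" if "set v \<subseteq> TLB_gens n" for v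
      using False that by (auto simp: A.proj_def filter_empty_conv)
    then show ?thesis using w by simp
  qed
  show "A.proj a b (map fst d) = A.proj a b (map fst d')"
    using in_gens[of a b] ab skip[of a _ b] skip[of b _ a] comm[of a b] w one by metis
qed

text \<open>Fixes the marks that \<open>lead_letter\<close> ignores, so that each choice of terms
  corresponds to exactly one decoration.\<close>

definition marked :: "(gen \<times> bool) list \<Rightarrow> bool" where
  "marked d \<longleftrightarrow> (\<forall>z\<in>set d. fst z \<noteq> p \<longrightarrow> snd z)"

text \<open>Commutations never exchange \<open>e\<close> and \<open>p\<close>, so the projection to
  these two letters, read in pairs, reveals the marks.\<close>

lemma lead_word_comm_eq_marks:
  assumes "fst ` set d \<subseteq> TLB_gens n" "map fst d = map fst d'" "marked d" "marked d'" "B.comm_eq (lead_word d) (lead_word d')"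
  shows "d = d'"
proof -
  have "B.dep e p" using dep_B(2) gens_Suc by auto
  then have "B.proj e p (lead_word d) = B.proj e p (lead_word d')" using B.comm_eq_proj assms(5) by blast
  then show ?thesis using assms(1-4)
  proof (induction d arbitrary: d')
    case (Cons z d)
    then obtain z' d'' where d': "d' = z' # d''" "fst z' = fst z" by (cases d') auto
    obtain a r r' where z: "z = (a, r)" "z' = (a, r')" using d'(2) by (cases z, cases z') auto
    have a: "a \<in> TLB_gens n" "a \<noteq> e" using Cons.prems(2) z e_gens by auto
    have "r = r' \<and> B.proj e p (lead_word d) = B.proj e p (lead_word d'')"
    proof (cases "a = p")
      case True
      then show ?thesis using Cons.prems(1) d' z e_neq by (auto simp: B.proj_def split: if_splits)
    next
      case False
      then have "r" "r'" using Cons.prems(4,5) z d' by (auto simp: marked_def)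
      then show ?thesis using Cons.prems(1) d' z e_neq a False by (auto simp: B.proj_def split: if_splits)
    qed
    then show ?case using Cons.IH[of d''] Cons.prems d' z by (auto simp: marked_def)
  qed simp
qed

section \<open>The expansion of the image of a word and its terms of highest degree\<close>

definition shift_tee :: "gen \<Rightarrow> gen" where
  "shift_tee a = (if a = f then f' else a)"

text \<open>\<open>expansion u w h\<close> evaluates \<open>h\<close> on the image of the monomial \<open>w\<close> under
  \<open>\<sigma>\<^sub>n\<^sub>-\<^sub>1 \<mapsto> p - p e - u e p + e\<close>; \<open>leading\<close> keeps the terms of highest degree.\<close>

fun expansion :: "'k \<Rightarrow> gen list \<Rightarrow> (gen list \<Rightarrow> 'k) \<Rightarrow> 'k" where
  "expansion u [] h = h []"
| "expansion u (a # w) h = (if a = p then expansion u w (\<lambda>v. h (p # v)) - expansion u w (\<lambda>v. h (p # e # v))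
      - u * expansion u w (\<lambda>v. h (e # p # v)) + expansion u w (\<lambda>v. h (e # v))
    else expansion u w (\<lambda>v. h (shift_tee a # v)))"

fun leading :: "'k \<Rightarrow> gen list \<Rightarrow> (gen list \<Rightarrow> 'k) \<Rightarrow> 'k" where
  "leading u [] h = h []"
| "leading u (a # w) h = (if a = p then - leading u w (\<lambda>v. h (p # e # v)) - u * leading u w (\<lambda>v. h (e # p # v))
    else leading u w (\<lambda>v. h (shift_tee a # v)))"

text \<open>A bound on the letters of every word \<open>v\<close> in the expansion of
  \<open>w\<close>: each \<open>p\<close> yields at most one \<open>p\<close> and at most one
  \<open>e\<close>.\<close>

definition bounded_by :: "gen list \<Rightarrow> gen list \<Rightarrow> bool" where
  "bounded_by w v \<longleftrightarrow> (\<forall>x\<in>TLB_gens n. count (mset v) (shift_tee x) \<le> count (mset w) x) \<and> count (mset v) e \<le> count (mset w) p"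

lemma bounded_by_Cons:
  assumes "a \<in> TLB_gens n" "bounded_by w v"
  shows "a \<noteq> p \<Longrightarrow> bounded_by (a # w) (shift_tee a # v)"
    and "bounded_by (p # w) (p # v)" "bounded_by (p # w) (p # e # v)" "bounded_by (p # w) (e # p # v)" "bounded_by (p # w) (e # v)"
proof -
  have neq: "x \<noteq> e" "x \<noteq> f'" "shift_tee x \<noteq> e" if "x \<in> TLB_gens n" for x
    using that e_gens f'_gens e_neq by (auto simp: shift_tee_def)
  have shift_tee: "shift_tee x = shift_tee y \<longleftrightarrow> x = y" if "x \<in> TLB_gens n" "y \<in> TLB_gens n" for x y
    using that f'_gens by (auto simp: shift_tee_def)
  have rp: "shift_tee p = p" using e_neq by (simp add: shift_tee_def)
  have p: "shift_tee x = p \<longleftrightarrow> x = p" if "x \<in> TLB_gens n" for x using shift_tee[OF that p_gens(1)] rp by simp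
  have b: "count (mset v) (shift_tee x) \<le> count (mset w) x" if "x \<in> TLB_gens n" for x
    using assms(2) that by (simp add: bounded_by_def)
  have be: "count (mset v) e \<le> count (mset w) p" using assms(2) by (simp add: bounded_by_def)
  show "bounded_by (a # w) (shift_tee a # v)" if "a \<noteq> p"
    unfolding bounded_by_def
  proof (intro conjI ballI)
    fix x assume x: "x \<in> TLB_gens n"
    show "count (mset (shift_tee a # v)) (shift_tee x) \<le> count (mset (a # w)) x"
      using b[OF x] shift_tee[OF assms(1) x] by auto
  next
    show "count (mset (shift_tee a # v)) e \<le> count (mset (a # w)) p"
      using be neq(3)[OF assms(1)] that by simp
  qed
  have bp: "count (mset (l @ v)) (shift_tee x) \<le> count (mset (p # w)) x"
    if "x \<in> TLB_gens n" "count (mset l) p \<le> 1" "set l \<subseteq> {p, e}" for x l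
  proof (cases "x = p")
    case True
    then show ?thesis using b[OF that(1)] rp that(2) by simp
  next
    case False
    then have "shift_tee x \<notin> set l" using p[OF that(1)] neq(3)[OF that(1)] that(3) by auto
    then have "count (mset l) (shift_tee x) = 0" by simp
    then have "count (mset (l @ v)) (shift_tee x) = count (mset v) (shift_tee x)"
      by (simp only: mset_append plus_multiset.rep_eq add_0)
    moreover have "count (mset (p # w)) x = count (mset w) x" using False by simp
    ultimately show ?thesis using b[OF that(1)] by presburger
  qed
  have "bounded_by (p # w) (l @ v)" if "count (mset l) p \<le> 1" "count (mset l) e \<le> 1" "set l \<subseteq> {p, e}" for l
    unfolding bounded_by_def using bp that be by auto
  from this[of "[p]"] this[of "[p,e]"] this[of "[e,p]"] this[of "[e]"]
  show "bounded_by (p # w) (p # v)" "bounded_by (p # w) (p # e # v)" "bounded_by (p # w) (e # p # v)" "bounded_by (p # w) (e # v)"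
    using e_neq by simp_all
qed

lemma expansion_zero:
  "set w \<subseteq> TLB_gens n \<Longrightarrow> (\<And>v. bounded_by w v \<Longrightarrow> h v = 0) \<Longrightarrow> expansion u w h = 0"
proof (induction w arbitrary: h)
  case Nil
  then show ?case by (simp add: bounded_by_def)
next
  case (Cons a w)
  then have a: "a \<in> TLB_gens n" and w: "set w \<subseteq> TLB_gens n" by auto
  note bc = bounded_by_Cons[OF a]
  show ?case
  proof (cases "a = p")
    case True
    have z: "expansion u w (\<lambda>v. h (l @ v)) = 0" if "\<And>v. bounded_by w v \<Longrightarrow> bounded_by (p # w) (l @ v)" for l
      by (rule Cons.IH[OF w], rule Cons.prems(2), unfold True, rule that)
    show ?thesis
      using z[of "[p]"] z[of "[p,e]"] z[of "[e,p]"] z[of "[e]"] True bc(2-5) by simp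
  next
    case False
    have "expansion u w (\<lambda>v. h (shift_tee a # v)) = 0"
      by (rule Cons.IH[OF w], rule Cons.prems(2)) (rule bc(1)[OF _ False])
    then show ?thesis using False by simp
  qed
qed

text \<open>A term of \<open>p\<close> consisting of a single letter lacks a \<open>p\<close> or an
  \<open>e\<close>, and by the bound the rest of the word cannot make up for the loss.\<close>

lemma expansion_leading:
  "set w \<subseteq> TLB_gens n \<Longrightarrow>
    (\<And>v. bounded_by w v \<Longrightarrow> count (mset v) p < count (mset w) p \<or> count (mset v) e < count (mset w) p \<Longrightarrow> h v = 0)
    \<Longrightarrow> expansion u w h = leading u w h"
proof (induction w arbitrary: h)
  case (Cons a w)
  then have a: "a \<in> TLB_gens n" and w: "set w \<subseteq> TLB_gens n" by auto
  note bc = bounded_by_Cons[OF a]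
  have rp: "shift_tee p = p" using e_neq by (simp add: shift_tee_def)
  show ?case
  proof (cases "a = p")
    case True
    have "expansion u w (\<lambda>v. h (p # v)) = 0"
    proof (rule expansion_zero[OF w])
      fix v assume "bounded_by w v"
      then show "h (p # v) = 0" using Cons.prems(2)[of "p # v"] bc(2)[of w v] True e_neq
        by (simp add: bounded_by_def)
    qed
    moreover have "expansion u w (\<lambda>v. h (e # v)) = 0"
    proof (rule expansion_zero[OF w])
      fix v assume b: "bounded_by w v"
      then have "count (mset v) p \<le> count (mset w) p" using p_gens(1) rp by (auto simp: bounded_by_def)
      then show "h (e # v) = 0" using Cons.prems(2)[of "e # v"] bc(5)[OF b] True e_neq
        by simp
    qed
    moreover have "expansion u w (\<lambda>v. h (p # e # v)) = leading u w (\<lambda>v. h (p # e # v))"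
    proof (rule Cons.IH[OF w], rule Cons.prems(2))
      fix v assume v: "bounded_by w v" "count (mset v) p < count (mset w) p \<or> count (mset v) e < count (mset w) p"
      show "bounded_by (a # w) (p # e # v)" using bc(3)[OF v(1)] True by simp
      show "count (mset (p # e # v)) p < count (mset (a # w)) p \<or> count (mset (p # e # v)) e < count (mset (a # w)) p"
        using v(2) True e_neq by simp
    qed
    moreover have "expansion u w (\<lambda>v. h (e # p # v)) = leading u w (\<lambda>v. h (e # p # v))"
    proof (rule Cons.IH[OF w], rule Cons.prems(2))
      fix v assume v: "bounded_by w v" "count (mset v) p < count (mset w) p \<or> count (mset v) e < count (mset w) p"
      show "bounded_by (a # w) (e # p # v)" using bc(4)[OF v(1)] True by simp
      show "count (mset (e # p # v)) p < count (mset (a # w)) p \<or> count (mset (e # p # v)) e < count (mset (a # w)) p"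
        using v(2) True e_neq by simp
    qed
    ultimately show ?thesis using True by simp
  next
    case False
    have ne: "shift_tee a \<noteq> p" "shift_tee a \<noteq> e" using False a e_gens e_neq by (auto simp: shift_tee_def)
    have "expansion u w (\<lambda>v. h (shift_tee a # v)) = leading u w (\<lambda>v. h (shift_tee a # v))"
    proof (rule Cons.IH[OF w], rule Cons.prems(2))
      fix v assume v: "bounded_by w v" "count (mset v) p < count (mset w) p \<or> count (mset v) e < count (mset w) p"
      show "bounded_by (a # w) (shift_tee a # v)" using bc(1)[OF v(1) False] .
      show "count (mset (shift_tee a # v)) p < count (mset (a # w)) p \<or> count (mset (shift_tee a # v)) e < count (mset (a # w)) p"
        using v(2) False ne by simp
    qed
    then show ?thesis using False by simp
  qed
qed simp

lemma leading_zero: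
  "(\<And>d. map fst d = w \<Longrightarrow> marked d \<Longrightarrow> h (lead_word d) = 0) \<Longrightarrow> leading u w h = 0"
proof (induction w arbitrary: h)
  case (Cons a w)
  have step: "h (lead_letter (a, r) @ lead_word d) = 0" if "map fst d = w" "marked d" "a \<noteq> p \<longrightarrow> r" for d r
    using Cons.prems[of "(a, r) # d"] that by (simp add: marked_def)
  show ?case
  proof (cases "a = p")
    case True
    have "leading u w (\<lambda>v. h (p # e # v)) = 0" "leading u w (\<lambda>v. h (e # p # v)) = 0"
      using step[of _ True] step[of _ False] True by (auto intro!: Cons.IH)
    then show ?thesis using True by simp
  next
    case False
    have "leading u w (\<lambda>v. h (shift_tee a # v)) = 0"
      using step[of _ True] False by (auto intro!: Cons.IH simp: shift_tee_def)
    then show ?thesis using False by simp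
  qed
qed (simp add: marked_def)

text \<open>The surviving coefficient is a product of factors \<open>- 1\<close> and
  \<open>- u\<close>, hence a unit; \<open>c'\<close> is its inverse.\<close>

lemma leading_single:
  assumes "u * u' = 1"
  shows "map fst d = w \<Longrightarrow> marked d \<Longrightarrow> (\<And>d'. map fst d' = w \<Longrightarrow> marked d' \<Longrightarrow> d' \<noteq> d \<Longrightarrow> h (lead_word d') = 0)
    \<Longrightarrow> \<exists>c c'. c * c' = 1 \<and> leading u w h = c * h (lead_word d)"
proof (induction w arbitrary: h d)
  case Nil
  then show ?case by (intro exI[of _ 1]) simp
next
  case (Cons a w)
  then obtain r d0 where d: "d = (a, r) # d0" "map fst d0 = w" by (cases d) auto
  have m: "marked d0" "a \<noteq> p \<longrightarrow> r" using Cons.prems(2) d by (auto simp: marked_def)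
  have other: "h (lead_letter (a, r') @ lead_word d') = 0" if "map fst d' = w" "marked d'" "a \<noteq> p \<longrightarrow> r'" "(r', d') \<noteq> (r, d0)" for r' d'
    using Cons.prems(3)[of "(a, r') # d'"] that d by (auto simp: marked_def)
  have IH: "\<exists>c c'. c * c' = 1 \<and> leading u w (\<lambda>v. h (lead_letter (a, r) @ v)) = c * h (lead_word d)"
    using Cons.IH[OF d(2) m(1), of "\<lambda>v. h (lead_letter (a, r) @ v)"] other[of _ r] m(2) d(1) by simp
  then obtain c c' where c: "c * c' = 1" "leading u w (\<lambda>v. h (lead_letter (a, r) @ v)) = c * h (lead_word d)" by blast
  show ?case
  proof (cases "a = p")
    case True
    have z: "leading u w (\<lambda>v. h (lead_letter (a, \<not> r) @ v)) = 0"
      by (rule leading_zero, rule other) (use True in auto)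
    show ?thesis
    proof (cases r)
      case rt: True
      have "leading u (a # w) h = (- c) * h (lead_word d)" using c(2) z True rt by simp
      moreover have "(- c) * (- c') = 1" using c(1) by simp
      ultimately show ?thesis by blast
    next
      case rf: False
      have "leading u (a # w) h = (- u * c) * h (lead_word d)" using c(2) z True rf by simp
      moreover have "(- u * c) * (- u' * c') = (u * u') * (c * c')" by (simp add: algebra_simps)
      ultimately show ?thesis using c(1) assms by (metis mult_1)
    qed
  next
    case False
    then have "leading u (a # w) h = c * h (lead_word d)" using c(2) by (simp add: shift_tee_def split: if_splits)
    then show ?thesis using c(1) by blast
  qed
qed

text \<open>A term with nonzero coefficient contains all letters of the leading word, so every
  letter occurs in \<open>w\<close> at least as often as in \<open>w0\<close>. As \<open>w\<close>
  is not longer, both have the same letters. Then only terms of highest degree count; these are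
  leading words of \<open>w\<close>, as long as the tested one, and so must be equivalent to
  it.\<close>

lemma expansion_coeff:
  assumes d: "map fst d = w0" "marked d" and w0: "set w0 \<subseteq> TLB_gens n" and w: "set w \<subseteq> TLB_gens n" "length w \<le> length w0"
  shows "\<not> A.comm_eq w w0 \<Longrightarrow> expansion u w (B.coeff_of (lead_word d)) = 0"
    and "u * u' = 1 \<Longrightarrow> B.irred (lead_word d) \<Longrightarrow> w = w0 \<Longrightarrow> \<exists>c c'. c * c' = 1 \<and> expansion u w (B.coeff_of (lead_word d)) = c"
proof -
  let ?g = "B.coeff_of (lead_word d)"
  have neq: "x \<noteq> e" "x \<noteq> f'" "shift_tee x \<noteq> e" if "x \<in> TLB_gens n" for x
    using that e_gens f'_gens e_neq by (auto simp: shift_tee_def)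
  have gens_d: "fst ` set d \<subseteq> TLB_gens n" using w0 unfolding d(1)[symmetric] set_map .
  have cnt: "count (mset (lead_word d')) (shift_tee x) = count (mset (map fst d')) x"
    if "x \<in> TLB_gens n" "fst ` set d' \<subseteq> TLB_gens n" for x d'
    using that(2)
  proof (induction d')
    case (Cons z d')
    then have "fst z \<in> TLB_gens n" by simp
    then have "count (mset (lead_letter z)) (shift_tee x) = (if fst z = x then 1 else 0)"
      using neq[of x] neq[of "fst z"] that(1) e_neq by (cases z) (auto simp: shift_tee_def)
    then show ?case using Cons by simp
  qed simp
  have cnte: "count (mset (lead_word d')) e = count (mset (map fst d')) p"
    if "fst ` set d' \<subseteq> TLB_gens n" for d'
    using that
  proof (induction d')
    case (Cons z d')
    then have "fst z \<in> TLB_gens n" by simp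
    then have "count (mset (lead_letter z)) e = (if fst z = p then 1 else 0)"
      using neq[of "fst z"] e_neq by (cases z) auto
    then show ?case using Cons by simp
  qed simp
  have key: "mset w = mset w0 \<and> count (mset v) p \<ge> count (mset w) p \<and> count (mset v) e \<ge> count (mset w) p"
    if "bounded_by w v" "?g v \<noteq> 0" for v
  proof -
    have sub: "mset (lead_word d) \<subseteq># mset v" using B.coeff_of_nonzero(1)[OF that(2)] .
    have "count (mset w0) x \<le> count (mset w) x" for x
    proof (cases "x \<in> TLB_gens n")
      case True
      then have "count (mset (lead_word d)) (shift_tee x) \<le> count (mset w) x"
        using mset_subset_eq_count[OF sub, of "shift_tee x"] that(1) by (force simp: bounded_by_def)
      then show ?thesis using cnt[OF True gens_d] d(1) by simp
    next
      case False
      then have "x \<notin> set w0" using w0 by auto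
      then have "count (mset w0) x = 0" by simp
      then show ?thesis by linarith
    qed
    then have "mset w0 \<subseteq># mset w" by (simp add: subseteq_mset_def)
    then have "mset w = mset w0"
      using w(2) by (metis mset_subset_size size_mset subset_mset.le_neq_trans leD)
    moreover have "shift_tee p = p" using e_neq by (simp add: shift_tee_def)
    then have "count (mset v) p \<ge> count (mset w0) p" "count (mset v) e \<ge> count (mset w0) p"
      using mset_subset_eq_count[OF sub, of p] mset_subset_eq_count[OF sub, of e] cnt[OF p_gens(1) gens_d] cnte[OF gens_d] d(1)
      by simp_all
    ultimately show ?thesis by simp
  qed
  have lead: "expansion u w ?g = leading u w ?g"
    by (rule expansion_leading[OF w(1)]) (use key in force)
  have full: "B.comm_eq (lead_word d') (lead_word d)" if d': "map fst d' = w" "?g (lead_word d') \<noteq> 0" for d'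
  proof (rule B.coeff_of_nonzero(2)[OF d'(2)])
    have gens: "fst ` set d' \<subseteq> TLB_gens n" using w(1) unfolding d'(1)[symmetric] set_map .
    have b: "bounded_by w (lead_word d')" using cnt[OF _ gens] cnte[OF gens] d'(1) by (simp add: bounded_by_def)
    have m: "mset w = mset w0" using key[OF b d'(2)] by simp
    have len: "length (lead_word d') = length (map fst d') + count (mset (map fst d')) p" for d'
      by (induction d') auto
    have "length w = length w0" using m by (metis size_mset)
    then show "length (lead_word d') = length (lead_word d)"
      unfolding len d(1) d'(1) m by simp
  qed
  show "expansion u w ?g = 0" if "\<not> A.comm_eq w w0"
  proof -
    have "leading u w ?g = 0"
    proof (rule leading_zero, rule ccontr)
      fix d' assume d': "map fst d' = w" "?g (lead_word d') \<noteq> 0"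
      have "fst ` set d' \<subseteq> TLB_gens n" using w(1) unfolding d'(1)[symmetric] set_map .
      then show False using lead_word_comm_eq[OF _ gens_d full[OF d']] d'(1) d(1) that by simp
    qed
    then show ?thesis using lead by simp
  qed
  show "\<exists>c c'. c * c' = 1 \<and> expansion u w ?g = c" if "u * u' = 1" "B.irred (lead_word d)" "w = w0"
  proof -
    have "\<exists>c c'. c * c' = 1 \<and> leading u w ?g = c * ?g (lead_word d)"
    proof (rule leading_single[OF that(1)])
      show "map fst d = w" "marked d" using d that(3) by auto
      fix d' assume d': "map fst d' = w" "marked d'" "d' \<noteq> d"
      show "?g (lead_word d') = 0"
      proof (rule ccontr)
        assume "?g (lead_word d') \<noteq> 0"
        then have "B.comm_eq (lead_word d') (lead_word d)" using full d' by blast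
        then show False using lead_word_comm_eq_marks[of d' d] d' d that(3) w(1) by auto
      qed
    qed
    moreover have "?g (lead_word d) = 1" using B.coeff_of_irred that(2) by blast
    ultimately show ?thesis using lead by simp
  qed
qed

lemma irred_has_leading:
  assumes "A.irred w" "set w \<subseteq> TLB_gens n"
  shows "\<exists>d. map fst d = w \<and> marked d \<and> B.irred (lead_word d)"
proof -
  obtain d where d: "map fst d = w" "good d" using good_exists assms by blast
  define d' where "d' = map (\<lambda>(a, r). (a, a \<noteq> p \<or> r)) d"
  have "map fst d' = w" using d(1) by (auto simp: d'_def)
  moreover have "marked d'" by (auto simp: d'_def marked_def)
  moreover have "lead_word d' = lead_word d" unfolding d'_def by (induction d) auto
  moreover have "B.irred (lead_word d)" using irred_lead_word d assms by auto
  ultimately show ?thesis by metis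
qed

end

section \<open>Free algebras\<close>

definition wmon :: "'g list \<Rightarrow> 'g fmon \<Rightarrow>\<^sub>0 'k::comm_ring_1" where
  "wmon w = Poly_Mapping.single (Word w) 1"

lemma wmon_Nil [simp]: "wmon [] = 1"
  by (simp add: wmon_def zero_fmon_def[symmetric])

lemma wmon_append: "wmon (u @ v) = wmon u * wmon v"
  by (simp add: wmon_def mult_single plus_fmon_def)

lemma wmon_Cons: "wmon (a # w) = gvar a * wmon w"
  by (simp add: wmon_def gvar_def mult_single plus_fmon_def)

lemma scal_wmon: "scal c * wmon w = Poly_Mapping.single (Word w) c"
  by (simp add: wmon_def scal_def mult_single)

lemma scal_simps: "scal 0 = 0" "scal 1 = 1" "scal (a + b) = scal a + scal b" "scal (a * b) = scal a * scal b"
    "scal (- a) = - scal a" "scal (a - b) = scal a - scal b"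
  by (simp_all add: scal_def single_add mult_single single_uminus single_diff)

lemma poly_decomp: "P = (\<Sum>w\<in>Poly_Mapping.keys P. Poly_Mapping.single w (Poly_Mapping.lookup P w))"
proof (rule poly_mapping_eqI)
  fix k
  show "Poly_Mapping.lookup P k = Poly_Mapping.lookup (\<Sum>w\<in>Poly_Mapping.keys P. Poly_Mapping.single w (Poly_Mapping.lookup P w)) k"
    by (simp add: lookup_sum lookup_single when_def sum.delta in_keys_iff)
qed

lemma free_alg_induct [consumes 1, case_names wmon add]:
  fixes P :: "'g fmon \<Rightarrow>\<^sub>0 'k::comm_ring_1"
  assumes "P \<in> carrier (free_alg S)"
    and "\<And>c w. set w \<subseteq> S \<Longrightarrow> Q (scal c * wmon w)"
    and "\<And>A B. A \<in> carrier (free_alg S) \<Longrightarrow> B \<in> carrier (free_alg S) \<Longrightarrow> Q A \<Longrightarrow> Q B \<Longrightarrow> Q (A + B)"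
  shows "Q P"
proof -
  have "Q (\<Sum>w\<in>W. Poly_Mapping.single w (Poly_Mapping.lookup P w)) \<and>
    (\<Sum>w\<in>W. Poly_Mapping.single w (Poly_Mapping.lookup P w)) \<in> carrier (free_alg S)"
    if "finite W" "W \<subseteq> Poly_Mapping.keys P" for W
    using that
  proof (induction W)
    case empty
    have "Q (scal 0 * wmon [])" by (rule assms(2)) simp
    then show ?case by (simp add: scal_simps)
  next
    case (insert w W)
    have "set (letters w) \<subseteq> S" using insert.prems assms(1) by (auto simp: free_alg_carrier)
    moreover have "Poly_Mapping.single w c = scal c * wmon (letters w)" for c :: 'k by (simp add: scal_wmon)
    moreover have "Poly_Mapping.single w c \<in> carrier (free_alg S)" if "set (letters w) \<subseteq> S" for c :: 'k
      using that by (auto simp: free_alg_carrier)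
    ultimately have "Q (Poly_Mapping.single w c) \<and> Poly_Mapping.single w c \<in> carrier (free_alg S)" for c :: 'k
      using assms(2) by metis
    then show ?case using insert assms(3) by simp
  qed
  from this[of "Poly_Mapping.keys P"] show ?thesis using poly_decomp[of P] by simp
qed

lemma free_alg_UNIV: "P \<in> carrier (free_alg UNIV)"
  by (simp add: free_alg_carrier)

lemma scal_central: "scal c * P = P * scal c" for P :: "'g fmon \<Rightarrow>\<^sub>0 'k::comm_ring_1"
proof (induction P rule: free_alg_induct[OF free_alg_UNIV])
  case (1 a w)
  then show ?case by (simp add: scal_wmon) (simp add: scal_def mult_single mult.commute)
qed (simp add: algebra_simps)

lemma scal_left_commute: "P * (scal c * R) = scal c * (P * R)" for P :: "'g fmon \<Rightarrow>\<^sub>0 'k::comm_ring_1"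
  by (simp only: mult.assoc[symmetric] scal_central[of c P])

text \<open>\<open>h w c\<close> is the image of the word \<open>w\<close> with coefficient
  \<open>c\<close>. One scheme thus covers both ring-valued substitutions and scalar-valued
  functionals.\<close>

definition linear_ext :: "('g list \<Rightarrow> 'k \<Rightarrow> 'b::comm_monoid_add) \<Rightarrow> ('g fmon \<Rightarrow>\<^sub>0 'k::comm_ring_1) \<Rightarrow> 'b" where
  "linear_ext h P = (\<Sum>w\<in>Poly_Mapping.keys P. h (letters w) (Poly_Mapping.lookup P w))"

lemma linear_ext_superset:
  assumes "\<And>w. h w 0 = 0" "finite W" "Poly_Mapping.keys P \<subseteq> W"
  shows "linear_ext h P = (\<Sum>w\<in>W. h (letters w) (Poly_Mapping.lookup P w))"
  unfolding linear_ext_def using assms by (intro sum.mono_neutral_left) (auto simp: in_keys_iff)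

lemma linear_ext_add:
  assumes "\<And>w. h w 0 = 0" "\<And>w a b. h w (a + b) = h w a + h w b"
  shows "linear_ext h (P + R) = linear_ext h P + linear_ext h R"
proof -
  let ?W = "Poly_Mapping.keys P \<union> Poly_Mapping.keys R"
  have "linear_ext h (P + R) = (\<Sum>w\<in>?W. h (letters w) (Poly_Mapping.lookup (P + R) w))"
    by (rule linear_ext_superset) (use Poly_Mapping.keys_add[of P R] in \<open>simp_all add: assms(1)\<close>)
  moreover have "linear_ext h P = (\<Sum>w\<in>?W. h (letters w) (Poly_Mapping.lookup P w))"
    "linear_ext h R = (\<Sum>w\<in>?W. h (letters w) (Poly_Mapping.lookup R w))"
    by (rule linear_ext_superset; simp add: assms(1))+
  ultimately show ?thesis by (simp add: lookup_add assms(2) sum.distrib)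
qed

lemma linear_ext_wmon: "h w 0 = 0 \<Longrightarrow> linear_ext h (scal c * wmon w) = h w c"
  by (simp add: scal_wmon linear_ext_def)

definition subst :: "('g \<Rightarrow> ('h fmon \<Rightarrow>\<^sub>0 'k)) \<Rightarrow> ('g fmon \<Rightarrow>\<^sub>0 'k::comm_ring_1) \<Rightarrow> ('h fmon \<Rightarrow>\<^sub>0 'k)" where
  "subst \<phi> = linear_ext (\<lambda>w c. scal c * prod_list (map \<phi> w))"

lemma subst_add [simp]: "subst \<phi> (P + R) = subst \<phi> P + subst \<phi> R"
  unfolding subst_def by (rule linear_ext_add) (simp_all add: scal_simps algebra_simps)

lemma subst_wmon: "subst \<phi> (scal c * wmon w) = scal c * prod_list (map \<phi> w)"
  unfolding subst_def by (rule linear_ext_wmon) (simp add: scal_simps)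

lemma subst_scal [simp]: "subst \<phi> (scal c) = scal c"
  using subst_wmon[of \<phi> c "[]"] by simp

lemma subst_0 [simp]: "subst \<phi> 0 = 0" and subst_1 [simp]: "subst \<phi> 1 = 1"
  using subst_scal[of \<phi> 0] subst_scal[of \<phi> 1] by (simp_all add: scal_simps)

lemma subst_gvar [simp]: "subst \<phi> (gvar g) = \<phi> g"
  using subst_wmon[of \<phi> 1 "[g]"] by (simp add: wmon_Cons scal_simps)

lemma subst_word [simp]: "subst \<phi> (wmon w) = prod_list (map \<phi> w)"
  using subst_wmon[of \<phi> 1 w] by (simp add: scal_simps)

lemma subst_uminus [simp]: "subst \<phi> (- P) = - subst \<phi> P"
  using subst_add[of \<phi> P "- P"] by (simp add: add_eq_0_iff)

lemma subst_diff [simp]: "subst \<phi> (P - R) = subst \<phi> P - subst \<phi> R"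
  using subst_add[of \<phi> P "- R"] by simp

lemma subst_mult [simp]: "subst \<phi> (P * R) = subst \<phi> P * subst \<phi> R"
proof (induction P rule: free_alg_induct[OF free_alg_UNIV])
  case (1 c w)
  show ?case
  proof (induction R rule: free_alg_induct[OF free_alg_UNIV])
    case (1 c' w')
    have eq: "scal c * wmon w * (scal c' * wmon w') = scal (c * c') * wmon (w @ w')"
      by (simp only: scal_simps(4) wmon_append mult.assoc scal_left_commute[of "wmon w"])
    show ?case
      unfolding eq subst_wmon by (simp only: scal_simps(4) map_append prod_list.append mult.assoc
          scal_left_commute[of "prod_list (map \<phi> w)"])
  qed (simp add: algebra_simps)
qed (simp add: algebra_simps)

lemma free_alg_prod_list: "(\<And>x. x \<in> set xs \<Longrightarrow> x \<in> carrier (free_alg S)) \<Longrightarrow> prod_list xs \<in> carrier (free_alg S)"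
  by (induction xs) auto

lemma subst_carrier:
  assumes "P \<in> carrier (free_alg S)" "\<And>g. g \<in> S \<Longrightarrow> \<phi> g \<in> carrier (free_alg S')"
  shows "subst \<phi> P \<in> carrier (free_alg S')"
  using assms(1)
proof (induction rule: free_alg_induct)
  case (wmon c w)
  then have "prod_list (map \<phi> w) \<in> carrier (free_alg S')"
    by (intro free_alg_prod_list) (use assms(2) in auto)
  then show ?case by simp
qed simp

definition functional :: "('g list \<Rightarrow> 'k) \<Rightarrow> ('g fmon \<Rightarrow>\<^sub>0 'k::comm_ring_1) \<Rightarrow> 'k" where
  "functional h = linear_ext (\<lambda>w c. c * h w)"

lemma functional_add [simp]: "functional h (P + R) = functional h P + functional h R"
  unfolding functional_def by (rule linear_ext_add) (simp_all add: algebra_simps)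

lemma functional_scal_wmon: "functional h (scal c * wmon w) = c * h w"
  unfolding functional_def by (rule linear_ext_wmon) simp

lemma functional_wmon [simp]: "functional h (wmon w) = h w"
  using functional_scal_wmon[of h 1 w] by (simp add: scal_simps)

lemma functional_0 [simp]: "functional h 0 = 0"
  using functional_scal_wmon[of h 0 "[]"] by (simp add: scal_simps)

lemma functional_uminus [simp]: "functional h (- P) = - functional h P"
  using functional_add[of h P "- P"] by (simp add: add_eq_0_iff)

lemma functional_diff [simp]: "functional h (P - R) = functional h P - functional h R"
  using functional_add[of h P "- R"] by simp

lemma functional_scal [simp]: "functional h (scal c * P) = c * functional h P"
proof (induction P rule: free_alg_induct[OF free_alg_UNIV])
  case (1 a w)
  have "scal c * (scal a * wmon w) = scal (c * a) * wmon w" by (simp add: scal_simps mult.assoc)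
  then show ?case by (simp only: functional_scal_wmon) (simp add: mult.assoc)
qed (simp add: algebra_simps)

lemma subst_cong: "P \<in> carrier (free_alg S) \<Longrightarrow> (\<And>g. g \<in> S \<Longrightarrow> \<phi> g = \<psi> g) \<Longrightarrow> subst \<phi> P = subst \<psi> P"
proof (induction P rule: free_alg_induct)
  case (wmon c w)
  then have "prod_list (map \<phi> w) = prod_list (map \<psi> w)"
    by (intro arg_cong[of _ _ prod_list] map_cong) auto
  then show ?case by simp
qed simp

lemma subst_gvar_id: "subst gvar P = P" for P :: "'g fmon \<Rightarrow>\<^sub>0 'k::comm_ring_1"
proof (induction P rule: free_alg_induct[OF free_alg_UNIV])
  case (1 c w)
  have "prod_list (map gvar w) = (wmon w :: 'g fmon \<Rightarrow>\<^sub>0 'k)" by (induction w) (simp_all add: wmon_Cons)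
  then show ?case by simp
qed simp

lemma subst_subst: "subst \<phi> (subst \<psi> P) = subst (\<lambda>g. subst \<phi> (\<psi> g)) P"
proof (induction P rule: free_alg_induct[OF free_alg_UNIV])
  case (1 c w)
  have "subst \<phi> (prod_list (map \<psi> w)) = prod_list (map (\<lambda>g. subst \<phi> (\<psi> g)) w)" by (induction w) simp_all
  then show ?case by simp
qed simp

section \<open>Congruence and conjugation modulo a two-sided ideal\<close>

locale two_sided =
  fixes J :: "'r::ring_1 set"
  assumes J_0: "0 \<in> J" and J_add: "x \<in> J \<Longrightarrow> y \<in> J \<Longrightarrow> x + y \<in> J" and J_uminus: "x \<in> J \<Longrightarrow> - x \<in> J"
    and J_left: "y \<in> J \<Longrightarrow> x * y \<in> J" and J_right: "x \<in> J \<Longrightarrow> x * y \<in> J"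
begin

definition cong :: "'r \<Rightarrow> 'r \<Rightarrow> bool" where
  "cong x y \<longleftrightarrow> x - y \<in> J"

lemma J_diff: "x \<in> J \<Longrightarrow> y \<in> J \<Longrightarrow> x - y \<in> J"
  using J_add[of x "- y"] J_uminus by simp

lemma cong_refl [simp]: "cong x x"
  by (simp add: cong_def J_0)

lemma cong_sym: "cong x y \<Longrightarrow> cong y x"
  using J_uminus[of "x - y"] by (simp add: cong_def)

lemma cong_trans [trans]: "cong x y \<Longrightarrow> cong y z \<Longrightarrow> cong x z"
  using J_add[of "x - y" "y - z"] by (simp add: cong_def)

lemma cong_add: "cong x y \<Longrightarrow> cong x' y' \<Longrightarrow> cong (x + x') (y + y')"
  using J_add[of "x - y" "x' - y'"] by (simp add: cong_def algebra_simps)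

lemma cong_diff: "cong x y \<Longrightarrow> cong x' y' \<Longrightarrow> cong (x - x') (y - y')"
  using J_diff[of "x - y" "x' - y'"] by (simp add: cong_def algebra_simps)

lemma cong_mult: "cong x y \<Longrightarrow> cong x' y' \<Longrightarrow> cong (x * x') (y * y')"
proof -
  assume *: "cong x y" "cong x' y'"
  then have "x * (x' - y') + (x - y) * y' \<in> J" by (intro J_add J_left J_right) (auto simp: cong_def)
  then show ?thesis by (simp add: cong_def algebra_simps)
qed

lemma cong_sum: "(\<And>i. i \<in> I \<Longrightarrow> cong (a i) (b i)) \<Longrightarrow> cong (sum a I) (sum b I)"
  by (induction I rule: infinite_finite_induct) (auto intro: cong_add)

lemma cong_J: "cong x y \<Longrightarrow> x \<in> J \<longleftrightarrow> y \<in> J"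
  using J_add[of "x - y" y] J_diff[of x "x - y"] by (auto simp: cong_def)

text \<open>A relation rather than a map, because \<open>W'\<close> inverts \<open>W\<close> only
  modulo \<open>J\<close>; compatibility with products is where \<open>cong (W' * W) 1\<close>
  enters.\<close>

definition conj_by :: "'r \<Rightarrow> 'r \<Rightarrow> 'r \<Rightarrow> 'r \<Rightarrow> bool" where
  "conj_by W W' A a \<longleftrightarrow> cong A (W * a * W')"

lemma conj_by_mult:
  assumes "cong (W' * W) 1" "conj_by W W' A a" "conj_by W W' B b"
  shows "conj_by W W' (A * B) (a * b)"
proof -
  have "cong (A * B) (W * a * W' * (W * b * W'))" using assms(2,3) by (auto simp: conj_by_def intro: cong_mult)
  also have "W * a * W' * (W * b * W') = W * a * (W' * W) * (b * W')" by (simp add: mult.assoc)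
  also have "cong \<dots> (W * a * 1 * (b * W'))" by (intro cong_mult cong_refl assms(1))
  finally show ?thesis by (simp add: conj_by_def mult.assoc)
qed

lemma conj_by_diff: "conj_by W W' A a \<Longrightarrow> conj_by W W' B b \<Longrightarrow> conj_by W W' (A - B) (a - b)"
  unfolding conj_by_def by (drule (1) cong_diff) (simp add: algebra_simps)

lemma conj_by_J: "conj_by W W' A a \<Longrightarrow> a \<in> J \<Longrightarrow> A \<in> J"
  unfolding conj_by_def using cong_J J_left J_right by blast

lemma conj_by_central: "conj_by W W' A a \<Longrightarrow> c * W = W * c \<Longrightarrow> conj_by W W' (c * A) (c * a)"
  using cong_mult[of c c A "W * a * W'"] by (simp add: conj_by_def mult.assoc[symmetric])

end

section \<open>The relations in terms of \<open>T + 1\<close>\<close>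

text \<open>An identity for every \<open>c\<close>. For \<open>c = q\<close> the last bracket is the
  quadratic relation, so that the vanishing of \<open>TL_V\<close> becomes X Y X = q X.\<close>

lemma TL_V_shift: "TL_V (X - 1) (Y - 1) = (X * Y * X - c * X) - (X * X - (c + 1) * X)"
  by (simp add: TL_V_def algebra_simps)

text \<open>The origin of the constant \<open>2 * q\<close>: \<open>TL_Z\<close> equals X Y X Y - X
  Y Y - X X Y + 2 X Y, and each square contributes q + 1 times X Y, which leaves 2 - 2 (q + 1) = -2
  q.\<close>

lemma TL_Z_shift:
  assumes "c * X = X * c"
  shows "TL_Z (X - 1) (Y - 1) = (X * Y * X * Y - 2 * c * (X * Y)) - X * (Y * Y - (c + 1) * Y) - (X * X - (c + 1) * X) * Y"
proof -
  have "X * (c * Y) = c * (X * Y)" by (metis assms mult.assoc)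
  then show ?thesis by (simp add: TL_Z_def algebra_simps mult_2)
qed

lemma quadratic_shift: "(X - 1) * (X - 1) - ((c - 1) * (X - 1) + c) = X * X - (c + 1) * X" for X c :: "'a::ring_1"
  by (simp add: algebra_simps)

lemma commutator_shift: "(X - 1) * (Y - 1) - (Y - 1) * (X - 1) = X * Y - Y * X" for X :: "'a::ring_1"
  by (simp add: algebra_simps)

text \<open>The presentation imposes \<open>TL_V\<close> on a pair in one order only. The braid
  relation carries it to the other order and, conversely, follows from both orders together.\<close>

lemma braid_3: "x * y * x - y * x * y = TL_V x y - TL_V y x"
  by (simp add: TL_V_def algebra_simps)

lemma braid_4: "x * y * x * y - y * x * y * x = TL_Z x y - TL_Z y x"
  by (simp add: TL_Z_def algebra_simps)

lemma subst_TL_V [simp]: "subst \<phi> (TL_V x y) = TL_V (subst \<phi> x) (subst \<phi> y)"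
  and subst_TL_Z [simp]: "subst \<phi> (TL_Z x y) = TL_Z (subst \<phi> x) (subst \<phi> y)"
  by (simp_all add: TL_V_def TL_Z_def)

locale two_sided_alg = two_sided J for J :: "('g fmon \<Rightarrow>\<^sub>0 'k::comm_ring_1) set"
begin

text \<open>Modulo \<open>J\<close>, the elements \<open>x a\<close> satisfy the relations of the generators \<open>T\<^sub>a + 1\<close>.\<close>

definition diagrammatic :: "'k \<Rightarrow> nat \<Rightarrow> (gen \<Rightarrow> ('g fmon \<Rightarrow>\<^sub>0 'k)) \<Rightarrow> bool" where
  "diagrammatic q N x \<longleftrightarrow> (\<forall>a\<in>TLB_gens N. x a * x a - scal (q + 1) * x a \<in> J) \<and>
    (\<forall>a\<in>TLB_gens N. \<forall>b\<in>TLB_gens N.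
      (cox N a b = 2 \<longrightarrow> x a * x b - x b * x a \<in> J) \<and>
      (cox N a b = 3 \<longrightarrow> x a * x b * x a - scal q * x a \<in> J) \<and>
      (cox N a b = 4 \<longrightarrow> x a * x b * x a * x b - scal (2 * q) * (x a * x b) \<in> J))"

lemma diagrammaticD:
  assumes "diagrammatic q N x" "a \<in> TLB_gens N"
  shows "x a * x a - scal (q + 1) * x a \<in> J"
    and "b \<in> TLB_gens N \<Longrightarrow> cox N a b = 2 \<Longrightarrow> x a * x b - x b * x a \<in> J"
    and "b \<in> TLB_gens N \<Longrightarrow> cox N a b = 3 \<Longrightarrow> x a * x b * x a - scal q * x a \<in> J"
    and "b \<in> TLB_gens N \<Longrightarrow> cox N a b = 4 \<Longrightarrow> x a * x b * x a * x b - scal (2 * q) * (x a * x b) \<in> J"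
  using assms by (auto simp: diagrammatic_def)

lemma TL_V_J:
  assumes "x * x - scal (q + 1) * x \<in> J"
  shows "TL_V (x - 1) (y - 1) \<in> J \<longleftrightarrow> x * y * x - scal q * x \<in> J"
proof -
  have eq: "TL_V (x - 1) (y - 1) = (x * y * x - scal q * x) - (x * x - scal (q + 1) * x)"
    using TL_V_shift[of x y "scal q"] by (simp add: scal_simps)
  show ?thesis
    using J_diff[OF _ assms, of "x * y * x - scal q * x"] J_add[OF _ assms, of "TL_V (x - 1) (y - 1)"]
    by (auto simp: eq)
qed

lemma TL_Z_J:
  assumes "x * x - scal (q + 1) * x \<in> J" "y * y - scal (q + 1) * y \<in> J"
  shows "TL_Z (x - 1) (y - 1) \<in> J \<longleftrightarrow> x * y * x * y - scal (2 * q) * (x * y) \<in> J"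
proof -
  let ?r = "x * (y * y - scal (q + 1) * y) + (x * x - scal (q + 1) * x) * y"
  have r: "?r \<in> J" using assms by (intro J_add J_left J_right)
  have s: "scal (2 * q) = 2 * (scal q :: 'g fmon \<Rightarrow>\<^sub>0 'k)"
    by (simp only: mult_2 scal_simps)
  have eq: "TL_Z (x - 1) (y - 1) = (x * y * x * y - scal (2 * q) * (x * y)) - ?r"
    using TL_Z_shift[OF scal_central[of q x], of y] by (simp add: scal_simps(2,3) s del: diff_diff_eq)
  show ?thesis
    using J_diff[OF _ r, of "x * y * x * y - scal (2 * q) * (x * y)"] J_add[OF _ r, of "TL_Z (x - 1) (y - 1)"]
    unfolding eq by (auto simp del: diff_diff_eq)
qed

lemma diagrammatic_rels:
  assumes N: "3 \<le> N" and x: "diagrammatic q N x" and P: "P \<in> TLB_rels q N"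
  shows "subst (\<lambda>a. x a - 1) P \<in> J"
proof -
  have gens: "SigmaBar \<in> TLB_gens N" "Tee N \<in> TLB_gens N"
    "\<And>i. 1 \<le> i \<Longrightarrow> i \<le> N - 1 \<Longrightarrow> Sigma i \<in> TLB_gens N"
    using N by (auto simp: TLB_gens_def)
  note D = diagrammaticD[OF x]
  have V: "TL_V (x a - 1) (x b - 1) \<in> J" if "a \<in> TLB_gens N" "b \<in> TLB_gens N" "cox N a b = 3" for a b
    using TL_V_J[OF D(1)] D(3) that by blast
  have Z: "TL_Z (x a - 1) (x b - 1) \<in> J" if "a \<in> TLB_gens N" "b \<in> TLB_gens N" "cox N a b = 4" for a b
    using TL_Z_J[OF D(1) D(1)] D(4) that by blast
  have s2: "Sigma 2 \<in> TLB_gens N" and sn: "Sigma (N - 1) \<in> TLB_gens N" using gens(3) N by auto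
  consider (ss) i j where "P = gvar (Sigma i) * gvar (Sigma j) - gvar (Sigma j) * gvar (Sigma i)"
      "1 \<le> i" "i \<le> N - 1" "1 \<le> j" "j \<le> N - 1" "\<bar>int i - int j\<bar> \<ge> 2"
    | (st) i where "P = gvar (Sigma i) * gvar (Tee N) - gvar (Tee N) * gvar (Sigma i)" "1 \<le> i" "i \<le> N - 1 - 1"
    | (sss) i where "P = gvar (Sigma i) * gvar (Sigma (i+1)) * gvar (Sigma i) - gvar (Sigma (i+1)) * gvar (Sigma i) * gvar (Sigma (i+1))"
      "1 \<le> i" "i \<le> N - 1 - 1"
    | (bsb) "P = gvar SigmaBar * gvar (Sigma 2) * gvar SigmaBar - gvar (Sigma 2) * gvar SigmaBar * gvar (Sigma 2)"
    | (bt) "P = gvar SigmaBar * gvar (Tee N) - gvar (Tee N) * gvar SigmaBar"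
    | (bs) i where "P = gvar SigmaBar * gvar (Sigma i) - gvar (Sigma i) * gvar SigmaBar" "1 \<le> i" "i \<le> N - 1" "i \<noteq> 2"
    | (tsts) "P = gvar (Tee N) * gvar (Sigma (N-1)) * gvar (Tee N) * gvar (Sigma (N-1)) - gvar (Sigma (N-1)) * gvar (Tee N) * gvar (Sigma (N-1)) * gvar (Tee N)"
    | (sq) g where "P = gvar g * gvar g - (scal (q - 1) * gvar g + scal q)" "g \<in> TLB_gens N"
    | (bV) "P = TL_V (gvar SigmaBar) (gvar (Sigma 2))"
    | (sV) i where "P = TL_V (gvar (Sigma i)) (gvar (Sigma (i+1)))" "1 \<le> i" "i \<le> N - 1 - 1"
    | (stst) "P = TL_Z (gvar (Sigma (N-1))) (gvar (Tee N))"
    using P unfolding TLB_rels_def Let_def Un_iff mem_Collect_eq singleton_iff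
    by (elim disjE exE conjE; blast)
  then show ?thesis
  proof cases
    case ss
    have "cox N (Sigma i) (Sigma j) = 2" using ss by (auto simp: cox_def adj3_def adj4_def)
    then show ?thesis using D(2) gens(3) ss by (simp add: commutator_shift)
  next
    case st
    have "cox N (Sigma i) (Tee N) = 2" using st by (auto simp: cox_def adj3_def adj4_def)
    then show ?thesis using D(2)[OF gens(3) gens(2)] st by (simp add: commutator_shift)
  next
    case sss
    have "cox N (Sigma i) (Sigma (i+1)) = 3" "cox N (Sigma (i+1)) (Sigma i) = 3" by (auto simp: cox_def adj3_def)
    moreover have "Sigma i \<in> TLB_gens N" "Sigma (i+1) \<in> TLB_gens N" using gens(3) sss by auto
    ultimately show ?thesis using J_diff[OF V V] sss(1) by (simp add: braid_3)
  next
    case bsb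
    have "cox N SigmaBar (Sigma 2) = 3" "cox N (Sigma 2) SigmaBar = 3" by (auto simp: cox_def adj3_def)
    then show ?thesis using J_diff[OF V[OF gens(1) s2] V[OF s2 gens(1)]] bsb by (simp add: braid_3)
  next
    case bt
    have "cox N SigmaBar (Tee N) = 2" by (auto simp: cox_def adj3_def adj4_def)
    then show ?thesis using D(2)[OF gens(1) gens(2)] bt by (simp add: commutator_shift)
  next
    case bs
    have "cox N SigmaBar (Sigma i) = 2" using bs by (auto simp: cox_def adj3_def adj4_def)
    then show ?thesis using D(2)[OF gens(1) gens(3)] bs by (simp add: commutator_shift)
  next
    case tsts
    have "cox N (Sigma (N-1)) (Tee N) = 4" "cox N (Tee N) (Sigma (N-1)) = 4" by (auto simp: cox_def adj3_def adj4_def)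
    then show ?thesis using J_diff[OF Z[OF gens(2) sn] Z[OF sn gens(2)]] tsts by (simp add: braid_4)
  next
    case sq
    then show ?thesis using D(1)[of g] quadratic_shift[of "x g" "scal q"] by (simp add: scal_simps)
  next
    case bV
    have "cox N SigmaBar (Sigma 2) = 3" by (auto simp: cox_def adj3_def)
    then show ?thesis using V[OF gens(1) s2] bV by simp
  next
    case sV
    have "cox N (Sigma i) (Sigma (i+1)) = 3" by (auto simp: cox_def adj3_def)
    then show ?thesis using V[OF gens(3) gens(3), of i "i+1"] sV by simp
  next
    case stst
    have "cox N (Sigma (N-1)) (Tee N) = 4" by (auto simp: cox_def adj3_def adj4_def)
    then show ?thesis using Z[OF sn gens(2)] stst by simp
  qed
qed

text \<open>The universal property of the presentation, for targets that are free algebras modulo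
  \<open>J\<close>: the preimage of \<open>J\<close> is an ideal containing the relations.\<close>

lemma TLB_ideal_subst:
  assumes N: "3 \<le> N" and x: "diagrammatic q N x" and P: "P \<in> TLB_ideal q N"
  shows "subst (\<lambda>a. x a - 1) P \<in> J"
proof -
  let ?R = "free_alg (TLB_gens N) :: (gen fmon \<Rightarrow>\<^sub>0 'k) ring"
  let ?I = "{P \<in> carrier ?R. subst (\<lambda>a. x a - 1) P \<in> J}"
  have "ideal ?I ?R"
  proof (rule idealI[OF ring_free_alg])
    interpret R: Ring.ring ?R by (rule ring_free_alg)
    show "subgroup ?I (add_monoid ?R)"
    proof (rule group.subgroupI[OF R.add.group_axioms])
      show "?I \<noteq> {}" using free_alg_consts(1)[of "TLB_gens N"] J_0 by force
      fix a assume a: "a \<in> ?I"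
      have "a \<oplus>\<^bsub>?R\<^esub> (- a) = \<zero>\<^bsub>?R\<^esub>" by simp
      then have "inv\<^bsub>add_monoid ?R\<^esub> a = - a"
        using a R.minus_equality[of "- a" a] by (simp add: a_inv_def)
      then show "inv\<^bsub>add_monoid ?R\<^esub> a \<in> ?I" using a by (simp add: J_uminus)
    qed (auto intro: J_add)
  qed (auto intro: J_left J_right)
  moreover have "TLB_rels q N \<subseteq> ?I"
    using diagrammatic_rels[OF N x] TLB_rels_carrier[OF N] by auto
  ultimately have "TLB_ideal q N \<subseteq> ?I"
    unfolding TLB_ideal_def by (rule ring.genideal_minimal[OF ring_free_alg])
  then show ?thesis using P by auto
qed

end

context two_sided_alg begin

text \<open>The converse of \<open>diagrammatic_rels\<close>. Adjacent generators play symmetric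
  roles in \<open>diagrammatic\<close> but not in the presentation, and the braid relations supply
  the missing order.\<close>

lemma rels_diagrammatic:
  assumes N: "3 \<le> N" and P: "\<And>P. P \<in> TLB_rels q N \<Longrightarrow> subst (\<lambda>a. x a - 1) P \<in> J"
  shows "diagrammatic q N x"
proof -
  have Sg: "Sigma i \<in> TLB_gens N \<longleftrightarrow> 1 \<le> i \<and> i < N" "Tee i \<in> TLB_gens N \<longleftrightarrow> i = N" for i
    by (auto simp: TLB_gens_def)
  have sq: "x a * x a - scal (q + 1) * x a \<in> J" if "a \<in> TLB_gens N" for a
  proof -
    have "gvar a * gvar a - (scal (q - 1) * gvar a + scal q) \<in> TLB_rels q N"
      using that unfolding TLB_rels_def Let_def by blast
    from P[OF this] show ?thesis using quadratic_shift[of "x a" "scal q"] by (simp add: scal_simps)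
  qed
  have com: "x a * x b - x b * x a \<in> J"
    if "gvar a * gvar b - gvar b * gvar a \<in> TLB_rels q N \<or> gvar b * gvar a - gvar a * gvar b \<in> TLB_rels q N" for a b
    using that P[of "gvar a * gvar b - gvar b * gvar a"] P[of "gvar b * gvar a - gvar a * gvar b"]
      J_uminus[of "x b * x a - x a * x b"] by (auto simp: commutator_shift)
  have cox2: "gvar a * gvar b - gvar b * gvar a \<in> TLB_rels q N \<or> gvar b * gvar a - gvar a * gvar b \<in> TLB_rels q N"
    if "a \<in> TLB_gens N" "b \<in> TLB_gens N" "cox N a b = 2" for a b
  proof -
    have ss: "gvar (Sigma i) * gvar (Sigma j) - gvar (Sigma j) * gvar (Sigma i) \<in> TLB_rels q N"
      if "1 \<le> i" "i \<le> N - 1" "1 \<le> j" "j \<le> N - 1" "2 \<le> \<bar>int i - int j\<bar>" for i j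
      using that unfolding TLB_rels_def Let_def by blast
    have st: "gvar (Sigma i) * gvar (Tee N) - gvar (Tee N) * gvar (Sigma i) \<in> TLB_rels q N"
      if "1 \<le> i" "i \<le> N - 1 - 1" for i
      using that unfolding TLB_rels_def Let_def by blast
    have bs: "gvar SigmaBar * gvar (Sigma i) - gvar (Sigma i) * gvar SigmaBar \<in> TLB_rels q N"
      if "1 \<le> i" "i \<le> N - 1" "i \<noteq> 2" for i
      using that unfolding TLB_rels_def Let_def by blast
    have bt: "gvar SigmaBar * gvar (Tee N) - gvar (Tee N) * gvar SigmaBar \<in> TLB_rels q N"
      unfolding TLB_rels_def Let_def by blast
    show ?thesis
    proof (cases a)
      case SigmaBar
      then show ?thesis using bs bt that
        by (cases b) (auto simp: Sg cox_def adj3_def adj4_def split: if_splits)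
    next
      case (Sigma i)
      show ?thesis
      proof (cases b)
        case SigmaBar
        then show ?thesis using bs that Sigma by (auto simp: Sg cox_def adj3_def adj4_def split: if_splits)
      next
        case b: (Sigma j)
        have "i \<noteq> j" "j \<noteq> Suc i" "i \<noteq> Suc j" using that Sigma b
          by (auto simp: cox_def adj3_def split: if_splits)
        then have "2 \<le> \<bar>int i - int j\<bar>" by arith
        then show ?thesis using ss[of i j] that Sigma b by (auto simp: Sg)
      next
        case (Tee j)
        then show ?thesis using st[of i] that Sigma by (auto simp: Sg cox_def adj3_def adj4_def split: if_splits)
      qed
    next
      case (Tee i)
      show ?thesis
      proof (cases b)
        case SigmaBar
        then show ?thesis using bt that Tee by (auto simp: Sg)
      next
        case (Sigma j)
        then show ?thesis using st[of j] that Tee by (auto simp: Sg cox_def adj3_def adj4_def split: if_splits)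
      next
        case b: (Tee j)
        then show ?thesis using that Tee by (auto simp: Sg cox_def)
      qed
    qed
  qed
  have V: "x a * x b * x a - scal q * x a \<in> J"
    if "a \<in> TLB_gens N" "TL_V (gvar a) (gvar b) \<in> TLB_rels q N \<or>
      TL_V (gvar b) (gvar a) \<in> TLB_rels q N \<and> gvar b * gvar a * gvar b - gvar a * gvar b * gvar a \<in> TLB_rels q N" for a b
  proof -
    have "TL_V (x a - 1) (x b - 1) \<in> J"
      using that(2)
    proof
      assume "TL_V (gvar a) (gvar b) \<in> TLB_rels q N"
      from P[OF this] show ?thesis by simp
    next
      assume "TL_V (gvar b) (gvar a) \<in> TLB_rels q N \<and> gvar b * gvar a * gvar b - gvar a * gvar b * gvar a \<in> TLB_rels q N"
      from P[OF conjunct1[OF this]] P[OF conjunct2[OF this]]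
      show ?thesis using J_diff[of "TL_V (x b - 1) (x a - 1)" "TL_V (x b - 1) (x a - 1) - TL_V (x a - 1) (x b - 1)"]
        unfolding braid_3 by simp
    qed
    then show ?thesis using TL_V_J[OF sq[OF that(1)]] by simp
  qed
  have Z: "x a * x b * x a * x b - scal (2 * q) * (x a * x b) \<in> J"
    if "a \<in> TLB_gens N" "b \<in> TLB_gens N" "TL_Z (gvar a) (gvar b) \<in> TLB_rels q N \<or>
      TL_Z (gvar b) (gvar a) \<in> TLB_rels q N \<and>
      gvar a * gvar b * gvar a * gvar b - gvar b * gvar a * gvar b * gvar a \<in> TLB_rels q N" for a b
  proof -
    have "TL_Z (x a - 1) (x b - 1) \<in> J"
      using that(3)
    proof
      assume "TL_Z (gvar a) (gvar b) \<in> TLB_rels q N"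
      from P[OF this] show ?thesis by simp
    next
      assume "TL_Z (gvar b) (gvar a) \<in> TLB_rels q N \<and>
        gvar a * gvar b * gvar a * gvar b - gvar b * gvar a * gvar b * gvar a \<in> TLB_rels q N"
      from P[OF conjunct1[OF this]] P[OF conjunct2[OF this]]
      show ?thesis using J_add[of "TL_Z (x b - 1) (x a - 1)" "TL_Z (x a - 1) (x b - 1) - TL_Z (x b - 1) (x a - 1)"]
        unfolding braid_4 by simp
    qed
    then show ?thesis using TL_Z_J[OF sq[OF that(1)] sq[OF that(2)]] by simp
  qed
  have cox3: "TL_V (gvar a) (gvar b) \<in> TLB_rels q N \<or>
      TL_V (gvar b) (gvar a) \<in> TLB_rels q N \<and> gvar b * gvar a * gvar b - gvar a * gvar b * gvar a \<in> TLB_rels q N"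
    if "a \<in> TLB_gens N" "b \<in> TLB_gens N" "cox N a b = 3" for a b
  proof -
    have ss: "TL_V (gvar (Sigma i)) (gvar (Sigma (Suc i))) \<in> TLB_rels q N"
        "gvar (Sigma i) * gvar (Sigma (Suc i)) * gvar (Sigma i) - gvar (Sigma (Suc i)) * gvar (Sigma i) * gvar (Sigma (Suc i)) \<in> TLB_rels q N"
      if "1 \<le> i" "i \<le> N - 1 - 1" for i
      using that unfolding TLB_rels_def Let_def Suc_eq_plus1 by blast+
    have bs: "TL_V (gvar SigmaBar) (gvar (Sigma 2)) \<in> TLB_rels q N"
      "gvar SigmaBar * gvar (Sigma 2) * gvar SigmaBar - gvar (Sigma 2) * gvar SigmaBar * gvar (Sigma 2) \<in> TLB_rels q N"
      unfolding TLB_rels_def Let_def by blast+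
    have "adj3 a b \<or> adj3 b a" using that(3) by (auto simp: cox_def split: if_splits)
    then have "(\<exists>i. a = Sigma i \<and> b = Sigma (Suc i)) \<or> a = SigmaBar \<and> b = Sigma 2 \<or>
      (\<exists>i. b = Sigma i \<and> a = Sigma (Suc i)) \<or> b = SigmaBar \<and> a = Sigma 2"
      unfolding adj3_def by blast
    then show ?thesis
    proof (elim disjE exE conjE)
      fix i assume i: "a = Sigma i" "b = Sigma (Suc i)"
      then have "1 \<le> i" "i \<le> N - 1 - 1" using that by (auto simp: Sg)
      from ss[OF this] i show ?thesis by blast
    next
      fix i assume i: "b = Sigma i" "a = Sigma (Suc i)"
      then have "1 \<le> i" "i \<le> N - 1 - 1" using that by (auto simp: Sg)
      from ss[OF this] i show ?thesis by blast
    qed (use bs in blast)+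
  qed
  have cox4: "TL_Z (gvar a) (gvar b) \<in> TLB_rels q N \<or>
      TL_Z (gvar b) (gvar a) \<in> TLB_rels q N \<and>
      gvar a * gvar b * gvar a * gvar b - gvar b * gvar a * gvar b * gvar a \<in> TLB_rels q N"
    if "cox N a b = 4" for a b
  proof -
    have st: "TL_Z (gvar (Sigma (N - 1))) (gvar (Tee N)) \<in> TLB_rels q N"
      "gvar (Tee N) * gvar (Sigma (N - 1)) * gvar (Tee N) * gvar (Sigma (N - 1)) -
        gvar (Sigma (N - 1)) * gvar (Tee N) * gvar (Sigma (N - 1)) * gvar (Tee N) \<in> TLB_rels q N"
      unfolding TLB_rels_def Let_def by blast+
    have "adj4 N a b \<or> adj4 N b a" using that by (auto simp: cox_def split: if_splits)
    then show ?thesis unfolding adj4_def using st by blast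
  qed
  show ?thesis
    unfolding diagrammatic_def using sq com[OF cox2] V[OF _ cox3] Z[OF _ _ cox4] by blast
qed

end

text \<open>The largest two-sided ideal on which \<open>h\<close> vanishes. Through it a mere linear
  functional becomes a test that every element of the defining ideal has to pass.\<close>

definition annihilator :: "('g list \<Rightarrow> 'k) \<Rightarrow> ('g fmon \<Rightarrow>\<^sub>0 'k::comm_ring_1) set" where
  "annihilator h = {P. \<forall>A B. functional h (A * P * B) = 0}"

lemma annihilatorD: "P \<in> annihilator h \<Longrightarrow> functional h (A * P * B) = 0"
  by (simp add: annihilator_def)

lemma two_sided_annihilator: "two_sided (annihilator h)"
proof
  fix x y :: "'a fmon \<Rightarrow>\<^sub>0 'b"
  show "x * y \<in> annihilator h" if "y \<in> annihilator h"
  proof -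
    have "functional h (A * (x * y) * B) = 0" for A B
      using annihilatorD[OF that, of "A * x" B] by (simp only: mult.assoc)
    then show ?thesis by (simp add: annihilator_def)
  qed
  show "x * y \<in> annihilator h" if "x \<in> annihilator h"
  proof -
    have "functional h (A * (x * y) * B) = 0" for A B
      using annihilatorD[OF that, of A "y * B"] by (simp only: mult.assoc)
    then show ?thesis by (simp add: annihilator_def)
  qed
qed (simp_all add: annihilator_def algebra_simps)

lemma annihilator_functional: "P \<in> annihilator h \<Longrightarrow> functional h P = 0"
  using annihilatorD[of P h 1 1] by simp

lemma annihilatorI:
  fixes P :: "'g fmon \<Rightarrow>\<^sub>0 'k::comm_ring_1"
  assumes "\<And>u v. functional h (wmon u * P * wmon v) = 0"
  shows "P \<in> annihilator h"
proof -
  have left: "functional h (wmon u * (P * B)) = 0" for u B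
  proof (induction B rule: free_alg_induct[OF free_alg_UNIV])
    case (1 c v)
    have "wmon u * (P * (scal c * wmon v)) = scal c * (wmon u * P * wmon v)"
      by (simp only: mult.assoc scal_left_commute[of P] scal_left_commute[of "wmon u"])
    then show ?case by (simp add: assms)
  qed (simp add: algebra_simps)
  have "functional h (A * P * B) = 0" for A B
  proof (induction A rule: free_alg_induct[OF free_alg_UNIV])
    case (1 c u)
    then show ?case by (simp add: mult.assoc left)
  qed (simp add: algebra_simps)
  then show ?thesis by (simp add: annihilator_def)
qed

section \<open>Reductions modulo the annihilator of a coefficient functional\<close>

context coxeter_words begin

lemma red_context: "red w c v \<Longrightarrow> red (x @ w @ y) c (x @ v @ y)"
proof (induction rule: red.induct)
  case (red_refl w)
  show ?case by (rule red.red_refl)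
next
  case (red_swap w w'' c w')
  then show ?case using red.red_swap[OF swap_context] by blast
next
  case (red_1 u s v c w')
  then show ?case using red.red_1[of "x @ u" s "v @ y"] by simp
next
  case (red_3 s t u v c w')
  then show ?case using red.red_3[of s t "x @ u" "v @ y"] by simp
next
  case (red_4 s t u v c w')
  then show ?case using red.red_4[of s t "x @ u" "v @ y"] by simp
qed

text \<open>Reductions remain reductions between further letters on both sides, and
  \<open>coeff_of\<close> respects them there as well.\<close>

lemma red_annihilator: "red w c v \<Longrightarrow> wmon w - scal c * wmon v \<in> annihilator (coeff_of \<mu>)"
proof (rule annihilatorI)
  fix x y assume "red w c v"
  then have "coeff_of \<mu> (x @ w @ y) = c * coeff_of \<mu> (x @ v @ y)" by (intro coeff_of_red red_context)
  moreover have "wmon x * (wmon w - scal c * wmon v) * wmon y = wmon (x @ w @ y) - scal c * wmon (x @ v @ y)"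
    by (simp add: wmon_append left_diff_distrib right_diff_distrib mult.assoc scal_left_commute[of "wmon x"])
  ultimately show "functional (coeff_of \<mu>) (wmon x * (wmon w - scal c * wmon v) * wmon y) = 0"
    by simp
qed

lemma red_basic:
  "m a b = 2 \<Longrightarrow> red [a,b] 1 [b,a]"
  "red [a,a] d [a]"
  "m a b = 3 \<Longrightarrow> red [a,b,a] k3 [a]"
  "m a b = 4 \<Longrightarrow> red [a,b,a,b] k4 [a,b]"
  using red_swap[OF swap.intros[of a b "[]" "[]"] red_refl] red_1[of "[]" a "[]" 1] red_3[of a b "[]" "[]" 1]
    red_4[of a b "[]" "[]" 1] red_refl by (auto simp: dep_def)

end

context two_sided begin

lemma conj_by_trans: "conj_by W W' A B \<Longrightarrow> conj_by V V' B C \<Longrightarrow> conj_by (W * V) (V' * W') A C"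
proof -
  assume *: "conj_by W W' A B" "conj_by V V' B C"
  have "cong (W * B * W') (W * (V * C * V') * W')"
    using *(2) unfolding conj_by_def by (intro cong_mult cong_refl)
  from cong_trans[OF *(1)[unfolded conj_by_def] this] show ?thesis by (simp only: conj_by_def mult.assoc)
qed

lemma conj_by_commute:
  assumes "cong (W * a) (a * W)" "cong (W * W') 1"
  shows "conj_by W W' a a"
proof -
  have "cong (W * a * W') (a * W * W')" by (intro cong_mult assms cong_refl)
  also have "a * W * W' = a * (W * W')" by (simp add: mult.assoc)
  also have "cong \<dots> (a * 1)" by (intro cong_mult assms cong_refl)
  finally show ?thesis unfolding conj_by_def by (simp add: cong_sym)
qed

lemma conj_by_iff:
  assumes "cong (W * W') 1" "cong (W' * W) 1"
  shows "conj_by W W' A a \<longleftrightarrow> cong (W' * A * W) a"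
proof
  assume "conj_by W W' A a"
  then have "cong (W' * A * W) (W' * (W * a * W') * W)"
    unfolding conj_by_def by (intro cong_mult cong_refl)
  also have "W' * (W * a * W') * W = (W' * W) * a * (W' * W)" by (simp add: mult.assoc)
  also have "cong \<dots> (1 * a * 1)" by (intro cong_mult assms cong_refl)
  finally show "cong (W' * A * W) a" by simp
next
  assume *: "cong (W' * A * W) a"
  have "cong (1 * A * 1) ((W * W') * A * (W * W'))" by (intro cong_mult cong_refl cong_sym[OF assms(1)])
  also have "(W * W') * A * (W * W') = W * (W' * A * W) * W'" by (simp add: mult.assoc)
  also have "cong \<dots> (W * a * W')" by (intro cong_mult cong_refl *)
  finally show "conj_by W W' A a" by (simp add: conj_by_def)
qed

lemma conj_by_prod_list:
  assumes "cong (W * W') 1" "cong (W' * W) 1" "\<And>a. a \<in> set w \<Longrightarrow> conj_by W W' (y a) (z a)"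
  shows "conj_by W W' (prod_list (map y w)) (prod_list (map z w))"
  using assms(3)
proof (induction w)
  case Nil
  then show ?case using assms(1) by (simp add: conj_by_def cong_sym)
qed (simp add: conj_by_mult[OF assms(2)])

end

section \<open>Reduction and conjugation in any algebra that satisfies the relations\<close>

locale tlb_quotient = tlb_pair q n + two_sided_alg J
  for q :: "'k::comm_ring_1" and n :: nat and J :: "('g fmon \<Rightarrow>\<^sub>0 'k) set"
begin

lemma red_cong:
  assumes x: "diagrammatic q n x" and "A.red w c v" "set w \<subseteq> TLB_gens n"
  shows "cong (prod_list (map x w)) (scal c * prod_list (map x v))"
  using assms(2,3)
proof (induction rule: A.red.induct)
  case (red_refl w)
  then show ?case by (simp add: scal_simps)
next
  note D = diagrammaticD[OF x]
  have ctx: "cong (U * X * V) (scal k * (U * Y * V))" if "X - scal k * Y \<in> J" for U V X Y k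
  proof -
    have "U * (X - scal k * Y) * V \<in> J" using that by (intro J_left J_right)
    moreover have "U * (scal k * Y) * V = scal k * (U * Y * V)"
      by (simp only: mult.assoc scal_left_commute[of U])
    ultimately show ?thesis by (simp add: cong_def algebra_simps)
  qed
  {
    case (red_swap w w'' c w')
    obtain a b u v where w: "w = u @ [a,b] @ v" "w'' = u @ [b,a] @ v" "\<not> A.dep a b"
      using red_swap.hyps(1) by (auto elim: A.swap.cases)
    have "x a * x b - x b * x a \<in> J" using D(2)[of a b] w red_swap.prems by (auto simp: A.dep_def)
    then have "cong (prod_list (map x w)) (prod_list (map x w''))"
      using ctx[of "x a * x b" 1 "x b * x a"] w by (simp add: scal_simps mult.assoc)
    moreover have "set w'' \<subseteq> TLB_gens n" using w red_swap.prems by auto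
    ultimately show ?case using red_swap.IH cong_trans by blast
  next
    case (red_1 u s v c w')
    have "x s * x s - scal (q + 1) * x s \<in> J" using D(1)[of s] red_1.prems by auto
    then have "cong (prod_list (map x (u @ [s,s] @ v))) (scal (q + 1) * prod_list (map x (u @ [s] @ v)))"
      using ctx[of "x s * x s" "q + 1" "x s"] by (simp add: mult.assoc)
    also have "cong \<dots> (scal (q + 1) * (scal c * prod_list (map x w')))"
      using red_1 by (intro cong_mult cong_refl) auto
    finally show ?case by (simp add: scal_simps(4) mult.assoc)
  next
    case (red_3 s t u v c w')
    have "x s * x t * x s - scal q * x s \<in> J" using D(3)[of s t] red_3 by auto
    then have "cong (prod_list (map x (u @ [s,t,s] @ v))) (scal q * prod_list (map x (u @ [s] @ v)))"
      using ctx[of "x s * x t * x s" q "x s"] by (simp add: mult.assoc)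
    also have "cong \<dots> (scal q * (scal c * prod_list (map x w')))"
      using red_3 by (intro cong_mult cong_refl) auto
    finally show ?case by (simp add: scal_simps(4) mult.assoc)
  next
    case (red_4 s t u v c w')
    have "x s * x t * x s * x t - scal (2 * q) * (x s * x t) \<in> J" using D(4)[of s t] red_4 by auto
    then have "cong (prod_list (map x (u @ [s,t,s,t] @ v))) (scal (2 * q) * prod_list (map x (u @ [s,t] @ v)))"
      using ctx[of "x s * x t * x s * x t" "2 * q" "x s * x t"] by (simp add: mult.assoc)
    also have "cong \<dots> (scal (2 * q) * (scal c * prod_list (map x w')))"
      using red_4 by (intro cong_mult cong_refl) auto
    finally show ?case by (simp only: scal_simps(4) mult.assoc)
  }
qed

end

text \<open>With \<open>x a = T\<^sub>a + 1\<close>, the following are \<open>T\<^sub>\<sigma>\<^sub>n\<close>, its inverse, and \<open>Q (T\<^sub>a) + 1\<close>.\<close>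

locale tlb_conjugation = tlb_quotient q n J
  for q :: "'k::comm_ring_1" and n :: nat and J :: "('g fmon \<Rightarrow>\<^sub>0 'k) set" +
  fixes u :: 'k and x :: "gen \<Rightarrow> 'g fmon \<Rightarrow>\<^sub>0 'k"
  assumes uq: "u * q = 1" and diag: "diagrammatic q (Suc n) x"
begin

definition "S = x e - 1"
definition "S' = scal u * (x e - scal q)"
definition "y a = (if a = f then S * (x f' - 1) * S' + 1 else x a)"
definition "z a = (if a = p then x p - x p * x e - scal u * (x e * x p) + x e else x (shift_tee a))"

lemma in_gens_Suc: "a \<in> TLB_gens n \<Longrightarrow> a \<noteq> f \<Longrightarrow> a \<in> TLB_gens (Suc n)"
  by (auto simp: TLB_gens_def)

lemma scal_uq: "scal u * scal q = (1 :: 'g fmon \<Rightarrow>\<^sub>0 'k)" "scal q * scal u = (1 :: 'g fmon \<Rightarrow>\<^sub>0 'k)"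
  "scal u * (scal q * X) = X" "scal q * (scal u * X) = (X :: 'g fmon \<Rightarrow>\<^sub>0 'k)"
proof -
  show 1: "scal u * scal q = (1 :: 'g fmon \<Rightarrow>\<^sub>0 'k)" "scal q * scal u = (1 :: 'g fmon \<Rightarrow>\<^sub>0 'k)"
    by (simp_all only: scal_simps(4)[symmetric] mult.commute[of q u] uq scal_simps(2))
  show "scal u * (scal q * X) = X" "scal q * (scal u * X) = X" by (simp_all add: mult.assoc[symmetric] 1)
qed

lemma scal_past: "x a * scal c = scal c * x a" "x a * (scal c * X) = scal c * (x a * X)"
  by (rule scal_central[symmetric]) (rule scal_left_commute)

text \<open>The product of \<open>x - 1\<close> and \<open>x - q\<close> is x x - (q + 1) x + q, and
  modulo the quadratic relation only q is left; hence the factor \<open>u\<close> in the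
  inverse.\<close>

lemma inverse_cong:
  assumes "a \<in> TLB_gens (Suc n)"
  shows "cong ((x a - 1) * (scal u * (x a - scal q))) 1" "cong ((scal u * (x a - scal q)) * (x a - 1)) 1"
proof -
  have J: "scal u * (x a * x a - scal (q + 1) * x a) \<in> J"
    by (intro J_left diagrammaticD(1)[OF diag assms])
  have "(x a - 1) * (scal u * (x a - scal q)) - 1 = scal u * (x a * x a - scal (q + 1) * x a)"
    "(scal u * (x a - scal q)) * (x a - 1) - 1 = scal u * (x a * x a - scal (q + 1) * x a)"
    by (simp_all add: algebra_simps scal_simps scal_past scal_uq)
  then show "cong ((x a - 1) * (scal u * (x a - scal q))) 1" "cong ((scal u * (x a - scal q)) * (x a - 1)) 1"
    using J by (simp_all only: cong_def)
qed

lemma SS': "cong (S * S') 1" "cong (S' * S) 1"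
  unfolding S_def S'_def using inverse_cong[of e] gens_Suc by auto

text \<open>Here \<open>z p\<close> originates: the product \<open>S' * x p * S\<close> has the same
  terms except that \<open>u\<close> times e p e stands in place of e.\<close>

lemma conj_S_p: "conj_by S S' (x p) (z p)"
proof -
  have "S' * x p * S - z p = scal u * (x e * x p * x e - scal q * x e)"
    by (simp add: S_def S'_def z_def algebra_simps scal_simps scal_past scal_uq)
  moreover have "cox (Suc n) e p = 3" using n3 by (auto simp: cox_def adj3_def)
  ultimately have "cong (S' * x p * S) (z p)"
    using J_left[OF diagrammaticD(3)[OF diag, of e p]] gens_Suc by (simp add: cong_def)
  then show ?thesis using conj_by_iff[OF SS'] by simp
qed

lemma conj_S_f: "conj_by S S' (y f) (x f')"
proof -
  have "y f - S * x f' * S' = - (S * S' - 1)" by (simp add: y_def algebra_simps)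
  then show ?thesis using SS'(1) J_uminus unfolding conj_by_def cong_def by metis
qed

lemma conj_S_other:
  assumes "a \<in> TLB_gens n" "a \<noteq> p" "a \<noteq> f"
  shows "conj_by S S' (x a) (x a)"
proof (rule conj_by_commute[OF _ SS'(1)])
  have "cox (Suc n) e a = 2" using assms n3 by (cases a) (auto simp: cox_def adj3_def adj4_def TLB_gens_def)
  then have "x e * x a - x a * x e \<in> J"
    using diagrammaticD(2)[OF diag, of e a] gens_Suc in_gens_Suc assms by auto
  moreover have "S * x a - x a * S = x e * x a - x a * x e" by (simp add: S_def algebra_simps)
  ultimately show "cong (S * x a) (x a * S)" by (simp add: cong_def)
qed

lemma conj_y_z: "a \<in> TLB_gens n \<Longrightarrow> conj_by S S' (y a) (z a)"
  using conj_S_p conj_S_f conj_S_other[of a] e_neq by (auto simp: y_def z_def shift_tee_def)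

text \<open>The double bond between \<open>p\<close> and the image of \<open>f\<close> is inherited
  from \<open>e\<close> and \<open>f'\<close>. The product of T at \<open>e\<close> and T at
  \<open>p\<close> conjugates \<open>e\<close> into \<open>p\<close> by the braid relation, and
  \<open>f'\<close> into the image of \<open>f\<close> because \<open>f'\<close> commutes with
  \<open>p\<close>.\<close>

lemma conj_pair:
  defines "W \<equiv> S * (x p - 1)" and "W' \<equiv> scal u * (x p - scal q) * S'"
  shows "cong (W' * W) 1" "conj_by W W' (x p) (x e)" "conj_by W W' (y f) (x f')"
proof -
  note RR' = inverse_cong[of p, OF gens_Suc(1)]
  have "W' * W = (scal u * (x p - scal q)) * (S' * S) * (x p - 1)" by (simp add: W_def W'_def mult.assoc)
  also have "cong \<dots> ((scal u * (x p - scal q)) * 1 * (x p - 1))" by (intro cong_mult cong_refl SS')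
  also have "cong \<dots> 1" using RR' by simp
  finally show "cong (W' * W) 1" .
  \<comment> \<open>Conjugating \<open>x e\<close> by T at \<open>p\<close> gives the same
    \<open>z p\<close> as conjugating \<open>x p\<close> by the inverse of T at \<open>e\<close>;
    this is the braid relation.\<close>
  have "(x p - 1) * x e * (scal u * (x p - scal q)) - z p = scal u * (x p * x e * x p - scal q * x p)"
    by (simp add: z_def algebra_simps scal_simps scal_past scal_uq)
  moreover have "cox (Suc n) p e = 3" using n3 by (auto simp: cox_def adj3_def)
  ultimately have "cong ((x p - 1) * x e * (scal u * (x p - scal q))) (z p)"
    using J_left[OF diagrammaticD(3)[OF diag, of p e]] gens_Suc by (simp add: cong_def)
  then have "conj_by (x p - 1) (scal u * (x p - scal q)) (z p) (x e)"
    unfolding conj_by_def by (rule cong_sym)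
  then show "conj_by W W' (x p) (x e)" unfolding W_def W'_def by (rule conj_by_trans[OF conj_S_p])
  have "cox (Suc n) p f' = 2" using n3 by (auto simp: cox_def adj3_def adj4_def)
  then have "x p * x f' - x f' * x p \<in> J" using diagrammaticD(2)[OF diag, of p f'] gens_Suc by auto
  moreover have "(x p - 1) * x f' - x f' * (x p - 1) = x p * x f' - x f' * x p" by (simp add: algebra_simps)
  ultimately have "cong ((x p - 1) * x f') (x f' * (x p - 1))" by (simp add: cong_def)
  then have "conj_by (x p - 1) (scal u * (x p - scal q)) (x f') (x f')"
    by (rule conj_by_commute[OF _ RR'(1)])
  then show "conj_by W W' (y f) (x f')" unfolding W_def W'_def by (rule conj_by_trans[OF conj_S_f])
qed

lemma cox_Suc: "a \<in> TLB_gens n \<Longrightarrow> b \<in> TLB_gens n \<Longrightarrow> a \<noteq> f \<Longrightarrow> b \<noteq> f \<Longrightarrow> cox (Suc n) a b = cox n a b"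
  by (auto simp: cox_def adj3_def adj4_def TLB_gens_def)

lemma cox_f: "a \<in> TLB_gens n \<Longrightarrow> a \<noteq> f \<Longrightarrow> cox n a f = (if a = p then 4 else 2)"
  using n3 by (auto simp: cox_def adj3_def adj4_def TLB_gens_def)

text \<open>This makes the arrow well defined. Every relation involving \<open>f\<close> is a
  conjugate of a relation of the target: by \<open>S\<close> for the square and the commutations, by
  \<open>W\<close> for the double bond.\<close>

lemma diagrammatic_y: "diagrammatic q n y"
proof -
  note D = diagrammaticD[OF diag]
  have square: "y a * y a - scal (q + 1) * y a \<in> J" if "a \<in> TLB_gens n" for a
  proof (cases "a = f")
    case True
    have "conj_by S S' (y f * y f - scal (q + 1) * y f) (x f' * x f' - scal (q + 1) * x f')"
      by (intro conj_by_diff conj_by_mult conj_by_central conj_S_f SS' scal_central)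
    then show ?thesis using conj_by_J D(1)[OF gens_Suc(3)] True by simp
  next
    case False
    then show ?thesis using D(1) in_gens_Suc that by (simp add: y_def)
  qed
  have commute: "y a * y f - y f * y a \<in> J" if "a \<in> TLB_gens n" "a \<noteq> p" "a \<noteq> f" for a
  proof -
    have "conj_by S S' (x a * y f - y f * x a) (x a * x f' - x f' * x a)"
      by (intro conj_by_diff conj_by_mult conj_S_f SS' conj_S_other that)
    moreover have "cox (Suc n) a f' = 2"
      using that e_gens f'_gens by (auto simp: cox_def adj3_def adj4_def TLB_gens_def)
    ultimately show ?thesis using conj_by_J D(2)[OF in_gens_Suc gens_Suc(3)] that by (simp add: y_def)
  qed
  have four: "y p * y f * y p * y f - scal (2 * q) * (y p * y f) \<in> J" "y f * y p * y f * y p - scal (2 * q) * (y f * y p) \<in> J"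
  proof -
    define W W' where "W = S * (x p - 1)" "W' = scal u * (x p - scal q) * S'"
    note C = conj_pair[folded W_W'_def]
    have "conj_by W W' (x p * y f * x p * y f - scal (2 * q) * (x p * y f)) (x e * x f' * x e * x f' - scal (2 * q) * (x e * x f'))"
      "conj_by W W' (y f * x p * y f * x p - scal (2 * q) * (y f * x p)) (x f' * x e * x f' * x e - scal (2 * q) * (x f' * x e))"
      by (intro conj_by_diff conj_by_mult conj_by_central C scal_central)+
    moreover have "cox (Suc n) e f' = 4" "cox (Suc n) f' e = 4" by (auto simp: cox_def adj3_def adj4_def)
    ultimately show "y p * y f * y p * y f - scal (2 * q) * (y p * y f) \<in> J" "y f * y p * y f * y p - scal (2 * q) * (y f * y p) \<in> J"
      using conj_by_J D(4)[OF gens_Suc(2,3)] D(4)[OF gens_Suc(3,2)] e_neq by (simp_all add: y_def)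
  qed
  have "(cox n a b = 2 \<longrightarrow> y a * y b - y b * y a \<in> J) \<and>
      (cox n a b = 3 \<longrightarrow> y a * y b * y a - scal q * y a \<in> J) \<and>
      (cox n a b = 4 \<longrightarrow> y a * y b * y a * y b - scal (2 * q) * (y a * y b) \<in> J)"
    if ab: "a \<in> TLB_gens n" "b \<in> TLB_gens n" for a b
  proof -
    consider "a = f" "b = f" | "a = f" "b \<noteq> f" | "a \<noteq> f" "b = f" | "a \<noteq> f" "b \<noteq> f" by blast
    then show ?thesis
    proof cases
      case 1
      then have "cox n a b = 1" by (simp add: cox_def)
      then show ?thesis by simp
    next
      case 2
      have "y f * y b - y b * y f \<in> J" if "b \<noteq> p" using J_uminus[OF commute[OF ab(2) that 2(2)]] by simp
      moreover have "cox n a b = (if b = p then 4 else 2)" using cox_f[OF ab(2) 2(2)] 2(1) by (simp add: cox_sym)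
      ultimately show ?thesis using four(2) 2(1) by simp
    next
      case 3
      then show ?thesis using four(1) commute[OF ab(1)] cox_f[OF ab(1)] by simp
    next
      case 4
      then show ?thesis
        using D(2,3,4)[OF in_gens_Suc[OF ab(1)] in_gens_Suc[OF ab(2)]] cox_Suc[OF ab] by (simp add: y_def)
    qed
  qed
  then show ?thesis
    unfolding diagrammatic_def using square by simp
qed

end

section \<open>Injectivity on the free algebra\<close>

definition restrict_to :: "'g set \<Rightarrow> 'g \<Rightarrow> ('g fmon \<Rightarrow>\<^sub>0 'k::comm_ring_1)" where
  "restrict_to G g = (if g \<in> G then gvar g else 0)"

text \<open>Pulled back along the retraction onto the free subalgebra on the generators, the defining ideal becomes an ideal of
  the whole free algebra, and congruences modulo it need no carrier conditions.\<close>

definition TLB_ideal_ext :: "'k::comm_ring_1 \<Rightarrow> nat \<Rightarrow> (gen fmon \<Rightarrow>\<^sub>0 'k) set" where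
  "TLB_ideal_ext q N = {P. subst (restrict_to (TLB_gens N)) P \<in> TLB_ideal q N}"

lemma subst_restrict_to: "P \<in> carrier (free_alg G) \<Longrightarrow> subst (restrict_to G) P = P"
  using subst_cong[of P G "restrict_to G" gvar] by (simp add: restrict_to_def subst_gvar_id)

lemma subst_restrict_to_carrier: "subst (restrict_to G) P \<in> carrier (free_alg G)"
  by (rule subst_carrier[OF free_alg_UNIV]) (simp add: restrict_to_def)

lemma TLB_ideal_ext_iff: "P \<in> carrier (free_alg (TLB_gens N)) \<Longrightarrow> P \<in> TLB_ideal_ext q N \<longleftrightarrow> P \<in> TLB_ideal q N"
  by (simp add: TLB_ideal_ext_def subst_restrict_to)

lemma two_sided_TLB_ideal_ext:
  assumes "3 \<le> N"
  shows "two_sided (TLB_ideal_ext q N)"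
proof -
  interpret ideal "TLB_ideal q N" "free_alg (TLB_gens N)" by (rule ideal_TLB_ideal[OF assms])
  have uminus: "- x \<in> TLB_ideal q N" if "x \<in> TLB_ideal q N" for x
    using I_l_closed[OF that, of "- 1"] by simp
  show ?thesis
  proof
    fix x y :: "gen fmon \<Rightarrow>\<^sub>0 'a"
    show "0 \<in> TLB_ideal_ext q N" using additive_subgroup.zero_closed[OF is_additive_subgroup] by (simp add: TLB_ideal_ext_def)
    show "x \<in> TLB_ideal_ext q N \<Longrightarrow> y \<in> TLB_ideal_ext q N \<Longrightarrow> x + y \<in> TLB_ideal_ext q N"
      using additive_subgroup.a_closed[OF is_additive_subgroup] by (simp add: TLB_ideal_ext_def)
    show "x \<in> TLB_ideal_ext q N \<Longrightarrow> - x \<in> TLB_ideal_ext q N"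
      using uminus by (simp add: TLB_ideal_ext_def)
    show "y \<in> TLB_ideal_ext q N \<Longrightarrow> x * y \<in> TLB_ideal_ext q N"
      using I_l_closed[OF _ subst_restrict_to_carrier] by (simp add: TLB_ideal_ext_def)
    show "x \<in> TLB_ideal_ext q N \<Longrightarrow> x * y \<in> TLB_ideal_ext q N"
      using I_r_closed[OF _ subst_restrict_to_carrier] by (simp add: TLB_ideal_ext_def)
  qed
qed

lemma diagrammatic_TLB_ideal_ext:
  assumes "3 \<le> N"
  shows "two_sided_alg.diagrammatic (TLB_ideal_ext q N) q N (\<lambda>a. gvar a + 1)"
proof -
  interpret two_sided_alg "TLB_ideal_ext q N"
    using two_sided_TLB_ideal_ext[OF assms] by (simp add: two_sided_alg_def)
  show ?thesis
  proof (rule rels_diagrammatic[OF assms])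
    fix P assume P: "P \<in> TLB_rels q N"
    have "P \<in> TLB_ideal q N"
      unfolding TLB_ideal_def using ring.genideal_self[OF ring_free_alg TLB_rels_carrier[OF assms]] P by blast
    moreover have "P \<in> carrier (free_alg (TLB_gens N))" using TLB_rels_carrier[OF assms] P by blast
    moreover have "subst (\<lambda>a. gvar a + 1 - 1) P = P" by (simp add: subst_gvar_id)
    ultimately show "subst (\<lambda>a. gvar a + 1 - 1) P \<in> TLB_ideal_ext q N" by (simp only: TLB_ideal_ext_iff)
  qed
qed

context tlb_pair begin

lemma diagrammatic_annihilator: "two_sided_alg.diagrammatic (annihilator (B.coeff_of \<mu>)) q (Suc n) gvar"
proof -
  interpret two_sided_alg "annihilator (B.coeff_of \<mu>)"
    using two_sided_annihilator by (simp add: two_sided_alg_def)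
  show ?thesis
    unfolding diagrammatic_def
    using B.red_annihilator[OF B.red_basic(1), of _ _ \<mu>] B.red_annihilator[OF B.red_basic(2), of _ \<mu>]
      B.red_annihilator[OF B.red_basic(3), of _ _ \<mu>] B.red_annihilator[OF B.red_basic(4), of _ _ \<mu>]
    by (simp add: wmon_Cons scal_simps(2) mult.assoc)
qed

text \<open>Equivalent words define the same predicate \<open>A.comm_eq w\<close>, so the chosen
  representative depends only on the class.\<close>

definition canon :: "gen list \<Rightarrow> gen list" where
  "canon w = (SOME v. A.comm_eq w v)"

lemma comm_eq_canon: "A.comm_eq w (canon w)"
  unfolding canon_def by (rule someI[of _ w]) simp

lemma canon_eq:
  assumes "A.comm_eq v w"
  shows "canon v = canon w"
proof -
  have "A.comm_eq v = A.comm_eq w"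
    using A.comm_eq_sym[OF assms] assms by (auto intro!: ext intro: rtranclp_trans)
  then show ?thesis by (simp add: canon_def)
qed

text \<open>The prefix \<open>v\<close> collects the letters chosen so far, which is why the claim
  has to be general in it.\<close>

lemma expansion_functional:
  assumes z: "\<And>a. z a = (if a = p then gvar p - gvar p * gvar e - scal u * (gvar e * gvar p) + gvar e else gvar (shift_tee a))"
  shows "functional h (wmon v * prod_list (map z w)) = expansion u w (\<lambda>v'. h (v @ v'))"
proof (induction w arbitrary: v)
  case (Cons a w)
  have z: "z a = (if a = p then wmon [p] - wmon [p, e] - scal u * wmon [e, p] + wmon [e] else wmon [shift_tee a])"
    by (simp add: z wmon_Cons)
  show ?case
  proof (cases "a = p")
    case True
    have "wmon v * ((wmon [p] - wmon [p, e] - scal u * wmon [e, p] + wmon [e]) * Z) =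
      wmon (v @ [p]) * Z - wmon (v @ [p, e]) * Z - scal u * (wmon (v @ [e, p]) * Z) + wmon (v @ [e]) * Z" for Z
      unfolding wmon_append[of v] by (simp add: algebra_simps scal_left_commute[of "wmon v"])
    then show ?thesis using z True Cons.IH by simp
  next
    case False
    then show ?thesis using Cons.IH[of "v @ [shift_tee a]"] by (simp add: z wmon_append mult.assoc)
  qed
qed simp

end

section \<open>Spanning by canonical irreducible words\<close>

context tlb_quotient begin

text \<open>Canonical representatives make the words of the combination pairwise inequivalent;
  without this the functional of one leading word could not isolate a single coefficient.\<close>

lemma spanning:
  assumes x: "diagrammatic q n x" and P: "P \<in> carrier (free_alg (TLB_gens n))"
  shows "\<exists>c. finite {w. c w \<noteq> 0} \<and> (\<forall>w. c w \<noteq> 0 \<longrightarrow> A.irred w \<and> set w \<subseteq> TLB_gens n \<and> canon w = w) \<and>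
    cong (subst x P) (\<Sum>w | c w \<noteq> 0. scal (c w) * prod_list (map x w))"
  using P
proof (induction P rule: free_alg_induct)
  case (wmon k w)
  obtain c v where v: "A.red w c v" "A.irred v" using A.red_irred_exists by blast
  let ?v = "canon v"
  have red: "A.red w c ?v" using A.red_comm_eq_right[OF v(1) comm_eq_canon] .
  have gens: "set ?v \<subseteq> TLB_gens n" using A.red_mset[OF red] wmon set_mset_mono by fastforce
  have irred: "A.irred ?v" using A.comm_eq_irred[OF comm_eq_canon] v(2) by blast
  have canon: "canon ?v = ?v" using canon_eq[OF comm_eq_canon[of v]] by simp
  let ?c = "\<lambda>w'. if w' = ?v then k * c else 0"
  have "cong (scal k * prod_list (map x w)) (scal k * (scal c * prod_list (map x ?v)))"
    by (intro cong_mult cong_refl red_cong x red wmon)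
  also have "scal k * (scal c * prod_list (map x ?v)) = (\<Sum>w' | ?c w' \<noteq> 0. scal (?c w') * prod_list (map x w'))"
  proof (cases "k * c = 0")
    case True
    then show ?thesis by (simp add: mult.assoc[symmetric] scal_simps(4)[symmetric] scal_simps(1))
  next
    case False
    then have "{w'. ?c w' \<noteq> 0} = {?v}" by auto
    then show ?thesis by (simp add: scal_simps(4) mult.assoc)
  qed
  finally have "cong (subst x (scal k * wmon w)) (\<Sum>w' | ?c w' \<noteq> 0. scal (?c w') * prod_list (map x w'))"
    by (simp only: subst_wmon)
  moreover have "finite {w'. ?c w' \<noteq> 0}" by simp
  moreover have "\<forall>w'. ?c w' \<noteq> 0 \<longrightarrow> A.irred w' \<and> set w' \<subseteq> TLB_gens n \<and> canon w' = w'"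
    using gens irred canon by simp
  ultimately show ?case by (intro exI[of _ ?c] conjI)
next
  case (add P R)
  from add(3) obtain a where a: "finite {w. a w \<noteq> 0}" "\<forall>w. a w \<noteq> 0 \<longrightarrow> A.irred w \<and> set w \<subseteq> TLB_gens n \<and> canon w = w"
    "cong (subst x P) (\<Sum>w | a w \<noteq> 0. scal (a w) * prod_list (map x w))" by blast
  from add(4) obtain b where b: "finite {w. b w \<noteq> 0}" "\<forall>w. b w \<noteq> 0 \<longrightarrow> A.irred w \<and> set w \<subseteq> TLB_gens n \<and> canon w = w"
    "cong (subst x R) (\<Sum>w | b w \<noteq> 0. scal (b w) * prod_list (map x w))" by blast
  let ?c = "\<lambda>w. a w + b w" and ?W = "{w. a w \<noteq> 0} \<union> {w. b w \<noteq> 0}"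
  have ext: "(\<Sum>w | g w \<noteq> 0. scal (g w) * prod_list (map x w)) = (\<Sum>w\<in>?W. scal (g w) * prod_list (map x w))"
    if "{w. g w \<noteq> 0} \<subseteq> ?W" for g
    using that a(1) b(1) by (intro sum.mono_neutral_left) (auto simp: scal_simps(1))
  have sub: "{w. ?c w \<noteq> 0} \<subseteq> ?W" by auto
  have "cong (subst x (P + R)) (\<Sum>w | ?c w \<noteq> 0. scal (?c w) * prod_list (map x w))"
    using cong_add[OF a(3) b(3)] ext[of a] ext[of b] ext[OF sub]
    by (simp add: scal_simps(3) distrib_right sum.distrib)
  moreover have "finite {w. ?c w \<noteq> 0}" using finite_subset[OF sub] a(1) b(1) by simp
  moreover have "\<forall>w. ?c w \<noteq> 0 \<longrightarrow> A.irred w \<and> set w \<subseteq> TLB_gens n \<and> canon w = w"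
    using a(2) b(2) sub by blast
  ultimately show ?case by (intro exI[of _ ?c] conjI)
qed

end

lemma functional_sum: "functional h (\<Sum>i\<in>I. P i) = (\<Sum>i\<in>I. functional h (P i))"
  by (induction I rule: infinite_finite_induct) simp_all

lemma subst_sum: "subst \<phi> (\<Sum>i\<in>I. P i) = (\<Sum>i\<in>I. subst \<phi> (P i))"
  by (induction I rule: infinite_finite_induct) simp_all

lemma subst_prod_list: "subst \<phi> (prod_list xs) = prod_list (map (subst \<phi>) xs)"
  by (induction xs) simp_all

section \<open>The arrow on the free algebras\<close>

context tlb_pair begin

text \<open>The variables stand for the T here, and the last factor is the inverse of T at
  \<open>e\<close>, obtained from T T = (q - 1) T + q.\<close>

definition sigma_Q :: "'k \<Rightarrow> gen \<Rightarrow> gen fmon \<Rightarrow>\<^sub>0 'k" where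
  "sigma_Q u a = (if a = f then gvar e * gvar f' * (scal u * (gvar e - scal (q - 1))) else gvar a)"

lemma sigma_Q_carrier: "a \<in> TLB_gens n \<Longrightarrow> sigma_Q u a \<in> carrier (free_alg (TLB_gens (Suc n)))"
  using gens_Suc by (auto simp: sigma_Q_def TLB_gens_def intro!: free_alg_closed)

lemma subst_sigma_Q_carrier: "P \<in> carrier (free_alg (TLB_gens n)) \<Longrightarrow> subst (sigma_Q u) P \<in> carrier (free_alg (TLB_gens (Suc n)))"
  by (erule subst_carrier) (rule sigma_Q_carrier)

lemma tlb_conjugation_ext:
  assumes "u * q = 1"
  shows "tlb_conjugation q n (TLB_ideal_ext q (Suc n)) u (\<lambda>a. gvar a + 1)"
proof -
  have N: "3 \<le> Suc n" using n3 by simp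
  show ?thesis
    using two_sided_TLB_ideal_ext[OF N, of q] diagrammatic_TLB_ideal_ext[OF N, of q] assms tlb_pair_axioms
    by (simp add: tlb_conjugation_def tlb_conjugation_axioms_def tlb_quotient_def two_sided_alg_def)
qed

lemma tlb_conjugation_annihilator:
  assumes "u * q = 1"
  shows "tlb_conjugation q n (annihilator (B.coeff_of \<mu>)) u gvar"
  using two_sided_annihilator[of "B.coeff_of \<mu>"] diagrammatic_annihilator[of \<mu>] assms tlb_pair_axioms
  by (simp add: tlb_conjugation_def tlb_conjugation_axioms_def tlb_quotient_def two_sided_alg_def)

lemma sigma_Q_ideal:
  assumes uq: "u * q = 1" and P: "P \<in> TLB_ideal q n" "P \<in> carrier (free_alg (TLB_gens n))"
  shows "subst (sigma_Q u) P \<in> TLB_ideal q (Suc n)"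
proof -
  interpret C: tlb_conjugation q n "TLB_ideal_ext q (Suc n)" u "\<lambda>a. gvar a + 1"
    by (rule tlb_conjugation_ext[OF uq])
  have "C.y a - 1 = sigma_Q u a" for a
    unfolding C.y_def C.S_def C.S'_def sigma_Q_def by (simp add: scal_simps algebra_simps)
  then have "subst (sigma_Q u) P \<in> TLB_ideal_ext q (Suc n)"
    using C.TLB_ideal_subst[OF n3 C.diagrammatic_y P(1)] by simp
  then show ?thesis using TLB_ideal_ext_iff subst_sigma_Q_carrier[OF P(2)] by blast
qed

lemma sigma_Q_injective:
  assumes uq: "u * q = 1" and P: "P \<in> carrier (free_alg (TLB_gens n))" and sP: "subst (sigma_Q u) P \<in> TLB_ideal q (Suc n)"
  shows "P \<in> TLB_ideal q n"
proof -
  interpret U: tlb_quotient q n "TLB_ideal_ext q n"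
    using two_sided_TLB_ideal_ext[OF n3, of q] tlb_pair_axioms by (simp add: tlb_quotient_def two_sided_alg_def)
  let ?x = "\<lambda>a. gvar a + 1 :: gen fmon \<Rightarrow>\<^sub>0 'k"
  \<comment> \<open>\<open>P\<close> is written in the variables T; \<open>?P'\<close> is the same
    element written in T + 1, where the reductions apply.\<close>
  let ?P' = "subst (\<lambda>a. gvar a - 1) P"
  have "?P' \<in> carrier (free_alg (TLB_gens n))" by (rule subst_carrier[OF P]) auto
  from U.spanning[OF diagrammatic_TLB_ideal_ext[OF n3] this]
  obtain c where c: "finite {w. c w \<noteq> 0}"
    "\<And>w. c w \<noteq> 0 \<Longrightarrow> A.irred w \<and> set w \<subseteq> TLB_gens n \<and> canon w = w"
    "U.cong (subst ?x ?P') (\<Sum>w | c w \<noteq> 0. scal (c w) * prod_list (map ?x w))" by blast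
  define W R where "W = {w. c w \<noteq> 0}" and "R = (\<Sum>w\<in>W. scal (c w) * prod_list (map ?x w))"
  have xP': "subst ?x ?P' = P" by (simp add: subst_subst subst_gvar_id)
  have "scal (c w) * prod_list (map ?x w) \<in> carrier (free_alg (TLB_gens n))" if "w \<in> W" for w
  proof -
    have "set w \<subseteq> TLB_gens n" using c(2) that by (simp add: W_def)
    then show ?thesis by (intro free_alg_closed free_alg_prod_list) auto
  qed
  then have R: "R \<in> carrier (free_alg (TLB_gens n))"
    unfolding R_def by (induction W rule: infinite_finite_induct) auto
  have "P - R \<in> TLB_ideal_ext q n" using c(3) unfolding xP' R_def W_def U.cong_def .
  then have PR: "P - R \<in> TLB_ideal q n" using TLB_ideal_ext_iff free_alg_diff[OF P R] by blast
  show ?thesis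
  proof (cases "W = {}")
    case True
    then show ?thesis using PR by (simp add: R_def)
  next
    case False
    have finW: "finite W" using c(1) by (simp add: W_def)
    \<comment> \<open>A word of maximal length, as \<open>expansion_coeff\<close> compares only with
      words that are not longer.\<close>
    have "Max (length ` W) \<in> length ` W" using False finW by (intro Max_in) auto
    then obtain w0 where "w0 \<in> W" "length w0 = Max (length ` W)" by auto
    then have w0: "w0 \<in> W" "\<And>w. w \<in> W \<Longrightarrow> length w \<le> length w0" using finW by auto
    obtain d where d: "map fst d = w0" "marked d" "B.irred (lead_word d)"
      using irred_has_leading[of w0] c(2)[of w0] w0(1) by (auto simp: W_def)
    let ?g = "B.coeff_of (lead_word d)"
    \<comment> \<open>In this instance a variable stands for T + 1, and the substitution of
      \<open>gvar a - 1\<close> translates from the variables T.\<close>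
    interpret C: tlb_conjugation q n "annihilator ?g" u gvar by (rule tlb_conjugation_annihilator[OF uq])
    have y: "subst (\<lambda>a. gvar a - 1) (subst (sigma_Q u) (gvar a + 1)) = C.y a" for a
      unfolding C.y_def C.S_def C.S'_def sigma_Q_def by (simp add: scal_simps algebra_simps)
    have gens: "3 \<le> Suc n" using n3 by simp
    have "subst (\<lambda>a. gvar a - 1) (subst (sigma_Q u) P) - subst (\<lambda>a. gvar a - 1) (subst (sigma_Q u) (P - R)) \<in> annihilator ?g"
      by (intro C.J_diff C.TLB_ideal_subst[OF gens C.diag] sP sigma_Q_ideal[OF uq PR] free_alg_diff P R)
    then have "subst (\<lambda>a. gvar a - 1) (subst (sigma_Q u) R) \<in> annihilator ?g" by simp
    moreover have "subst (\<lambda>a. gvar a - 1) (subst (sigma_Q u) R) = (\<Sum>w\<in>W. scal (c w) * prod_list (map C.y w))"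
      unfolding R_def subst_sum subst_mult subst_scal subst_prod_list map_map o_def y ..
    \<comment> \<open>Undoing the conjugation replaces the images \<open>C.y\<close> by the simpler
      \<open>C.z\<close>, whose monomials are computed by \<open>expansion\<close>.\<close>
    ultimately have "C.S' * (\<Sum>w\<in>W. scal (c w) * prod_list (map C.y w)) * C.S \<in> annihilator ?g"
      by (intro C.J_left C.J_right) simp
    moreover have "C.cong (C.S' * (\<Sum>w\<in>W. scal (c w) * prod_list (map C.y w)) * C.S) (\<Sum>w\<in>W. scal (c w) * prod_list (map C.z w))"
    proof -
      have "C.cong (C.S' * (scal (c w) * prod_list (map C.y w)) * C.S) (scal (c w) * prod_list (map C.z w))" if "w \<in> W" for w
      proof -
        have "C.conj_by C.S C.S' (prod_list (map C.y w)) (prod_list (map C.z w))"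
          using c(2)[of w] that by (intro C.conj_by_prod_list C.SS' C.conj_y_z) (auto simp: W_def)
        then have "C.conj_by C.S C.S' (scal (c w) * prod_list (map C.y w)) (scal (c w) * prod_list (map C.z w))"
          by (rule C.conj_by_central) (rule scal_central)
        then show ?thesis using C.conj_by_iff[OF C.SS'] by blast
      qed
      then show ?thesis unfolding sum_distrib_left sum_distrib_right by (rule C.cong_sum)
    qed
    ultimately have "(\<Sum>w\<in>W. scal (c w) * prod_list (map C.z w)) \<in> annihilator ?g" using C.cong_J by blast
    then have "0 = (\<Sum>w\<in>W. c w * functional ?g (prod_list (map C.z w)))"
      using annihilator_functional by (fastforce simp: functional_sum)
    also have "\<dots> = (\<Sum>w\<in>W. c w * expansion u w ?g)"
      using expansion_functional[OF C.z_def, of ?g "[]"] by simp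
    also have "\<dots> = (\<Sum>w\<in>W. if w = w0 then c w * expansion u w ?g else 0)"
    proof (rule sum.cong[OF refl])
      fix w assume w: "w \<in> W"
      have gens: "set w0 \<subseteq> TLB_gens n" "set w \<subseteq> TLB_gens n" "canon w = w" "canon w0 = w0"
        using c(2)[of w] c(2)[of w0] w w0(1) by (auto simp: W_def)
      have "expansion u w ?g = 0" if "w \<noteq> w0"
      proof (rule expansion_coeff(1)[OF d(1,2) gens(1,2) w0(2)[OF w]])
        show "\<not> A.comm_eq w w0" using canon_eq[of w w0] gens that by auto
      qed
      then show "c w * expansion u w ?g = (if w = w0 then c w * expansion u w ?g else 0)" by simp
    qed
    also have "\<dots> = c w0 * expansion u w0 ?g" using w0(1) finW by simp
    finally have "c w0 * expansion u w0 ?g = 0" by simp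
    moreover obtain k k' where "k * k' = 1" "expansion u w0 ?g = k"
      using expansion_coeff(2)[OF d(1,2) _ _ _ uq d(3) refl] c(2)[of w0] w0(1) by (auto simp: W_def)
    ultimately have "c w0 = 0" by (metis mult.assoc mult.right_neutral mult_zero_left)
    then show ?thesis using w0(1) by (simp add: W_def)
  qed
qed

end

section \<open>Injectivity on the quotients\<close>

definition TLB_class :: "'k::comm_ring_1 \<Rightarrow> nat \<Rightarrow> (gen fmon \<Rightarrow>\<^sub>0 'k) \<Rightarrow> (gen fmon \<Rightarrow>\<^sub>0 'k) set" where
  "TLB_class q N P = TLB_ideal q N +>\<^bsub>free_alg (TLB_gens N)\<^esub> P"

lemma wmon_carrier: "set w \<subseteq> G \<Longrightarrow> wmon w \<in> carrier (free_alg G)"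
  by (simp add: wmon_def free_alg_carrier)

lemma free_alg_minus:
  assumes "x \<in> carrier (free_alg G)" "y \<in> carrier (free_alg G)"
  shows "x \<ominus>\<^bsub>free_alg G\<^esub> y = x - y"
proof -
  interpret R: Ring.ring "free_alg G" by (rule ring_free_alg)
  have "\<ominus>\<^bsub>free_alg G\<^esub> y = - y" using R.minus_equality[of "- y" y] assms by simp
  then show ?thesis by (simp add: a_minus_def)
qed

context
  fixes N :: nat
  assumes N: "3 \<le> N"
begin

lemma TLB_class_eq:
  assumes "P \<in> carrier (free_alg (TLB_gens N))" "R \<in> carrier (free_alg (TLB_gens N))"
  shows "TLB_class q N P = TLB_class q N R \<longleftrightarrow> P - R \<in> TLB_ideal q N"
  using ring.quotient_eq_iff_same_a_r_cos[OF ring_free_alg ideal_TLB_ideal[OF N] assms, of q] free_alg_minus[OF assms]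
  by (simp add: TLB_class_def)

lemma TLB_class_hom: "TLB_class q N \<in> ring_hom (free_alg (TLB_gens N)) (TLB q N)"
proof -
  have "TLB_class q N = (+>\<^bsub>free_alg (TLB_gens N)\<^esub>) (TLB_ideal q N)" by (rule ext) (simp add: TLB_class_def)
  then show ?thesis using ideal.rcos_ring_hom[OF ideal_TLB_ideal[OF N], of q] by (simp add: TLB_def)
qed

lemma TLB_class_closed: "P \<in> carrier (free_alg (TLB_gens N)) \<Longrightarrow> TLB_class q N P \<in> carrier (TLB q N)"
  by (rule ring_hom_closed[OF TLB_class_hom])

lemma TLB_class_mult: "P \<in> carrier (free_alg (TLB_gens N)) \<Longrightarrow> R \<in> carrier (free_alg (TLB_gens N)) \<Longrightarrow>
    TLB_class q N P \<otimes>\<^bsub>TLB q N\<^esub> TLB_class q N R = TLB_class q N (P * R)"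
  using ring_hom_mult[OF TLB_class_hom, of P R q] by simp

lemma TLB_class_add: "P \<in> carrier (free_alg (TLB_gens N)) \<Longrightarrow> R \<in> carrier (free_alg (TLB_gens N)) \<Longrightarrow>
    TLB_class q N P \<oplus>\<^bsub>TLB q N\<^esub> TLB_class q N R = TLB_class q N (P + R)"
  using ring_hom_add[OF TLB_class_hom, of P R q] by simp

lemma TLB_class_one: "\<one>\<^bsub>TLB q N\<^esub> = TLB_class q N 1"
  using ring_hom_one[OF TLB_class_hom, of q] by simp

lemma TLB_class_surj:
  assumes "X \<in> carrier (TLB q N)"
  obtains P where "P \<in> carrier (free_alg (TLB_gens N))" "X = TLB_class q N P"
  using assms unfolding TLB_def FactRing_def TLB_class_def A_RCOSETS_def' by auto

lemma TLB_inv_gen: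
  assumes "u * q = 1" "a \<in> TLB_gens N"
  shows "inv\<^bsub>TLB q N\<^esub> TLB_gen q N a = TLB_class q N (scal u * (gvar a - scal (q - 1)))"
proof -
  let ?s = "scal u * (gvar a - scal (q - 1)) :: gen fmon \<Rightarrow>\<^sub>0 'a"
  let ?r = "gvar a * gvar a - (scal (q - 1) * gvar a + scal q)"
  have "?r \<in> TLB_rels q N" using assms(2) unfolding TLB_rels_def Let_def by blast
  then have "?r \<in> TLB_ideal q N"
    unfolding TLB_ideal_def using ring.genideal_self[OF ring_free_alg TLB_rels_carrier[OF N]] by blast
  then have "scal u * ?r \<in> TLB_ideal q N"
    using ideal.I_l_closed[OF ideal_TLB_ideal[OF N], of ?r q "scal u"] by simp
  moreover have "scal u * scal q = (1 :: gen fmon \<Rightarrow>\<^sub>0 'a)"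
    by (simp only: scal_simps(4)[symmetric] assms(1) scal_simps(2))
  then have "?s * gvar a - 1 = scal u * ?r" by (simp add: algebra_simps)
  moreover have "gvar a * ?s = ?s * gvar a"
  proof -
    have "gvar a * ?s = scal u * (gvar a * (gvar a - scal (q - 1)))" by (rule scal_left_commute)
    also have "gvar a * (gvar a - scal (q - 1)) = (gvar a - scal (q - 1)) * gvar a"
      by (simp add: right_diff_distrib left_diff_distrib scal_central)
    finally show ?thesis by (simp only: mult.assoc)
  qed
  moreover have s: "?s \<in> carrier (free_alg (TLB_gens N))" "gvar a \<in> carrier (free_alg (TLB_gens N) :: (gen fmon \<Rightarrow>\<^sub>0 'a) ring)"
    using assms(2) by simp_all
  ultimately have "TLB_class q N (gvar a * ?s) = TLB_class q N 1" "TLB_class q N (?s * gvar a) = TLB_class q N 1"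
    by (simp_all add: TLB_class_eq)
  then have "TLB_class q N (gvar a) \<otimes>\<^bsub>TLB q N\<^esub> TLB_class q N ?s = \<one>\<^bsub>TLB q N\<^esub>"
    "TLB_class q N ?s \<otimes>\<^bsub>TLB q N\<^esub> TLB_class q N (gvar a) = \<one>\<^bsub>TLB q N\<^esub>"
    by (simp_all only: TLB_class_mult s TLB_class_one)
  then have "inv\<^bsub>TLB q N\<^esub> TLB_class q N (gvar a) = TLB_class q N ?s"
    by (intro monoid.inv_char[OF ring.is_monoid[OF ring_TLB[OF N]]] TLB_class_closed s)
  then show ?thesis by (simp add: TLB_gen_def TLB_class_def)
qed

lemma inj_TLB_unit: "inj (TLB_unit q N)"
  \<comment> \<open>\<open>T \<mapsto> - 1\<close> defines a character.\<close>
proof (rule injI)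
  fix c c' assume "TLB_unit q N c = TLB_unit q N c'"
  then have "TLB_class q N (scal c) = TLB_class q N (scal c')" by (simp add: TLB_class_def TLB_unit_def)
  then have I: "scal (c - c') \<in> TLB_ideal q N" by (simp add: TLB_class_eq scal_simps)
  interpret two_sided_alg "{0 :: gen fmon \<Rightarrow>\<^sub>0 'a}" by standard auto
  have "diagrammatic q N (\<lambda>a. 0)" by (simp add: diagrammatic_def)
  from TLB_ideal_subst[OF N this I] have "scal (c - c') = (0 :: gen fmon \<Rightarrow>\<^sub>0 'a)" by simp
  then have "c - c' = 0" unfolding scal_def by (metis single_zero lookup_single_eq)
  then show "c = c'" by simp
qed

end

section \<open>Arrows between the quotients\<close>

context tlb_pair begin

text \<open>A ring morphism that respects scalars is determined by its values on the generators, so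
  every arrow is the one induced by \<open>sigma_Q\<close>.\<close>

lemma arrow_class:
  assumes u: "u * q = 1" and Q: "TLB_arrow q n Q" and P: "P \<in> carrier (free_alg (TLB_gens n))"
  shows "Q (TLB_class q n P) = TLB_class q (Suc n) (subst (sigma_Q u) P)"
proof -
  have N: "3 \<le> Suc n" using n3 by simp
  note hom = Q[unfolded TLB_arrow_def, THEN conjunct1]
  have unit: "Q (TLB_class q n (scal c)) = TLB_class q (Suc n) (scal c)" for c
    using Q by (simp add: TLB_arrow_def TLB_unit_def TLB_class_def)
  have gen: "Q (TLB_class q n (gvar a)) = TLB_class q (Suc n) (sigma_Q u a)" if a: "a \<in> TLB_gens n" for a
  proof (cases "a = f")
    case True
    have "Q (TLB_class q n (gvar f)) = TLB_gen q (Suc n) e \<otimes>\<^bsub>TLB q (Suc n)\<^esub> TLB_gen q (Suc n) f'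
        \<otimes>\<^bsub>TLB q (Suc n)\<^esub> inv\<^bsub>TLB q (Suc n)\<^esub> TLB_gen q (Suc n) e"
      using Q by (simp add: TLB_arrow_def TLB_gen_def TLB_class_def)
    also have "\<dots> = TLB_class q (Suc n) (gvar e * gvar f' * (scal u * (gvar e - scal (q - 1))))"
      unfolding TLB_inv_gen[OF N u gens_Suc(2)] unfolding TLB_gen_def TLB_class_def[symmetric]
      using gens_Suc by (simp add: TLB_class_mult[OF N])
    finally show ?thesis using True by (simp add: sigma_Q_def)
  next
    case False
    then have "a = SigmaBar \<or> (\<exists>i. a = Sigma i \<and> 1 \<le> i \<and> i \<le> n - 1)" using a by (auto simp: TLB_gens_def)
    then show ?thesis using Q False by (auto simp: TLB_arrow_def TLB_gen_def TLB_class_def sigma_Q_def)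
  qed
  have word: "Q (TLB_class q n (wmon w)) = TLB_class q (Suc n) (subst (sigma_Q u) (wmon w))"
    if "set w \<subseteq> TLB_gens n" for w
    using that
  proof (induction w)
    case Nil
    show ?case using unit[of 1] by (simp add: scal_simps(2))
  next
    case (Cons a w)
    then have c: "gvar a \<in> carrier (free_alg (TLB_gens n) :: (gen fmon \<Rightarrow>\<^sub>0 'k) ring)" "wmon w \<in> carrier (free_alg (TLB_gens n) :: (gen fmon \<Rightarrow>\<^sub>0 'k) ring)"
      by (simp_all add: wmon_carrier)
    have "Q (TLB_class q n (wmon (a # w))) = Q (TLB_class q n (gvar a)) \<otimes>\<^bsub>TLB q (Suc n)\<^esub> Q (TLB_class q n (wmon w))"
      unfolding wmon_Cons TLB_class_mult[OF n3 c, symmetric]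
      using ring_hom_mult[OF hom TLB_class_closed[OF n3 c(1)] TLB_class_closed[OF n3 c(2)]] by simp
    also have "\<dots> = TLB_class q (Suc n) (sigma_Q u a * subst (sigma_Q u) (wmon w))"
      using Cons gen sigma_Q_carrier subst_sigma_Q_carrier[OF c(2)] by (simp only: TLB_class_mult[OF N] list.set insert_subset simp_thms)
    finally show ?case using c by (simp add: wmon_Cons)
  qed
  show ?thesis
    using P
  proof (induction P rule: free_alg_induct)
    case (wmon k w)
    have c: "scal k \<in> carrier (free_alg (TLB_gens n))" "wmon w \<in> carrier (free_alg (TLB_gens n) :: (gen fmon \<Rightarrow>\<^sub>0 'k) ring)"
      using wmon by (simp_all add: wmon_carrier)
    have "Q (TLB_class q n (scal k * wmon w)) = Q (TLB_class q n (scal k)) \<otimes>\<^bsub>TLB q (Suc n)\<^esub> Q (TLB_class q n (wmon w))"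
      unfolding TLB_class_mult[OF n3 c, symmetric]
      using ring_hom_mult[OF hom TLB_class_closed[OF n3 c(1)] TLB_class_closed[OF n3 c(2)]] by simp
    also have "\<dots> = TLB_class q (Suc n) (scal k * subst (sigma_Q u) (wmon w))"
      using word[OF wmon] unit subst_sigma_Q_carrier[OF c(2), of u] by (simp only: TLB_class_mult[OF N] free_alg_consts)
    finally show ?case by (simp only: subst_mult subst_scal)
  next
    case (add P R)
    have "Q (TLB_class q n (P + R)) = Q (TLB_class q n P) \<oplus>\<^bsub>TLB q (Suc n)\<^esub> Q (TLB_class q n R)"
      unfolding TLB_class_add[OF n3 add(1,2), symmetric]
      using ring_hom_add[OF hom TLB_class_closed[OF n3 add(1)] TLB_class_closed[OF n3 add(2)]] by simp
    also have "\<dots> = TLB_class q (Suc n) (subst (sigma_Q u) P + subst (sigma_Q u) R)"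
      unfolding add(3,4) by (intro TLB_class_add[OF N] subst_sigma_Q_carrier add)
    finally show ?case by simp
  qed
qed

lemma arrow_inj:
  assumes u: "u * q = 1" and Q: "TLB_arrow q n Q"
  shows "inj_on Q (carrier (TLB q n))"
proof (rule inj_onI)
  have N: "3 \<le> Suc n" using n3 by simp
  fix X Y assume X: "X \<in> carrier (TLB q n)" and Y: "Y \<in> carrier (TLB q n)" and eq: "Q X = Q Y"
  obtain P where P: "P \<in> carrier (free_alg (TLB_gens n))" "X = TLB_class q n P" by (rule TLB_class_surj[OF n3 X])
  obtain R where R: "R \<in> carrier (free_alg (TLB_gens n))" "Y = TLB_class q n R" by (rule TLB_class_surj[OF n3 Y])
  have "subst (sigma_Q u) P - subst (sigma_Q u) R \<in> TLB_ideal q (Suc n)"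
    using eq arrow_class[OF u Q] P R TLB_class_eq[OF N] subst_sigma_Q_carrier by metis
  then have "P - R \<in> TLB_ideal q n" using sigma_Q_injective[OF u free_alg_diff[OF P(1) R(1)]] by simp
  then show "X = Y" using TLB_class_eq[OF n3] P R by blast
qed

text \<open>The morphism is computed on an arbitrary representative; by \<open>sigma_Q_ideal\<close>
  the result does not depend on it.\<close>

lemma arrow_exists:
  assumes u: "u * q = 1"
  shows "\<exists>Q. TLB_arrow q n Q"
proof -
  have N: "3 \<le> Suc n" using n3 by simp
  define Q where "Q X = TLB_class q (Suc n) (subst (sigma_Q u) (SOME P. P \<in> carrier (free_alg (TLB_gens n)) \<and> X = TLB_class q n P))" for X
  have Q: "Q (TLB_class q n P) = TLB_class q (Suc n) (subst (sigma_Q u) P)" if P: "P \<in> carrier (free_alg (TLB_gens n))" for P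
  proof -
    define R where "R = (SOME R. R \<in> carrier (free_alg (TLB_gens n)) \<and> TLB_class q n P = TLB_class q n R)"
    have R: "R \<in> carrier (free_alg (TLB_gens n))" "TLB_class q n P = TLB_class q n R"
      unfolding R_def using P someI[of "\<lambda>R. R \<in> carrier (free_alg (TLB_gens n)) \<and> TLB_class q n P = TLB_class q n R" P] by auto
    have "R - P \<in> TLB_ideal q n" using TLB_class_eq[OF n3 R(1) P, of q] R(2) by simp
    then have "subst (sigma_Q u) (R - P) \<in> TLB_ideal q (Suc n)" by (rule sigma_Q_ideal[OF u _ free_alg_diff[OF R(1) P]])
    then have "TLB_class q (Suc n) (subst (sigma_Q u) R) = TLB_class q (Suc n) (subst (sigma_Q u) P)"
      using TLB_class_eq[OF N subst_sigma_Q_carrier[OF R(1), of u] subst_sigma_Q_carrier[OF P, of u], of q] by simp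
    then show ?thesis by (simp only: Q_def R_def)
  qed
  have hom: "Q \<in> ring_hom (TLB q n) (TLB q (Suc n))"
  proof (rule ring_hom_memI)
    fix X assume X: "X \<in> carrier (TLB q n)"
    obtain P where P: "P \<in> carrier (free_alg (TLB_gens n))" "X = TLB_class q n P" by (rule TLB_class_surj[OF n3 X])
    show "Q X \<in> carrier (TLB q (Suc n))" unfolding P(2) Q[OF P(1)] by (intro TLB_class_closed N subst_sigma_Q_carrier P)
    fix Y assume Y: "Y \<in> carrier (TLB q n)"
    obtain R where R: "R \<in> carrier (free_alg (TLB_gens n))" "Y = TLB_class q n R" by (rule TLB_class_surj[OF n3 Y])
    note s = subst_sigma_Q_carrier[OF P(1), of u] subst_sigma_Q_carrier[OF R(1), of u]
    show "Q (X \<otimes>\<^bsub>TLB q n\<^esub> Y) = Q X \<otimes>\<^bsub>TLB q (Suc n)\<^esub> Q Y"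
      unfolding P(2) R(2) TLB_class_mult[OF n3 P(1) R(1)] Q[OF P(1)] Q[OF R(1)] Q[OF free_alg_mult[OF P(1) R(1)]]
        TLB_class_mult[OF N s] by simp
    show "Q (X \<oplus>\<^bsub>TLB q n\<^esub> Y) = Q X \<oplus>\<^bsub>TLB q (Suc n)\<^esub> Q Y"
      unfolding P(2) R(2) TLB_class_add[OF n3 P(1) R(1)] Q[OF P(1)] Q[OF R(1)] Q[OF free_alg_add[OF P(1) R(1)]]
        TLB_class_add[OF N s] by simp
  next
    show "Q \<one>\<^bsub>TLB q n\<^esub> = \<one>\<^bsub>TLB q (Suc n)\<^esub>"
      unfolding TLB_class_one[OF n3] TLB_class_one[OF N] using Q[of 1] by simp
  qed
  have gen: "Q (TLB_gen q n a) = TLB_class q (Suc n) (sigma_Q u a)" if "a \<in> TLB_gens n" for a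
    using Q[of "gvar a"] that by (simp add: TLB_gen_def TLB_class_def[symmetric])
  have "Q (TLB_gen q n f) = TLB_gen q (Suc n) e \<otimes>\<^bsub>TLB q (Suc n)\<^esub> TLB_gen q (Suc n) f'
        \<otimes>\<^bsub>TLB q (Suc n)\<^esub> inv\<^bsub>TLB q (Suc n)\<^esub> TLB_gen q (Suc n) e"
  proof -
    have "TLB_gen q (Suc n) e \<otimes>\<^bsub>TLB q (Suc n)\<^esub> TLB_gen q (Suc n) f' \<otimes>\<^bsub>TLB q (Suc n)\<^esub> inv\<^bsub>TLB q (Suc n)\<^esub> TLB_gen q (Suc n) e
        = TLB_class q (Suc n) (gvar e * gvar f' * (scal u * (gvar e - scal (q - 1))))"
      unfolding TLB_inv_gen[OF N u gens_Suc(2)] unfolding TLB_gen_def TLB_class_def[symmetric]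
      using gens_Suc by (simp add: TLB_class_mult[OF N])
    moreover have "f \<in> TLB_gens n" by (simp add: TLB_gens_def)
    ultimately show ?thesis using gen[of f] by (simp add: sigma_Q_def)
  qed
  moreover have "Q (TLB_unit q n c) = TLB_unit q (Suc n) c" for c
    using Q[of "scal c"] by (simp add: TLB_unit_def TLB_class_def)
  moreover have "Q (TLB_gen q n a) = TLB_gen q (Suc n) a" if "a \<in> TLB_gens n" "a \<noteq> f" for a
    using gen[OF that(1)] that(2) by (simp add: sigma_Q_def TLB_gen_def TLB_class_def)
  ultimately have "TLB_arrow q n Q" using hom by (auto simp: TLB_arrow_def TLB_gens_def)
  then show ?thesis by blast
qed

end

text \<open>The map \<open>TLB_unit q 3\<close> is the arrow Q_2. The existence clause ensures that
  the statement about all arrows is not vacuous.\<close>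

theorem theorem6p4:
  fixes q :: "'k::comm_ring_1"
  assumes "q dvd 1"
  shows "inj (TLB_unit q 3) \<and>
    (\<forall>n\<ge>3. (\<exists>Q. TLB_arrow q n Q) \<and>
      (\<forall>Q. TLB_arrow q n Q \<longrightarrow> inj_on Q (carrier (TLB q n))))"
proof -
  obtain u where "u * q = 1" using assms by (metis dvd_def mult.commute)
  then show ?thesis
    using inj_TLB_unit[of 3 q] tlb_pair.arrow_exists tlb_pair.arrow_inj by (auto simp: tlb_pair_def)
qed

end
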